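(* Let $\mathcal{F} = \{H,T\} \cup \{\mathrm{F}_n \mid n\ge 1\}$ and $\mathcal{F}' = \{H,T\} \cup \{\mathrm{F}_n \mid n\ge 1\} \cup \{\mathrm{T}_n \mid n\ge 1\}$. For each of the two gate families $\mathcal{G}\in\{\mathcal{F},\mathcal{F}'\}$ there exists a family of quantum circuits $\{U_{n,d}\}_{n,d>0}$ that is depth-universal over $\mathcal{G}$. Moreover, $U_{n,d}$ uses $O(n^2 d)$ qubits, and the family can be constructed log-space uniformly in $n$ and $d$.
   Context: Gates: $H$ is the Hadamard gate and $T=\mathrm{diag}(1,e^{i\pi/4})$ is the $\pi/8$ gate. For $n\ge1$, the fanout gate $\mathrm{F}_n$ acts on $n+1$ qubits by $\lvert c,t_1,\ldots,t_n\rangle \mapsto \lvert c, c\oplus t_1,\ldots,c\oplus t_n\rangle$ on computational basis states (extended linearly); $\mathrm{F}_1$ is CNOT. The unbounded Toffoli gate $\mathrm{T}_n$ acts on $n+1$ qubits by $\lvert c_1,\ldots,c_n,t\rangle\mapsto \lvert c_1,\ldots,c_n, t\oplus \bigwedge_{i=1}^n c_i\rangle$. The depth of a circuit is the number of layers, where a layer is a set of gates acting simultaneously on pairwise disjoint sets of qubits. Universal circuit: fix $n>0$ and a collection $\mathcal{C}$ of quantum circuits on $n$ qubits. A quantum circuit $U$ on $n+m$ qubits (possibly plus ancilla qubits initialized to and returned to $\lvert 0\rangle$) is universal for $\mathcal{C}$ if for every $C\in\mathcal{C}$ there is a string $x\in\{0,1\}^m$ (the encoding) such that for all $y\in\{0,1\}^n$,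 $U(\lvert y\rangle\otimes\lvert x\rangle) = C\lvert y\rangle\otimes\lvert x\rangle$. Depth-universal: for a family $\mathcal{G}$ of unitary gates, a family $\{U_{n,d}\}_{n,d>0}$ is depth-universal over $\mathcal{G}$ if (1) $U_{n,d}$ is universal for the collection of $n$-qubit circuits of depth at most $d$ using gates from $\mathcal{G}$; (2) $U_{n,d}$ uses only gates from $\mathcal{G}$; (3) $U_{n,d}$ has depth $O(d)$; (4) the number $m$ of encoding qubits of $U_{n,d}$ is polynomial in $n$ and $d$. *)

theory Defs
  imports Complex_Main
begin

section \<open>Qubits and gates\<close>

text \<open>
  A basis state of an N-qubit register is a Boolean list of length N, and a state vector is the
  function of its amplitudes. The amplitudes at lists of any other length are meant to be 0, as
  they are for every vector obtained from \<open>ket\<close>, \<open>tensor\<close> and \<open>run\<close> below.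
\<close>

type_synonym state = "bool list \<Rightarrow> complex"

definition bitstrings :: "nat \<Rightarrow> bool list set" where
  "bitstrings k = {w. length w = k}"

definition ket :: "bool list \<Rightarrow> state" where
  "ket x = (\<lambda>z. of_bool (z = x))"

definition tensor :: "nat \<Rightarrow> state \<Rightarrow> state \<Rightarrow> state" where
  \<comment> \<open>the first factor is a state of \<open>k\<close> qubits\<close>
  "tensor k \<phi> \<psi> = (\<lambda>z. \<phi> (take k z) * \<psi> (drop k z))"

datatype gate = Hadamard | PiEighth | Fanout nat | Toffoli nat

fun arity :: "gate \<Rightarrow> nat" where
  "arity Hadamard = 1"
| "arity PiEighth = 1"
| "arity (Fanout n) = Suc n"
| "arity (Toffoli n) = Suc n"

text \<open>
  The image of a basis state. The control of a fanout gate comes first, the target of a Toffoli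
  gate comes last; on Booleans, \<open>\<noteq>\<close> is exclusive or.
\<close>

fun gate_ket :: "gate \<Rightarrow> bool list \<Rightarrow> state" where
  "gate_ket Hadamard w =
     (\<lambda>z. (ket [False] z + (if hd w then - 1 else 1) * ket [True] z) / complex_of_real (sqrt 2))"
| "gate_ket PiEighth w = (\<lambda>z. (if hd w then cis (pi / 4) else 1) * ket w z)"
| "gate_ket (Fanout n) w = ket (hd w # map (\<lambda>t. hd w \<noteq> t) (tl w))"
| "gate_ket (Toffoli n) w = ket (butlast w @ [last w \<noteq> (\<forall>c\<in>set (butlast w). c)])"

lemma ket_inner:
  assumes "x \<in> bitstrings k"
  shows "(\<Sum>z\<in>bitstrings k. cnj (ket x z) * f z) = f x"
proof -
  have "finite (bitstrings k)"
    unfolding bitstrings_def using finite_lists_length_eq[of "UNIV :: bool set" k] by simp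
  have "(\<Sum>z\<in>bitstrings k. cnj (ket x z) * f z) =
      (\<Sum>z\<in>bitstrings k. if z = x then f z else 0)"
    by (intro sum.cong) (auto simp: ket_def)
  with \<open>finite (bitstrings k)\<close> assms show ?thesis by simp
qed

lemma bitstrings_1: "bitstrings (Suc 0) = {[False], [True]}"
  by (auto simp: bitstrings_def length_Suc_conv)

lemma gate_unitary:
  assumes "v \<in> bitstrings (arity g)" "w \<in> bitstrings (arity g)"
  shows "(\<Sum>z\<in>bitstrings (arity g). cnj (gate_ket g v z) * gate_ket g w z) = of_bool (v = w)"
proof (cases g)
  case Hadamard
  then have "v = [False] \<or> v = [True]" "w = [False] \<or> w = [True]"
    using assms by (auto simp: bitstrings_def length_Suc_conv)
  with Hadamard show ?thesis
    by (elim disjE) (simp_all add: bitstrings_1 ket_def flip: of_real_mult)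
next
  case PiEighth
  then have "v = [False] \<or> v = [True]" "w = [False] \<or> w = [True]"
    using assms by (auto simp: bitstrings_def length_Suc_conv)
  with PiEighth show ?thesis
    by (elim disjE) (simp_all add: bitstrings_1 ket_def cis_cnj cis_mult)
next
  case (Fanout n)
  then obtain c xs c' ys where vw: "v = c # xs" "w = c' # ys" "length xs = n"
    using assms by (auto simp: bitstrings_def length_Suc_conv)
  have "map (\<lambda>t. c \<noteq> t) xs = map (\<lambda>t. c \<noteq> t) ys \<longleftrightarrow> xs = ys"
    by (rule inj_map_eq_map, unfold inj_def) blast
  then have *: "c # map (\<lambda>t. c \<noteq> t) xs = c' # map (\<lambda>t. c' \<noteq> t) ys \<longleftrightarrow> c # xs = c' # ys"
    by (metis list.inject)
  have "c # map (\<lambda>t. c \<noteq> t) xs \<in> bitstrings (Suc n)"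
    using vw by (simp add: bitstrings_def)
  from ket_inner[OF this] show ?thesis
    unfolding Fanout vw arity.simps gate_ket.simps list.sel
    by (simp only: ket_def *)
next
  case (Toffoli n)
  then have "length v = Suc n" "length w = Suc n"
    using assms by (simp_all add: bitstrings_def)
  then obtain xs t ys t' where vw: "v = xs @ [t]" "w = ys @ [t']" "length xs = n"
    by (metis length_Suc_conv_rev)
  have "xs @ [t \<noteq> (\<forall>c\<in>set xs. c)] \<in> bitstrings (Suc n)"
    using vw by (simp add: bitstrings_def)
  moreover have *: "xs @ [t \<noteq> (\<forall>c\<in>set xs. c)] = ys @ [t' \<noteq> (\<forall>c\<in>set ys. c)] \<longleftrightarrow>
      xs @ [t] = ys @ [t']"
    by (cases "xs = ys") (simp_all, blast)
  ultimately show ?thesis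
    unfolding Toffoli vw arity.simps gate_ket.simps butlast_snoc last_snoc
    by (simp only: ket_inner) (simp only: ket_def *)
qed

definition fanout_family :: "gate set" where
  "fanout_family = {Hadamard, PiEighth} \<union> {Fanout n | n. n \<ge> 1}"

definition fanout_toffoli_family :: "gate set" where
  "fanout_toffoli_family =
     {Hadamard, PiEighth} \<union> {Fanout n | n. n \<ge> 1} \<union> {Toffoli n | n. n \<ge> 1}"


section \<open>Circuits\<close>

text \<open>
  A placed gate carries the list of the qubits it acts on, in the order of its arguments. The
  gates of a layer act on disjoint sets of qubits, hence commute (\<open>apply_gate_commute\<close> below), so
  applying them one after the other in list order is their simultaneous action. Qubits not
  mentioned in a layer are left alone.
\<close>

type_synonym placed_gate = "gate \<times> nat list"
type_synonym layer = "placed_gate list"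
type_synonym circuit = "layer list"

definition layer_over :: "gate set \<Rightarrow> nat \<Rightarrow> layer \<Rightarrow> bool" where
  "layer_over G N L \<longleftrightarrow>
     (\<forall>(g, qs)\<in>set L. g \<in> G \<and> length qs = arity g \<and> set qs \<subseteq> {..<N}) \<and>
     distinct (concat (map snd L))"

definition circuit_over :: "gate set \<Rightarrow> nat \<Rightarrow> circuit \<Rightarrow> bool" where
  "circuit_over G N C \<longleftrightarrow> (\<forall>L\<in>set C. layer_over G N L)"

abbreviation depth :: "circuit \<Rightarrow> nat" where
  "depth C \<equiv> length C"

definition overwrite :: "nat list \<Rightarrow> bool list \<Rightarrow> bool list \<Rightarrow> bool list" where
  "overwrite qs w z = fold (\<lambda>(q, b) z. z[q := b]) (zip qs w) z"

text \<open>
  The gate tensored with the identity on the remaining qubits: its matrix entry at row \<open>z\<close> and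
  column \<open>z'\<close> vanishes unless \<open>z'\<close> agrees with \<open>z\<close> off \<open>qs\<close>, and is then the entry of the
  gate at the restrictions of \<open>z\<close> and \<open>z'\<close> to \<open>qs\<close>.
\<close>

definition apply_gate :: "placed_gate \<Rightarrow> state \<Rightarrow> state" where
  "apply_gate = (\<lambda>(g, qs) \<psi> z.
     \<Sum>w\<in>bitstrings (arity g). gate_ket g w (map ((!) z) qs) * \<psi> (overwrite qs w z))"

definition apply_layer :: "layer \<Rightarrow> state \<Rightarrow> state" where
  "apply_layer L = fold apply_gate L"

definition run :: "circuit \<Rightarrow> state \<Rightarrow> state" where
  "run C = fold apply_layer C"

lemma length_overwrite [simp]: "length (overwrite qs w z) = length z"
  unfolding overwrite_def by (induction qs w arbitrary: z rule: list_induct2') auto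

lemma nth_overwrite_outside: "q \<notin> set qs \<Longrightarrow> overwrite qs w z ! q = z ! q"
  unfolding overwrite_def by (induction qs w arbitrary: z rule: list_induct2') auto

lemma overwrite_update:
  "q \<notin> set qs \<Longrightarrow> overwrite qs w (z[q := b]) = (overwrite qs w z)[q := b]"
  unfolding overwrite_def
  by (induction qs w arbitrary: z rule: list_induct2') (auto simp: list_update_swap)

lemma overwrite_Cons: "overwrite (q # qs) (b # w) z = overwrite qs w (z[q := b])"
  by (simp add: overwrite_def)

lemma overwrite_commute:
  "set ps \<inter> set qs = {} \<Longrightarrow>
     overwrite ps v (overwrite qs w z) = overwrite qs w (overwrite ps v z)"
proof (induction ps v arbitrary: z rule: list_induct2')
  case (4 p ps b v)
  then have "p \<notin> set qs" "set ps \<inter> set qs = {}" by auto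
  with "4.IH" show ?case by (simp add: overwrite_Cons flip: overwrite_update)
qed (simp_all add: overwrite_def)

lemma apply_gate_commute:
  assumes "set ps \<inter> set qs = {}"
  shows "apply_gate (g, ps) (apply_gate (h, qs) \<psi>) = apply_gate (h, qs) (apply_gate (g, ps) \<psi>)"
proof
  fix z
  have *: "map ((!) (overwrite rs v z)) rs' = map ((!) z) rs'"
    if "set rs \<inter> set rs' = {}" for rs rs' v
    by (rule map_cong[OF refl], rule nth_overwrite_outside) (use that in blast)
  have "map ((!) (overwrite ps v z)) qs = map ((!) z) qs"
       "map ((!) (overwrite qs v z)) ps = map ((!) z) ps" for v
    using assms by (simp_all only: * inf_commute)
  then show "apply_gate (g, ps) (apply_gate (h, qs) \<psi>) z =
      apply_gate (h, qs) (apply_gate (g, ps) \<psi>) z"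
    unfolding apply_gate_def prod.case sum_distrib_left
    by (simp only: overwrite_commute[OF assms] mult.left_commute) (rule sum.swap)
qed


section \<open>Universal circuits\<close>

text \<open>
  The qubits of a circuit that is universal for n-qubit circuits are numbered with the n data
  qubits first, then the encoding qubits, then the ancillas.
\<close>

record universal_circuit =
  enc_qubits :: nat
  anc_qubits :: nat
  layers :: circuit

definition num_qubits :: "nat \<Rightarrow> universal_circuit \<Rightarrow> nat" where
  "num_qubits n U = n + enc_qubits U + anc_qubits U"

definition universal_for :: "nat \<Rightarrow> circuit set \<Rightarrow> universal_circuit \<Rightarrow> bool" where
  "universal_for n \<C> U \<longleftrightarrow>
     (\<forall>C\<in>\<C>. \<exists>x\<in>bitstrings (enc_qubits U). \<forall>y\<in>bitstrings n.
        run (layers U) (ket (y @ x @ replicate (anc_qubits U) False)) =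
        tensor n (run C (ket y)) (ket (x @ replicate (anc_qubits U) False)))"

definition circuits_of_depth :: "gate set \<Rightarrow> nat \<Rightarrow> nat \<Rightarrow> circuit set" where
  "circuits_of_depth G n d = {C. circuit_over G n C \<and> depth C \<le> d}"

definition depth_universal :: "gate set \<Rightarrow> (nat \<Rightarrow> nat \<Rightarrow> universal_circuit) \<Rightarrow> bool" where
  "depth_universal G U \<longleftrightarrow>
     (\<forall>n>0. \<forall>d>0. universal_for n (circuits_of_depth G n d) (U n d)) \<and>
     (\<forall>n>0. \<forall>d>0. circuit_over G (num_qubits n (U n d)) (layers (U n d))) \<and>
     (\<exists>c. \<forall>n>0. \<forall>d>0. depth (layers (U n d)) \<le> c * d) \<and>
     (\<exists>c k. \<forall>n>0. \<forall>d>0. enc_qubits (U n d) \<le> c * (n + d) ^ k)"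


section \<open>Log-space transducers\<close>

text \<open>
  Deterministic Turing machines with a read-only two-way input tape, finitely many one-way
  infinite work tapes and a write-only output tape. A cell is blank (\<open>None\<close>) or holds a symbol.
  The input occupies the cells 1, ..., length w of the input tape and is delimited by a blank cell
  on either side; the head cannot leave this range, so that its position is not free storage.
  A head at cell 0 stays there when told to go left.
\<close>

datatype move = Go_Left | Stay | Go_Right

fun shift :: "move \<Rightarrow> nat \<Rightarrow> nat" where
  "shift Go_Left p = p - 1"
| "shift Stay p = p"
| "shift Go_Right p = Suc p"

text \<open>
  \<open>trans\<close> maps the state, the input cell and the work tape cells under the heads to the new state,
  the move of the input head, what to write and how to move on each work tape, and the symbol to
  output, if any.
\<close>

record 'a transducer =
  num_states :: nat
  num_tapes :: nat
  start_state :: nat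
  halt_state :: nat
  trans :: "nat \<Rightarrow> 'a option \<Rightarrow> 'a option list \<Rightarrow>
    nat \<times> move \<times> ('a option \<times> move) list \<times> 'a option"

definition transducer :: "'a::finite transducer \<Rightarrow> bool" where
  "transducer M \<longleftrightarrow>
     start_state M < num_states M \<and> halt_state M < num_states M \<and>
     (\<forall>q<num_states M. \<forall>a us. length us = num_tapes M \<longrightarrow>
        (case trans M q a us of (q', _, acts, _) \<Rightarrow>
           q' < num_states M \<and> length acts = num_tapes M))"

record 'a config =
  control :: nat
  in_head :: nat
  work :: "((nat \<Rightarrow> 'a option) \<times> nat) list"
  out :: "'a list"

definition input_cell :: "'a list \<Rightarrow> nat \<Rightarrow> 'a option" where
  "input_cell w p = (if 1 \<le> p \<and> p \<le> length w then Some (w ! (p - 1)) else None)"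

definition initial :: "'a transducer \<Rightarrow> 'a config" where
  "initial M = \<lparr>control = start_state M, in_head = 0,
     work = replicate (num_tapes M) (\<lambda>_. None, 0), out = []\<rparr>"

definition step :: "'a transducer \<Rightarrow> 'a list \<Rightarrow> 'a config \<Rightarrow> 'a config" where
  "step M w c =
     (if control c = halt_state M then c
      else case trans M (control c) (input_cell w (in_head c)) (map (\<lambda>(t, p). t p) (work c)) of
        (q, mv, acts, b) \<Rightarrow>
          \<lparr>control = q,
           in_head = min (shift mv (in_head c)) (Suc (length w)),
           work = map2 (\<lambda>(a, m) (t, p). (t(p := a), shift m p)) acts (work c),
           out = out c @ (case b of None \<Rightarrow> [] | Some s \<Rightarrow> [s])\<rparr>)"

text \<open>
  Only the work tapes count towards the space. As the number of tapes is fixed, it is enough to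
  bound each of them.
\<close>

definition computes_in_space :: "'a transducer \<Rightarrow> 'a list \<Rightarrow> 'a list \<Rightarrow> real \<Rightarrow> bool" where
  "computes_in_space M w v s \<longleftrightarrow>
     (\<exists>t. control ((step M w ^^ t) (initial M)) = halt_state M \<and>
          out ((step M w ^^ t) (initial M)) = v) \<and>
     (\<forall>t. \<forall>(_, p)\<in>set (work ((step M w ^^ t) (initial M))). real (Suc p) \<le> s)"


section \<open>Uniformity\<close>

text \<open>
  A circuit is written down with qubit numbers and register sizes in binary (most significant bit
  first, no leading zeros). The number of arguments of a gate need not be written, as it can be
  read off from its list of qubits.
\<close>

fun binary :: "nat \<Rightarrow> string" where
  "binary k =
     (if k < 2 then [] else binary (k div 2)) @ [if odd k then CHR ''1'' else CHR ''0'']"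

declare binary.simps [simp del]

fun gate_symbol :: "gate \<Rightarrow> char" where
  "gate_symbol Hadamard = CHR ''H''"
| "gate_symbol PiEighth = CHR ''T''"
| "gate_symbol (Fanout n) = CHR ''F''"
| "gate_symbol (Toffoli n) = CHR ''A''"

definition describe_gate :: "placed_gate \<Rightarrow> string" where
  "describe_gate = (\<lambda>(g, qs).
     gate_symbol g # concat (map (\<lambda>q. binary q @ '','') qs) @ '';'')"

definition describe_layer :: "layer \<Rightarrow> string" where
  "describe_layer L = concat (map describe_gate L) @ ''/''"

definition describe :: "nat \<Rightarrow> universal_circuit \<Rightarrow> string" where
  "describe n U =
     binary n @ '','' @ binary (enc_qubits U) @ '','' @ binary (anc_qubits U) @ '':'' @
     concat (map describe_layer (layers U))"

text \<open>
  As usual for uniformity, the parameters are given in unary, so that logarithmic space means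
  space logarithmic in \<open>n + d\<close>.
\<close>

definition unary_input :: "nat \<Rightarrow> nat \<Rightarrow> string" where
  "unary_input n d = replicate n CHR ''1'' @ '','' @ replicate d CHR ''1''"

definition logspace_uniform :: "(nat \<Rightarrow> nat \<Rightarrow> universal_circuit) \<Rightarrow> bool" where
  "logspace_uniform U \<longleftrightarrow>
     (\<exists>(M :: char transducer) c. transducer M \<and>
        (\<forall>n>0. \<forall>d>0. computes_in_space M (unary_input n d) (describe n (U n d))
                        (c * log 2 (real (n + d)))))"

end

theory Submission
  imports Defs
begin

text \<open>
  Each layer of the simulated circuit is described by Boolean \<open>n \<times> n\<close> matrices in the encoding. The
  basic step adds \<open>m i j \<and> y i\<close> to an ancilla \<open>b i j\<close> for all \<open>i\<close> and \<open>j\<close> at once: it fans out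
  the data qubits to the rows of a block, multiplies cellwise by a Toffoli gate made of \<open>H\<close>, \<open>T\<close> and
  CNOT, and undoes the fanout. With diagonal matrices and \<open>T\<close> or \<open>Z = T\<^sup>4\<close> on the ancillas this
  yields controlled \<open>T\<close> and \<open>Z\<close> gates, hence controlled Hadamard gates, as \<open>H\<close> is conjugate to \<open>Z\<close>
  by a word in \<open>H\<close> and \<open>T\<close>. A layer of fanout gates adds to each data qubit the parity of a column,
  a layer of Toffoli gates the conjunction of a column; in both cases controls are not changed, so
  the ancillas can be cleared by the same step. For the computation, basis states are functions on
  all natural numbers and a block acts on the subspace of a fixed encoding just like the layer.

  The description of the circuit is printed by nested loops whose bounds are variables, with qubit
  numbers that are polynomials in the variables. Such programs are compiled to transducers that keep
  each of their polynomially bounded registers in binary on a tape.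
\<close>

section \<open>Wave functions on assignments\<close>

text \<open>The obstacle is constant depth per simulated layer: a data qubit may have to interact
  with any other one, while the gates of a layer must not share qubits. A fanout gate gives each
  data qubit a whole row of cells, so all n^2 conditional interactions take place on disjoint cells
  at the same time and no qubit is ever routed to another place. The gates of a layer commute, so
  they can be sorted by kind, and each kind gets a stage of fixed depth. A phase can be switched by
  a bit, since a phase gate on a cleared ancilla does nothing; a Hadamard gate cannot. Therefore the
  basis change V around the Z gate is applied to all data qubits unconditionally and only Z is
  switched: where the bit is off, V and its inverse cancel. Inverses of T are powers, because T^8 =
  1. The stages must be correct on superpositions, so they are compared as operators, but only on
  vectors supported where the encoding is right and the ancillas are clear. Elsewhere a stage may do
  something different from the simulated layer.\<close>

type_synonym assignment = "nat \<Rightarrow> bool"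
type_synonym wave = "assignment \<Rightarrow> complex"

type_synonym qubit_matrix = "bool \<Rightarrow> bool \<Rightarrow> complex"

definition sq :: "qubit_matrix \<Rightarrow> nat \<Rightarrow> wave \<Rightarrow> wave" where
  "sq U q \<phi> s = U (s q) False * \<phi> (s(q := False)) + U (s q) True * \<phi> (s(q := True))"

text \<open>A permutation of basis states acts on amplitudes by composition with its inverse. The
  maps of fanout and Toffoli gates are involutions, so pulling back along the map itself gives the
  gate. Composition reverses the order of the maps.\<close>

definition pull :: "(assignment \<Rightarrow> assignment) \<Rightarrow> wave \<Rightarrow> wave" where
  "pull f \<phi> s = \<phi> (f s)"

definition hmat :: qubit_matrix where
  "hmat a b = (if a \<and> b then - 1 else 1) / complex_of_real (sqrt 2)"

definition dmat :: "complex \<Rightarrow> qubit_matrix" where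
  "dmat u a b = (if a \<noteq> b then 0 else if a then u else 1)"

definition fan :: "nat \<Rightarrow> nat list \<Rightarrow> assignment \<Rightarrow> assignment" where
  "fan c ts s = (\<lambda>i. if i \<in> set ts then s i \<noteq> s c else s i)"

definition tof :: "nat list \<Rightarrow> nat \<Rightarrow> assignment \<Rightarrow> assignment" where
  "tof cs t s = s(t := (s t \<noteq> (\<forall>c\<in>set cs. s c)))"

fun ap :: "placed_gate \<Rightarrow> wave \<Rightarrow> wave" where
  "ap (Hadamard, qs) = sq hmat (hd qs)"
| "ap (PiEighth, qs) = sq (dmat (cis (pi / 4))) (hd qs)"
| "ap (Fanout n, qs) = pull (fan (hd qs) (tl qs))"
| "ap (Toffoli n, qs) = pull (tof (butlast qs) (last qs))"

section \<open>Gates on a finite register as operators on wave functions\<close>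

definition lift :: "nat \<Rightarrow> wave \<Rightarrow> state" where
  "lift N \<phi> = (\<lambda>z. if length z = N then \<phi> ((!) z) else 0)"

text \<open>Indices beyond the length cause no exception: the unspecified value of
  \<open>nth\<close> there survives an update. So \<open>lift\<close> is compatible with updates
  however the assignment continues beyond the register.\<close>

lemma nth_update_fun: "q < length z \<Longrightarrow> (!) (z[q := b]) = ((!) z)(q := b)"
  by (rule ext) auto

lemma nth_overwrite:
  assumes "set qs \<subseteq> {..<length z}"
  shows "(!) (overwrite qs (map h qs) z) = (\<lambda>i. if i \<in> set qs then h i else z ! i)"
  using assms
proof (induction qs arbitrary: z)
  case Nil
  then show ?case by (simp add: overwrite_def)
next
  case (Cons q qs)
  then have "q < length z" by simp
  from Cons.IH[of "z[q := h q]"] Cons.prems this show ?case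
    by (auto simp: overwrite_Cons fun_eq_iff)
qed

lemma finite_bitstrings: "finite (bitstrings k)"
  unfolding bitstrings_def using finite_lists_length_eq[of "UNIV :: bool set" k] by simp

text \<open>Only the term \<open>w = g v\<close> of the matrix-vector product survives. For an
  involution no inverse has to be named, and both multi-qubit gates are of this kind.\<close>

lemma sum_ket_involution:
  assumes "v \<in> bitstrings k" "g v \<in> bitstrings k"
    and "\<And>w. w \<in> bitstrings k \<Longrightarrow> g (g w) = w"
  shows "(\<Sum>w\<in>bitstrings k. ket (g w) v * F w) = F (g v)"
proof -
  have "(\<Sum>w\<in>bitstrings k. ket (g w) v * F w) = (\<Sum>w\<in>bitstrings k. if w = g v then F w else 0)"
  proof (intro sum.cong refl)
    fix w assume "w \<in> bitstrings k"
    then have "v = g w \<longleftrightarrow> w = g v" using assms by metis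
    then show "ket (g w) v * F w = (if w = g v then F w else 0)" by (simp add: ket_def)
  qed
  with assms(2) show ?thesis by (simp add: finite_bitstrings)
qed

lemma apply_gate_lift:
  assumes "length qs = arity g" "distinct qs" "set qs \<subseteq> {..<N}"
  shows "apply_gate (g, qs) (lift N \<phi>) = lift N (ap (g, qs) \<phi>)"
proof
  fix z
  show "apply_gate (g, qs) (lift N \<phi>) z = lift N (ap (g, qs) \<phi>) z"
  proof (cases "length z = N")
    case False
    then show ?thesis by (simp add: apply_gate_def lift_def)
  next
    case N: True
    show ?thesis
    proof (cases g)
      case Hadamard
      then obtain q where "qs = [q]" using assms by (auto simp: length_Suc_conv)
      with Hadamard N assms show ?thesis
        by (simp add: apply_gate_def lift_def bitstrings_1 overwrite_def nth_update_fun sq_def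
            hmat_def ket_def field_simps)
    next
      case PiEighth
      then obtain q where "qs = [q]" using assms by (auto simp: length_Suc_conv)
      with PiEighth N assms show ?thesis
        by (simp add: apply_gate_def lift_def bitstrings_1 overwrite_def nth_update_fun sq_def
            dmat_def ket_def)
    next
      case (Fanout n)
      then obtain c ts where qs: "qs = c # ts" "length ts = n" using assms by (auto simp: length_Suc_conv)
      \<comment> \<open>\<open>G\<close> acts on the argument list of the gate; \<open>h\<close> is
        the same action indexed by qubit numbers, the form that \<open>nth_overwrite\<close> can
        use.\<close>
      define G where "G w = (hd w # map (\<lambda>t. hd w \<noteq> t) (tl w))" for w :: "bool list"
      define h where "h q = (if q = c then z ! c else z ! q \<noteq> z ! c)" for q
      have "apply_gate (g, qs) (lift N \<phi>) z =
          (\<Sum>w\<in>bitstrings (Suc n). ket (G w) (map ((!) z) qs) * lift N \<phi> (overwrite qs w z))"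
        by (simp add: apply_gate_def Fanout G_def)
      also have "\<dots> = lift N \<phi> (overwrite qs (G (map ((!) z) qs)) z)"
        by (rule sum_ket_involution)
          (use qs in \<open>auto simp: G_def bitstrings_def length_Suc_conv intro!: map_idI\<close>)
      also have "G (map ((!) z) qs) = map h qs"
        using assms(2) by (auto simp: qs G_def h_def)
      also have "lift N \<phi> (overwrite qs (map h qs) z) = lift N (ap (g, qs) \<phi>) z"
      proof -
        have "(\<lambda>i. if i \<in> set qs then h i else z ! i) = fan c ts ((!) z)"
          using assms(2) by (auto simp: fun_eq_iff fan_def h_def qs)
        then have "(!) (overwrite qs (map h qs) z) = fan c ts ((!) z)"
          using nth_overwrite[of qs z h] N assms(3) by simp
        then show ?thesis
          using N unfolding lift_def by (simp add: Fanout pull_def) (simp add: qs)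
      qed
      finally show ?thesis .
    next
      case (Toffoli n)
      then obtain cs t where qs: "qs = cs @ [t]" "length cs = n"
        using assms by (auto simp: length_Suc_conv_rev)
      define G where "G w = butlast w @ [last w \<noteq> (\<forall>c\<in>set (butlast w). c)]" for w :: "bool list"
      define h where "h q = (if q = t then z ! t \<noteq> (\<forall>c\<in>set cs. z ! c) else z ! q)" for q
      have "apply_gate (g, qs) (lift N \<phi>) z =
          (\<Sum>w\<in>bitstrings (Suc n). ket (G w) (map ((!) z) qs) * lift N \<phi> (overwrite qs w z))"
        by (simp add: apply_gate_def Toffoli G_def)
      also have "\<dots> = lift N \<phi> (overwrite qs (G (map ((!) z) qs)) z)"
      proof (rule sum_ket_involution)
        fix w :: "bool list" assume "w \<in> bitstrings (Suc n)"
        then obtain u b where "w = u @ [b]" by (auto simp: bitstrings_def length_Suc_conv_rev)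
        then show "G (G w) = w" by (auto simp: G_def)
      qed (use qs in \<open>auto simp: G_def bitstrings_def\<close>)
      also have "G (map ((!) z) qs) = map h qs"
        using assms(2) by (auto simp: qs G_def h_def)
      also have "lift N \<phi> (overwrite qs (map h qs) z) = lift N (ap (g, qs) \<phi>) z"
      proof -
        have "(\<lambda>i. if i \<in> set qs then h i else z ! i) = tof cs t ((!) z)"
          using assms(2) by (auto simp: fun_eq_iff tof_def h_def qs)
        then have "(!) (overwrite qs (map h qs) z) = tof cs t ((!) z)"
          using nth_overwrite[of qs z h] N assms(3) by simp
        then show ?thesis
          using N unfolding lift_def by (simp add: Toffoli pull_def) (simp add: qs)
      qed
      finally show ?thesis .
    qed
  qed
qed

abbreviation runf :: "circuit \<Rightarrow> wave \<Rightarrow> wave" where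
  "runf C \<equiv> fold ap (concat C)"

lemma distinct_concat_nth: "distinct (concat xss) \<Longrightarrow> xs \<in> set xss \<Longrightarrow> distinct xs"
  by (induction xss) auto

lemma apply_layer_lift:
  assumes "layer_over G N L"
  shows "apply_layer L (lift N \<phi>) = lift N (fold ap L \<phi>)"
proof -
  have "apply_layer L' (lift N \<phi>) = lift N (fold ap L' \<phi>)" if "set L' \<subseteq> set L" for L' \<phi>
    using that
  proof (induction L' arbitrary: \<phi>)
    case (Cons p L')
    obtain g qs where p: "p = (g, qs)" by force
    with Cons.prems have "(g, qs) \<in> set L" by auto
    with assms have "length qs = arity g" "set qs \<subseteq> {..<N}" "distinct qs"
      by (auto simp: layer_over_def intro!: distinct_concat_nth[of "map snd L"] rev_image_eqI)
    from apply_gate_lift[OF this(1,3,2)] Cons show ?case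
      by (simp add: apply_layer_def p)
  qed (simp add: apply_layer_def)
  then show ?thesis by blast
qed

lemma run_lift: "circuit_over G N C \<Longrightarrow> run C (lift N \<phi>) = lift N (runf C \<phi>)"
  by (induction C arbitrary: \<phi>) (auto simp: circuit_over_def run_def apply_layer_lift[of G])

lemma ket_lift: "length w = N \<Longrightarrow> ket w = lift N (\<lambda>s. of_bool (\<forall>i<N. s i = w ! i))"
  by (auto simp: ket_def lift_def fun_eq_iff list_eq_iff_nth_eq)

lemma tensor_ket: "length y = n \<Longrightarrow> tensor n (ket y) (ket x) = ket (y @ x)"
proof
  fix z assume "length y = n"
  then have "z = y @ x \<longleftrightarrow> take n z = y \<and> drop n z = x"
    by (metis append_eq_conv_conj append_take_drop_id)
  then show "tensor n (ket y) (ket x) z = ket (y @ x) z"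
    by (simp add: tensor_def ket_def)
qed

lemma overwrite_take_drop:
  assumes "set qs \<subseteq> {..<n}"
  shows "take n (overwrite qs w z) = overwrite qs w (take n z)"
    and "drop n (overwrite qs w z) = drop n z"
  using assms
proof (induction qs w arbitrary: z rule: list_induct2')
  case (4 q qs b w)
  case 1 with 4 show ?case by (simp add: overwrite_Cons take_update_swap)
next
  case (4 q qs b w)
  case 2 with 4 show ?case by (simp add: overwrite_Cons)
qed (simp_all add: overwrite_def)

lemma apply_gate_tensor:
  assumes "set qs \<subseteq> {..<n}"
  shows "apply_gate (g, qs) (tensor n \<psi> \<chi>) = tensor n (apply_gate (g, qs) \<psi>) \<chi>"
proof
  fix z :: "bool list"
  have "map ((!) (take n z)) qs = map ((!) z) qs" using assms by auto
  then show "apply_gate (g, qs) (tensor n \<psi> \<chi>) z = tensor n (apply_gate (g, qs) \<psi>) \<chi> z"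
    unfolding apply_gate_def tensor_def prod.case overwrite_take_drop[OF assms]
    by (simp only: sum_distrib_right mult.assoc)
qed

text \<open>The universal and the simulated circuit are compared on the large register; this splits
  off the untouched qubits at the end.\<close>

lemma run_tensor:
  assumes "circuit_over G n C"
  shows "run C (tensor n \<psi> \<chi>) = tensor n (run C \<psi>) \<chi>"
proof -
  have "apply_layer L (tensor n \<psi> \<chi>) = tensor n (apply_layer L \<psi>) \<chi>"
    if "\<forall>(g, qs)\<in>set L. set qs \<subseteq> {..<n}" for L \<psi>
    using that
    by (induction L arbitrary: \<psi>) (auto simp: apply_layer_def apply_gate_tensor)
  moreover have "\<forall>L\<in>set C. \<forall>(g, qs)\<in>set L. set qs \<subseteq> {..<n}"
    using assms by (fastforce simp: circuit_over_def layer_over_def)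
  ultimately show ?thesis
    by (induction C arbitrary: \<psi>) (simp_all add: run_def)
qed

section \<open>Operators local to a set of qubits\<close>

definition supported_on :: "nat set \<Rightarrow> (assignment \<Rightarrow> 'b) \<Rightarrow> bool" where
  "supported_on Q a \<longleftrightarrow> (\<forall>s s'. (\<forall>i\<in>Q. s i = s' i) \<longrightarrow> a s = a s')"

definition local_map :: "nat set \<Rightarrow> (assignment \<Rightarrow> assignment) \<Rightarrow> bool" where
  "local_map Q f \<longleftrightarrow> (\<forall>s i. i \<notin> Q \<longrightarrow> f s i = s i) \<and> (\<forall>i\<in>Q. supported_on Q (\<lambda>s. f s i))"

text \<open>A common normal form of one-qubit matrices, where the two maps set the qubit to false
  and true, and of basis permutations, where \<open>b\<close> vanishes. One commutation lemma then
  covers all gates.\<close>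

definition local_op :: "nat set \<Rightarrow> (wave \<Rightarrow> wave) \<Rightarrow> bool" where
  "local_op Q A \<longleftrightarrow> (\<exists>a f b g. supported_on Q a \<and> supported_on Q b \<and> local_map Q f \<and> local_map Q g \<and>
     (\<forall>\<phi> s. A \<phi> s = a s * \<phi> (f s) + b s * \<phi> (g s)))"

lemma supported_on_local_map:
  assumes "supported_on P a" "local_map Q f" "P \<inter> Q = {}"
  shows "a (f s) = a s"
  using assms unfolding supported_on_def local_map_def by (metis disjoint_iff)

lemma local_map_commute:
  assumes "local_map P f" "local_map Q g" "P \<inter> Q = {}"
  shows "f (g s) = g (f s)"
proof
  fix i
  consider "i \<in> P" "i \<notin> Q" | "i \<in> Q" "i \<notin> P" | "i \<notin> P" "i \<notin> Q" using assms(3) by blast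
  then show "f (g s) i = g (f s) i"
  proof cases
    case 1
    then have "f (g s) i = f s i"
      using supported_on_local_map[of P "\<lambda>s. f s i" Q g s] assms by (auto simp: local_map_def)
    with 1 assms show ?thesis by (auto simp: local_map_def)
  next
    case 2
    then have "g (f s) i = g s i"
      using supported_on_local_map[of Q "\<lambda>s. g s i" P f s] assms by (auto simp: local_map_def)
    with 2 assms show ?thesis by (auto simp: local_map_def)
  next
    case 3
    with assms show ?thesis by (auto simp: local_map_def)
  qed
qed

text \<open>The coefficients of one operator are blind to the maps of the other, and these maps
  commute, so the four terms of the two products agree.\<close>

lemma local_op_commute:
  assumes "local_op P A" "local_op Q B" "P \<inter> Q = {}"
  shows "A (B \<phi>) = B (A \<phi>)"
proof -
  obtain a f b g where A: "supported_on P a" "supported_on P b" "local_map P f" "local_map P g"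
    "\<And>\<phi> s. A \<phi> s = a s * \<phi> (f s) + b s * \<phi> (g s)" using assms(1) unfolding local_op_def by blast
  obtain c h d k where B: "supported_on Q c" "supported_on Q d" "local_map Q h" "local_map Q k"
    "\<And>\<phi> s. B \<phi> s = c s * \<phi> (h s) + d s * \<phi> (k s)" using assms(2) unfolding local_op_def by blast
  have QP: "Q \<inter> P = {}" using assms(3) by blast
  show ?thesis
    by (rule ext)
      (simp add: A(5) B(5) supported_on_local_map[OF A(1) B(3) assms(3)] supported_on_local_map[OF A(2) B(3) assms(3)]
       supported_on_local_map[OF A(1) B(4) assms(3)] supported_on_local_map[OF A(2) B(4) assms(3)]
       supported_on_local_map[OF B(1) A(3) QP] supported_on_local_map[OF B(2) A(3) QP]
       supported_on_local_map[OF B(1) A(4) QP] supported_on_local_map[OF B(2) A(4) QP]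
       local_map_commute[OF A(3) B(3) assms(3)] local_map_commute[OF A(4) B(3) assms(3)]
       local_map_commute[OF A(3) B(4) assms(3)] local_map_commute[OF A(4) B(4) assms(3)]
       algebra_simps)
qed

lemma local_op_sq: "local_op {q} (sq U q)"
  unfolding local_op_def
  by (rule exI[of _ "\<lambda>s. U (s q) False"], rule exI[of _ "\<lambda>s. s(q := False)"],
      rule exI[of _ "\<lambda>s. U (s q) True"], rule exI[of _ "\<lambda>s. s(q := True)"])
    (auto simp: sq_def supported_on_def local_map_def)

lemma local_op_pull: "local_map Q f \<Longrightarrow> local_op Q (pull f)"
  unfolding local_op_def
  by (rule exI[of _ "\<lambda>_. 1"], rule exI[of _ f], rule exI[of _ "\<lambda>_. 0"], rule exI[of _ f])
    (auto simp: pull_def supported_on_def)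

lemma local_map_fan: "local_map (insert c (set ts)) (fan c ts)"
  by (auto simp: local_map_def fan_def supported_on_def)

lemma local_map_tof: "local_map (insert t (set cs)) (tof cs t)"
  by (auto simp: local_map_def tof_def supported_on_def)

lemma local_op_ap:
  assumes "length qs = arity g"
  shows "local_op (set qs) (ap (g, qs))"
proof (cases g)
  case (Fanout n)
  with assms show ?thesis
    using local_op_pull[OF local_map_fan] by (auto simp: length_Suc_conv)
next
  case (Toffoli n)
  with assms show ?thesis
    using local_op_pull[OF local_map_tof] by (auto simp: length_Suc_conv_rev)
qed (use assms local_op_sq in \<open>auto simp: length_Suc_conv\<close>)

section \<open>Reordering products of commuting operators\<close>

lemma commute_fold:
  "(\<And>x \<phi>. x \<in> set xs \<Longrightarrow> A (F x \<phi>) = F x (A \<phi>)) \<Longrightarrow> A (fold F xs \<phi>) = fold F xs (A \<phi>)"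
  by (induction xs arbitrary: \<phi>) auto

text \<open>Each \<open>B k\<close> can be moved past the \<open>A k'\<close> of all other indices
  until it directly follows \<open>A k\<close>, so two sweeps merge into one.\<close>

lemma fold_weave:
  assumes "distinct ks"
    and "\<And>k k' \<phi>. k \<in> set ks \<Longrightarrow> k' \<in> set ks \<Longrightarrow> k \<noteq> k' \<Longrightarrow> B k (A k' \<phi>) = A k' (B k \<phi>)"
  shows "fold B ks (fold A ks \<phi>) = fold (\<lambda>k \<phi>. B k (A k \<phi>)) ks \<phi>"
  using assms
proof (induction ks arbitrary: \<phi>)
  case (Cons k ks)
  have "B k (fold A ks (A k \<phi>)) = fold A ks (B k (A k \<phi>))"
    by (rule commute_fold) (use Cons.prems in auto)
  with Cons show ?case by simp
qed simp

text \<open>Running a word layer by layer in all cells is running it cell by cell, as different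
  cells do not interact. This reduces a word on whole blocks to a computation on the few qubits of
  one cell.\<close>

lemma fold_rows:
  assumes "distinct ks"
    and "\<And>k k' g h \<phi>. k \<in> set ks \<Longrightarrow> k' \<in> set ks \<Longrightarrow> k \<noteq> k' \<Longrightarrow> g \<in> set gs \<Longrightarrow> h \<in> set gs \<Longrightarrow>
      F g k (F h k' \<phi>) = F h k' (F g k \<phi>)"
  shows "fold (\<lambda>g. fold (F g) ks) gs \<phi> = fold (\<lambda>k. fold (\<lambda>g. F g k) gs) ks \<phi>"
  using assms(2)
proof (induction gs arbitrary: \<phi>)
  case Nil
  have "fold (\<lambda>k a. a) ks \<phi> = \<phi>" by (induction ks) auto
  then show ?case by (simp add: id_def)
next
  case (Cons g gs)
  have "fold (\<lambda>k. fold (\<lambda>g. F g k) gs) ks (fold (F g) ks \<phi>) =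
      fold (\<lambda>k \<phi>. fold (\<lambda>g. F g k) gs (F g k \<phi>)) ks \<phi>"
  proof (rule fold_weave[OF assms(1)])
    fix k k' \<phi> assume k: "k \<in> set ks" "k' \<in> set ks" "k \<noteq> k'"
    show "fold (\<lambda>g. F g k) gs (F g k' \<phi>) = F g k' (fold (\<lambda>g. F g k) gs \<phi>)"
      by (rule commute_fold[symmetric]) (use Cons.prems[of k' k] k in auto)
  qed
  with Cons show ?case by simp
qed

lemma fold_same_mset:
  assumes "\<And>x y \<phi>. x \<in> set xs \<Longrightarrow> y \<in> set xs \<Longrightarrow> F x (F y \<phi>) = F y (F x \<phi>)"
    and "distinct xs" "distinct ys" "set xs = set ys"
  shows "fold F xs \<phi> = fold F ys \<phi>"
  using assms
proof (induction xs arbitrary: ys \<phi>)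
  case (Cons x xs)
  then obtain us vs where ys: "ys = us @ x # vs" by (metis list.set_intros(1) split_list)
  have "fold F us (F x \<phi>) = F x (fold F us \<phi>)"
    by (rule commute_fold[symmetric]) (use Cons.prems ys in auto)
  then have "fold F ys \<phi> = fold F (us @ vs) (F x \<phi>)" by (simp add: ys)
  also have "\<dots> = fold F xs (F x \<phi>)"
  proof (rule Cons.IH[symmetric])
    have "set xs = set (x # xs) - {x}" using Cons.prems(2) by auto
    also have "\<dots> = set (us @ vs)" using Cons.prems(3) by (subst Cons.prems(4)) (auto simp: ys)
    finally show "set xs = set (us @ vs)" .
  qed (use Cons.prems ys in auto)
  finally show ?case by simp
qed simp

section \<open>Gadgets\<close>

abbreviation \<omega> :: complex where "\<omega> \<equiv> cis (pi / 4)"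

lemma sqrt2_square: "complex_of_real (sqrt 2) * complex_of_real (sqrt 2) = 2"
  by (simp flip: of_real_mult)

lemma omega_power_8: "\<omega> ^ 8 = 1"
  by (simp add: DeMoivre)

lemma omega_power_4: "\<omega> ^ 4 = - 1"
  by (simp add: DeMoivre)

lemma sq_dmat: "sq (dmat u) q \<phi> s = (if s q then u else 1) * \<phi> s"
  by (auto simp: sq_def dmat_def fun_upd_idem)

lemma sq_dmat_power: "(sq (dmat u) q ^^ k) \<phi> = sq (dmat (u ^ k)) q \<phi>"
  by (induction k) (auto simp: fun_eq_iff sq_dmat)

definition mprod :: "qubit_matrix \<Rightarrow> qubit_matrix \<Rightarrow> qubit_matrix" where
  "mprod U W a b = U a False * W False b + U a True * W True b"

definition idm :: qubit_matrix where
  "idm a b = of_bool (a = b)"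

lemma sq_sq: "sq U q (sq W q \<phi>) = sq (mprod U W) q \<phi>"
  by (rule ext) (simp add: sq_def mprod_def algebra_simps)

lemma sq_idm: "sq idm q \<phi> = \<phi>"
  by (rule ext) (auto simp: sq_def idm_def fun_upd_idem)

lemma hmat_hmat: "mprod hmat hmat = idm"
  by (simp add: fun_eq_iff mprod_def hmat_def idm_def flip: of_real_mult)

lemma sq_commute: "p \<noteq> q \<Longrightarrow> sq U p (sq W q \<phi>) = sq W q (sq U p \<phi>)"
  by (rule local_op_commute[OF local_op_sq local_op_sq]) simp

lemma fold_sq_fold_sq:
  "distinct qs \<Longrightarrow> fold (\<lambda>q. sq (U q) q) qs (fold (\<lambda>q. sq (W q) q) qs \<phi>) =
    fold (\<lambda>q. sq (mprod (U q) (W q)) q) qs \<phi>"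
  by (subst fold_weave) (auto simp: sq_commute sq_sq)

lemma sq_idm_fun: "sq idm = (\<lambda>_ a. a)"
  by (intro ext) (simp add: sq_idm)

lemma fold_const_id: "fold (\<lambda>_ a. a) xs \<phi> = \<phi>"
  by (induction xs) auto

lemma fold_hmat_twice: "distinct qs \<Longrightarrow> fold (sq hmat) qs (fold (sq hmat) qs \<phi>) = \<phi>"
  using fold_sq_fold_sq[of qs "\<lambda>_. hmat" "\<lambda>_. hmat" \<phi>]
  by (simp add: hmat_hmat sq_idm_fun fold_const_id)

lemma pull_pull: "pull f (pull g \<phi>) = pull (\<lambda>s. g (f s)) \<phi>"
  by (simp add: pull_def fun_eq_iff)

lemma fold_pull: "fold (\<lambda>k. pull (f k)) ks \<phi> = pull (foldr f ks) \<phi>"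
  by (induction ks arbitrary: \<phi>) (simp_all add: pull_def fun_eq_iff)

lemma fan_Cons: "c \<notin> set (t # ts) \<Longrightarrow> distinct (t # ts) \<Longrightarrow> fan c (t # ts) s = fan c [t] (fan c ts s)"
  by (auto simp: fan_def fun_eq_iff)

lemma fan_foldr: "c \<notin> set ts \<Longrightarrow> distinct ts \<Longrightarrow> fan c ts = foldr (\<lambda>t. fan c [t]) ts"
proof (induction ts)
  case (Cons t ts)
  then have IH: "foldr (\<lambda>t. fan c [t]) ts = fan c ts" by simp
  show ?case using Cons.prems by (intro ext) (simp only: fan_Cons[OF Cons.prems] foldr.simps IH comp_def)
qed (auto simp: fan_def fun_eq_iff)

lemma fan_one: "fan c [t] s = s(t := (s t \<noteq> s c))"
  by (rule ext) (auto simp: fan_def)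

text \<open>
  A Toffoli gate from \<open>(-1)\<^sup>a\<^sup>m\<^sup>b = \<omega>\<^sup>e\<close> with
  \<open>e = a + m + b - (a \<oplus> m) - (m \<oplus> b) - (a \<oplus> b) + (a \<oplus> m \<oplus> b)\<close>, where \<open>T\<^sup>7\<close> stands
  for the inverse of \<open>T\<close>. It is polymorphic in the names of the qubits so that one word describes
  all cells of a block at once.
\<close>

definition gadget :: "'a \<Rightarrow> 'a \<Rightarrow> 'a \<Rightarrow> (gate \<times> 'a list) list" where
  "gadget a m b =
     [(Hadamard, [b]), (PiEighth, [a]), (PiEighth, [m]), (PiEighth, [b]), (Fanout 1, [a, m])] @
     replicate 7 (PiEighth, [m]) @ [(Fanout 1, [b, m]), (PiEighth, [m]), (Fanout 1, [a, m])] @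
     replicate 7 (PiEighth, [m]) @ [(Fanout 1, [b, m]), (Fanout 1, [a, b])] @
     replicate 7 (PiEighth, [b]) @ [(Fanout 1, [a, b]), (Hadamard, [b])]"

text \<open>The gadget without its two Hadamard gates is a doubly controlled Z. The CNOTs form the
  parities one after the other and undo them, and the collected exponent of \<omega> is 4 if all
  three bits are set and 0 otherwise. As operators are nested, the first gate in time is
  innermost.\<close>

lemma gadget_phase:
  assumes "a \<noteq> m" "a \<noteq> b" "m \<noteq> b"
  shows "pull (fan a [b]) (sq (dmat (\<omega> ^ 7)) b (pull (fan a [b]) (pull (fan b [m])
     (sq (dmat (\<omega> ^ 7)) m (pull (fan a [m]) (sq (dmat \<omega>) m (pull (fan b [m])
     (sq (dmat (\<omega> ^ 7)) m (pull (fan a [m]) (sq (dmat \<omega>) b (sq (dmat \<omega>) m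
     (sq (dmat \<omega>) a \<phi>)))))))))))) = (\<lambda>s. (if s a \<and> s m \<and> s b then - 1 else 1) * \<phi> s)"
    (is "?L = _")
proof
  fix s :: assignment
  have *: "s(m := s m, b := s b) = s" "s(b := s b, m := s m) = s" by auto
  have w: "\<omega> ^ 7 * \<omega> = 1" "\<omega> * \<omega> ^ 7 = 1" "\<omega> * (\<omega> ^ 7 * x) = x" "\<omega> ^ 7 * (\<omega> * x) = x" for x
    using omega_power_8 by (simp_all add: power_Suc[symmetric] power_Suc2[symmetric] mult.assoc[symmetric])
  have w3: "\<omega> * (\<omega> * (\<omega> * (\<omega> * x))) = - x" for x
    using omega_power_4 by (simp add: numeral_eq_Suc mult.assoc[symmetric])
  show "?L s = (if s a \<and> s m \<and> s b then - 1 else 1) * \<phi> s"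
    using assms assms[symmetric]
    by (cases "s a"; cases "s m"; cases "s b")
      (simp_all add: pull_def sq_dmat fan_one fun_upd_twist fun_upd_idem w w3)
qed

text \<open>HZH = X turns the doubly controlled Z into a Toffoli gate. In use, \<open>h\<close>
  sends a block number to its qubit in a fixed cell.\<close>

lemma gadget:
  assumes "h a \<noteq> h m" "h a \<noteq> h b" "h m \<noteq> h b"
  shows "fold (\<lambda>(g, rs). ap (g, map h rs)) (gadget a m b) \<phi> = pull (tof [h a, h m] (h b)) \<phi>"
proof -
  have "fold (\<lambda>(g, rs). ap (g, map h rs)) (gadget a m b) \<phi> =
      sq hmat (h b) (\<lambda>s. (if s (h a) \<and> s (h m) \<and> s (h b) then - 1 else 1) * sq hmat (h b) \<phi> s)"
    unfolding gadget_def
    by (simp add: fold_replicate sq_dmat_power gadget_phase[OF assms])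
  also have "\<dots> = pull (tof [h a, h m] (h b)) \<phi>"
  proof
    fix s :: assignment
    have [simp]: "s(h b := True) = s" if "s (h b)" using that by (auto simp: fun_eq_iff)
    have [simp]: "s(h b := False) = s" if "\<not> s (h b)" using that by (auto simp: fun_eq_iff)
    show "sq hmat (h b) (\<lambda>s. (if s (h a) \<and> s (h m) \<and> s (h b) then - 1 else 1) *
        sq hmat (h b) \<phi> s) s = pull (tof [h a, h m] (h b)) \<phi> s"
      using assms sqrt2_square
      by (cases "s (h a)"; cases "s (h m)"; cases "s (h b)")
        (simp_all add: pull_def sq_def hmat_def tof_def field_simps)
  qed
  finally show ?thesis .
qed

text \<open>The Hadamard gates off \<open>c\<close> and \<open>t\<close> commute with the CNOT and
  cancel in pairs, which leaves the familiar two-qubit identity.\<close>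

lemma conjugate_fan_one:
  assumes "distinct Q" "c \<in> set Q" "t \<in> set Q" "c \<noteq> t"
  shows "fold (sq hmat) Q (pull (fan c [t]) (fold (sq hmat) Q \<phi>)) = pull (fan t [c]) \<phi>"
proof -
  define R where "R = filter (\<lambda>q. q \<noteq> c \<and> q \<noteq> t) Q"
  have R: "distinct R" "c \<notin> set R" "t \<notin> set R" using assms by (auto simp: R_def)
  \<comment> \<open>Two arrangements of the same product: the first is used after the CNOT and the
    second before it, so that the two sweeps over \<open>R\<close> meet at the CNOT.\<close>
  have Q: "fold (sq hmat) Q \<psi> = sq hmat c (sq hmat t (fold (sq hmat) R \<psi>))"
    "fold (sq hmat) Q \<psi> = fold (sq hmat) R (sq hmat t (sq hmat c \<psi>))" for \<psi>
  proof -
    have comm: "sq hmat x (sq hmat y \<psi>) = sq hmat y (sq hmat x \<psi>)" for x y \<psi>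
      by (cases "x = y") (auto simp: sq_commute)
    have "fold (sq hmat) Q \<psi> = fold (sq hmat) (R @ [t, c]) \<psi>"
      by (rule fold_same_mset) (use assms R comm in \<open>auto simp: R_def\<close>)
    then show "fold (sq hmat) Q \<psi> = sq hmat c (sq hmat t (fold (sq hmat) R \<psi>))" by simp
    have "fold (sq hmat) Q \<psi> = fold (sq hmat) (c # t # R) \<psi>"
      by (rule fold_same_mset) (use assms R comm in \<open>auto simp: R_def\<close>)
    then show "fold (sq hmat) Q \<psi> = fold (sq hmat) R (sq hmat t (sq hmat c \<psi>))" by simp
  qed
  have "pull (fan c [t]) (fold (sq hmat) R \<psi>) = fold (sq hmat) R (pull (fan c [t]) \<psi>)" for \<psi>
    by (rule commute_fold, rule local_op_commute[OF local_op_pull[OF local_map_fan] local_op_sq])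
      (use R in auto)
  then have "fold (sq hmat) Q (pull (fan c [t]) (fold (sq hmat) Q \<phi>)) = sq hmat c (sq hmat t (pull (fan c [t]) (sq hmat t (sq hmat c \<phi>))))"
    (is "_ = ?A") unfolding Q(1)[of "pull _ _"] Q(2)[of \<phi>] by (simp add: fold_hmat_twice R)
  also have "\<dots> = pull (fan t [c]) \<phi>"
  proof
    fix s :: assignment
    \<comment> \<open>Both sides involve only the four assignments that agree with \<open>s\<close>
      off \<open>c\<close> and \<open>t\<close>; \<chi> names their amplitudes.\<close>
    define \<chi> where "\<chi> x y = \<phi> (s(c := x, t := y))" for x y
    have \<chi>: "\<phi> (s(c := x, t := y)) = \<chi> x y" "\<phi> (s(t := y, c := x)) = \<chi> x y" for x y
      using assms(4) by (simp_all add: \<chi>_def fun_upd_twist)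
    have "pull (fan t [c]) \<phi> s = \<chi> (s c \<noteq> s t) (s t)"
      by (simp add: pull_def fan_one \<chi>_def fun_upd_idem fun_upd_twist[OF assms(4)])
    moreover have "?A s =
        \<chi> (s c \<noteq> s t) (s t)"
      using assms(4) sqrt2_square
      by (cases "s c"; cases "s t") (simp_all add: pull_def sq_def hmat_def fan_one \<chi> field_simps)
    ultimately show "?A s =
      pull (fan t [c]) \<phi> s" by simp
  qed
  finally show ?thesis .
qed

text \<open>Between consecutive CNOTs a double sweep over \<open>Q\<close>, which is the identity,
  can be inserted, so each CNOT is conjugated separately.\<close>

lemma conjugate_fans:
  assumes "distinct Q" "\<forall>(c, t)\<in>set ps. c \<in> set Q \<and> t \<in> set Q \<and> c \<noteq> t"
  shows "fold (sq hmat) Q (fold (\<lambda>(c, t). pull (fan c [t])) ps (fold (sq hmat) Q \<phi>)) =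
    fold (\<lambda>(c, t). pull (fan t [c])) ps \<phi>"
  using assms(2)
proof (induction ps arbitrary: \<phi>)
  case Nil
  then show ?case by (simp add: fold_hmat_twice assms(1))
next
  case (Cons p ps)
  obtain c t where p: "p = (c, t)" by force
  have "fold (sq hmat) Q (pull (fan c [t]) (fold (sq hmat) Q \<phi>)) = pull (fan t [c]) \<phi>"
    by (rule conjugate_fan_one) (use Cons.prems assms(1) p in auto)
  from arg_cong[OF this, of "fold (sq hmat) Q"]
  have "pull (fan c [t]) (fold (sq hmat) Q \<phi>) = fold (sq hmat) Q (pull (fan t [c]) \<phi>)"
    by (simp add: fold_hmat_twice assms(1))
  with Cons show ?case by (simp add: p)
qed

section \<open>Words in H and T as matrices\<close>

fun gmat :: "gate \<Rightarrow> qubit_matrix" where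
  "gmat PiEighth = dmat \<omega>"
| "gmat _ = hmat"

text \<open>New factors are multiplied on the left, so the gate that comes first in time is the
  rightmost factor.\<close>

definition wmat :: "gate list \<Rightarrow> qubit_matrix" where
  "wmat w = fold (\<lambda>g. mprod (gmat g)) w idm"

lemma mprod_idm: "mprod U idm = U"
  by (auto simp: fun_eq_iff mprod_def idm_def)

lemma mprod_assoc: "mprod (mprod U V) W = mprod U (mprod V W)"
  by (auto simp: fun_eq_iff mprod_def algebra_simps)

lemma fold_sq_word: "fold (\<lambda>g. sq (gmat g) q) w \<phi> = sq (wmat w) q \<phi>"
proof -
  have "fold (\<lambda>g. sq (gmat g) q) w (sq U q \<phi>) = sq (fold (\<lambda>g. mprod (gmat g)) w U) q \<phi>" for U
    by (induction w arbitrary: U) (simp_all add: sq_sq)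
  from this[of idm] show ?thesis by (simp add: wmat_def sq_idm)
qed

text \<open>The Hadamard gate is \<open>V Z V\<^sup>-\<^sup>1\<close> for \<open>V = S H T H\<close>; words are read in order of time.\<close>

definition vword :: "gate list" where
  "vword = [Hadamard, PiEighth, Hadamard, PiEighth, PiEighth]"

text \<open>As S is T^2 and T has order 8, the inverse of S is T^6 and that of T is T^7.\<close>

definition vword_inv :: "gate list" where
  "vword_inv = replicate 6 PiEighth @ [Hadamard] @ replicate 7 PiEighth @ [Hadamard]"

lemma dmat_dmat: "mprod (dmat u) (dmat v) = dmat (u * v)"
  by (auto simp: fun_eq_iff mprod_def dmat_def)

lemma mprod_dmat: "mprod (dmat u) U = (\<lambda>a b. (if a then u else 1) * U a b)"
  by (auto simp: fun_eq_iff mprod_def dmat_def)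

lemma mprod_dmat_power: "(mprod (dmat u) ^^ k) U = mprod (dmat (u ^ k)) U"
  by (induction k) (auto simp: fun_eq_iff mprod_dmat)

lemma omega_Complex: "\<omega> = Complex (sqrt 2 / 2) (sqrt 2 / 2)"
  by (simp add: complex_eq_iff cos_45 sin_45)

lemma omega_2: "\<omega> ^ 2 = \<i>" and omega_6: "\<omega> ^ 6 = - \<i>" and omega_7: "\<omega> ^ 7 = cnj \<omega>"
proof -
  show 2: "\<omega> ^ 2 = \<i>" by (simp add: DeMoivre cis_pi_half)
  have "\<omega> ^ 6 = \<omega> ^ 4 * \<omega> ^ 2" by (simp flip: power_add)
  then show 6: "\<omega> ^ 6 = - \<i>" by (simp add: 2 omega_power_4)
  have "\<omega> ^ 7 = \<omega> ^ 6 * \<omega>" by (simp flip: power_Suc2)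
  also have "\<dots> = cnj \<omega>" unfolding 6 by (simp add: omega_Complex complex_eq_iff)
  finally show "\<omega> ^ 7 = cnj \<omega>" .
qed

lemma wmat_vword:
  "wmat vword a b = (if a then \<i> else 1) * (if a = b then 1 + \<omega> else 1 - \<omega>) / 2"
proof -
  have "wmat vword = mprod (dmat (\<omega> ^ 2)) (mprod hmat (mprod (dmat \<omega>) hmat))"
    by (simp add: wmat_def vword_def mprod_idm dmat_dmat power2_eq_square flip: mprod_assoc)
  then show ?thesis
    by (cases a; cases b) (simp_all add: omega_2 mprod_dmat mprod_def[of hmat] hmat_def field_simps sqrt2_square)
qed

lemma wmat_vword_inv:
  "wmat vword_inv a b = (if b then - \<i> else 1) * (if a = b then 1 + cnj \<omega> else 1 - cnj \<omega>) / 2"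
proof -
  have "wmat vword_inv = mprod hmat (mprod (dmat (\<omega> ^ 7)) (mprod hmat (dmat (\<omega> ^ 6))))"
    by (simp add: wmat_def vword_inv_def fold_replicate mprod_dmat_power mprod_idm)
  then show ?thesis
    by (cases a; cases b) (simp_all add: omega_6 omega_7 mprod_def hmat_def dmat_def field_simps sqrt2_square)
qed

lemma vword_inverse: "mprod (wmat vword) (wmat vword_inv) = idm"
proof (intro ext)
  fix a b
  have "sqrt 2 * sqrt 2 = (2::real)" by simp
  then show "mprod (wmat vword) (wmat vword_inv) a b = idm a b"
    by (cases a; cases b)
      (simp_all add: mprod_def wmat_vword wmat_vword_inv idm_def omega_Complex complex_eq_iff field_simps)
qed

text \<open>On the Bloch sphere, HTH is the rotation by 45 degrees about the x axis and takes Z to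
  (Z - Y) / sqrt 2. Then S, a quarter turn about the z axis, takes -Y to X, which gives (X + Z) /
  sqrt 2 = H.\<close>

lemma vword_conjugate: "mprod (wmat vword) (mprod (dmat (- 1)) (wmat vword_inv)) = hmat"
proof (intro ext)
  fix a b
  have "sqrt 2 * sqrt 2 = (2::real)" by simp
  then show "mprod (wmat vword) (mprod (dmat (- 1)) (wmat vword_inv)) a b = hmat a b"
    by (cases a; cases b)
      (simp_all add: mprod_dmat mprod_def[of "wmat vword"] wmat_vword wmat_vword_inv hmat_def omega_Complex complex_eq_iff
        field_simps)
qed

section \<open>Layers of a register arranged in blocks\<close>

text \<open>
  The data qubits \<open>0, ..., n - 1\<close> are followed by \<open>n \<times> n\<close> blocks, stored row by row. Rows belong
  to sources and columns to targets of interactions between data qubits.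
\<close>

definition blk :: "nat \<Rightarrow> nat \<Rightarrow> nat \<Rightarrow> nat \<Rightarrow> nat" where
  "blk n r i j = n + (r * n + i) * n + j"

abbreviation pairs :: "nat \<Rightarrow> (nat \<times> nat) list" where
  "pairs n \<equiv> List.product [0..<n] [0..<n]"

definition row :: "gate \<Rightarrow> nat \<Rightarrow> layer" where
  "row g n = map (\<lambda>i. (g, [i])) [0..<n]"

definition cells :: "gate \<Rightarrow> nat list \<Rightarrow> nat \<Rightarrow> layer" where
  "cells g rs n = map (\<lambda>(i, j). (g, map (\<lambda>r. blk n r i j) rs)) (pairs n)"

definition fan_rows :: "nat \<Rightarrow> nat \<Rightarrow> layer" where
  "fan_rows a n = map (\<lambda>i. (Fanout n, i # map (\<lambda>j. blk n a i j) [0..<n])) [0..<n]"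

definition fan_cols :: "nat \<Rightarrow> nat \<Rightarrow> layer" where
  "fan_cols b n = map (\<lambda>j. (Fanout n, j # map (\<lambda>i. blk n b i j) [0..<n])) [0..<n]"

definition tof_cols :: "nat \<Rightarrow> nat \<Rightarrow> layer" where
  "tof_cols b n = map (\<lambda>j. (Toffoli n, map (\<lambda>i. blk n b i j) [0..<n] @ [j])) [0..<n]"

definition row_word :: "gate list \<Rightarrow> nat \<Rightarrow> circuit" where
  "row_word w n = map (\<lambda>g. row g n) w"

definition cell_word :: "(gate \<times> nat list) list \<Rightarrow> nat \<Rightarrow> circuit" where
  "cell_word w n = map (\<lambda>(g, rs). cells g rs n) w"

section \<open>Addresses of cells and validity of the layers\<close>

lemma blk_eq_iff [simp]:
  assumes "i < n" "j < n" "i' < n" "j' < n"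
  shows "blk n r i j = blk n r' i' j' \<longleftrightarrow> r = r' \<and> i = i' \<and> j = j'"
proof
  have dm: "(x * n + y) div n = x" "(x * n + y) mod n = y" if "y < n" for x y
    using that by (simp_all add: div_mult_self3)
  assume "blk n r i j = blk n r' i' j'"
  then have "(r * n + i) * n + j = (r' * n + i') * n + j'" by (simp add: blk_def)
  then have "r * n + i = r' * n + i' \<and> j = j'" using dm assms by metis
  then show "r = r' \<and> i = i' \<and> j = j'" using dm assms by metis
qed simp

lemma blk_ge [simp]: "n \<le> blk n r i j" "\<not> blk n r i j < n"
  by (simp_all add: blk_def)

lemma blk_neq [simp]: "i' < n \<Longrightarrow> blk n r i j \<noteq> i'" "i' < n \<Longrightarrow> i' \<noteq> blk n r i j"
  using blk_ge(1)[of n r i j] by linarith+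

lemma distinct_pairs: "distinct (pairs n)"
  by (simp add: distinct_product)

lemma blk_less:
  assumes "r < R" "i < n" "j < n"
  shows "blk n r i j < n + R * (n * n)"
proof -
  have "(r * n + i) * n + j < (r * n + i) * n + n" using assms by simp
  also have "\<dots> = (r * n + Suc i) * n" by simp
  also have "\<dots> \<le> (r * n + n) * n" using assms by (intro mult_le_mono1) simp
  also have "\<dots> = Suc r * (n * n)" by (simp add: algebra_simps)
  also have "\<dots> \<le> R * (n * n)" using assms by (intro mult_le_mono1) simp
  finally show ?thesis by (simp add: blk_def)
qed

lemma layer_overI:
  assumes "distinct ks" "\<And>k. k \<in> set ks \<Longrightarrow> g \<in> G \<and> length (f k) = arity g \<and> set (f k) \<subseteq> {..<N} \<and> distinct (f k)"
    and "\<And>k k' q. k \<in> set ks \<Longrightarrow> k' \<in> set ks \<Longrightarrow> q \<in> set (f k) \<Longrightarrow> q \<in> set (f k') \<Longrightarrow> k = k'"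
  shows "layer_over G N (map (\<lambda>k. (g, f k)) ks)"
proof -
  have "distinct (concat (map f ks))"
    using assms by (induction ks) (auto, blast)
  moreover have "map snd (map (\<lambda>k. (g, f k)) ks) = map f ks" by (simp add: comp_def)
  ultimately show ?thesis unfolding layer_over_def using assms(2) by (auto simp: comp_def)
qed

context
  fixes G :: "gate set" and n R N :: nat
  assumes N: "N = n + R * (n * n)"
begin

lemma layer_over_row: "g \<in> G \<Longrightarrow> arity g = 1 \<Longrightarrow> layer_over G N (row g n)"
  unfolding row_def by (rule layer_overI) (auto simp: N)

lemma layer_over_cells:
  assumes "g \<in> G" "length rs = arity g" "set rs \<subseteq> {..<R}" "distinct rs"
  shows "layer_over G N (cells g rs n)"
  unfolding cells_def case_prod_unfold
proof (rule layer_overI[OF distinct_pairs])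
  fix k assume "k \<in> set (pairs n)"
  then show "g \<in> G \<and> length (map (\<lambda>r. blk n r (fst k) (snd k)) rs) = arity g \<and>
      set (map (\<lambda>r. blk n r (fst k) (snd k)) rs) \<subseteq> {..<N} \<and> distinct (map (\<lambda>r. blk n r (fst k) (snd k)) rs)"
    using assms by (auto simp: N blk_less distinct_map inj_on_def)
qed (auto simp: prod_eq_iff)

lemma layer_over_fan_rows: "Fanout n \<in> G \<Longrightarrow> r < R \<Longrightarrow> layer_over G N (fan_rows r n)"
  unfolding fan_rows_def
  by (rule layer_overI) (auto simp: N blk_less distinct_map inj_on_def trans_less_add1)

lemma layer_over_fan_cols: "Fanout n \<in> G \<Longrightarrow> r < R \<Longrightarrow> layer_over G N (fan_cols r n)"
  unfolding fan_cols_def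
  by (rule layer_overI) (auto simp: N blk_less distinct_map inj_on_def trans_less_add1)

lemma layer_over_tof_cols: "Toffoli n \<in> G \<Longrightarrow> r < R \<Longrightarrow> layer_over G N (tof_cols r n)"
  unfolding tof_cols_def
  by (rule layer_overI) (auto simp: N blk_less distinct_map inj_on_def trans_less_add1)

end

text \<open>\<open>T p\<close> is the set of positions that \<open>f p\<close> writes. The third
  assumption says that the values written depend only on positions that no other map writes. Hence
  the order of execution cannot be noticed, and all maps may be evaluated on the original
  \<open>s\<close>.\<close>

lemma foldr_parallel:
  fixes f :: "'a \<Rightarrow> ('b \<Rightarrow> 'c) \<Rightarrow> 'b \<Rightarrow> 'c"
  assumes "distinct ps"
    and "\<And>p s i. p \<in> set ps \<Longrightarrow> i \<notin> T p \<Longrightarrow> f p s i = s i"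
    and "\<And>p s s' i. p \<in> set ps \<Longrightarrow> i \<in> T p \<Longrightarrow>
      (\<And>i. (\<And>p'. p' \<in> set ps \<Longrightarrow> p' \<noteq> p \<Longrightarrow> i \<notin> T p') \<Longrightarrow> s i = s' i) \<Longrightarrow> f p s i = f p s' i"
    and "\<And>p p'. p \<in> set ps \<Longrightarrow> p' \<in> set ps \<Longrightarrow> p \<noteq> p' \<Longrightarrow> T p \<inter> T p' = {}"
  shows "(\<forall>p\<in>set ps. \<forall>i\<in>T p. foldr f ps s i = f p s i) \<and>
    (\<forall>i. (\<forall>p\<in>set ps. i \<notin> T p) \<longrightarrow> foldr f ps s i = s i)"
  using assms
proof (induction ps)
  case Nil
  show ?case by simp
next
  case (Cons p ps)
  have IH: "(\<forall>p\<in>set ps. \<forall>i\<in>T p. foldr f ps s i = f p s i) \<and>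
    (\<forall>i. (\<forall>p\<in>set ps. i \<notin> T p) \<longrightarrow> foldr f ps s i = s i)"
  proof (rule Cons.IH)
    fix p' i and s s' :: "'b \<Rightarrow> 'c"
    assume *: "p' \<in> set ps" "i \<in> T p'" "\<And>i. (\<And>p''. p'' \<in> set ps \<Longrightarrow> p'' \<noteq> p' \<Longrightarrow> i \<notin> T p'') \<Longrightarrow> s i = s' i"
    show "f p' s i = f p' s' i"
      by (rule Cons.prems(3)) (use * in auto)
  qed (use Cons.prems in auto)
  have first: "f p (foldr f ps s) i = f p s i" if "i \<in> T p" for i
  proof (rule Cons.prems(3))
    fix i assume "\<And>p'. p' \<in> set (p # ps) \<Longrightarrow> p' \<noteq> p \<Longrightarrow> i \<notin> T p'"
    then have "\<forall>p'\<in>set ps. i \<notin> T p'" using Cons.prems(1) by auto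
    with IH show "foldr f ps s i = s i" by blast
  qed (use that in auto)
  have other: "f p (foldr f ps s) i = f p' s i" if "p' \<in> set ps" "i \<in> T p'" for p' i
  proof -
    have "i \<notin> T p" using Cons.prems(1) Cons.prems(4)[of p p'] that by auto
    then have "f p (foldr f ps s) i = foldr f ps s i" by (intro Cons.prems(2)) auto
    with IH that show ?thesis by auto
  qed
  have none: "f p (foldr f ps s) i = s i" if "\<forall>p'\<in>set (p # ps). i \<notin> T p'" for i
    using Cons.prems(2)[of p i "foldr f ps s"] IH that by auto
  show ?case
  proof (intro conjI ballI allI impI)
    fix p' i assume "p' \<in> set (p # ps)" "i \<in> T p'"
    then show "foldr f (p # ps) s i = f p' s i" using first other by (cases "p' = p") simp_all
  next
    fix i assume "\<forall>p'\<in>set (p # ps). i \<notin> T p'"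
    then show "foldr f (p # ps) s i = s i" using none by simp
  qed
qed

text \<open>\<open>F\<close> is evaluated on the old assignment for all cells, so this is a
  simultaneous update; the same holds for \<open>add_data\<close>.\<close>

definition add_blk :: "nat \<Rightarrow> nat \<Rightarrow> (assignment \<Rightarrow> nat \<Rightarrow> nat \<Rightarrow> bool) \<Rightarrow> assignment \<Rightarrow> assignment" where
  "add_blk n b F s p = (s p \<noteq> (\<exists>i<n. \<exists>j<n. p = blk n b i j \<and> F s i j))"

definition add_data :: "nat \<Rightarrow> (assignment \<Rightarrow> nat \<Rightarrow> bool) \<Rightarrow> assignment \<Rightarrow> assignment" where
  "add_data n F s p = (s p \<noteq> (p < n \<and> F s p))"

lemma add_blk_simps [simp]:
  "i < n \<Longrightarrow> j < n \<Longrightarrow> add_blk n b F s (blk n b i j) = (s (blk n b i j) \<noteq> F s i j)"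
  "i < n \<Longrightarrow> j < n \<Longrightarrow> r \<noteq> b \<Longrightarrow> add_blk n b F s (blk n r i j) = s (blk n r i j)"
  "i < n \<Longrightarrow> add_blk n b F s i = s i"
  by (auto simp: add_blk_def)

lemma add_data_simps [simp]:
  "i < n \<Longrightarrow> add_data n F s i = (s i \<noteq> F s i)"
  "add_data n F s (blk n r i j) = s (blk n r i j)"
  by (auto simp: add_data_def)

section \<open>The action of a layer\<close>

text \<open>Gates on disjoint qubits satisfy the conditions of \<open>foldr_parallel\<close>: each
  reads only its own qubits, and \<open>T x\<close> contains those among them that it writes.
  \<open>g\<close> is a description of the joint result that does not mention the order.\<close>

lemma parallel_action:
  assumes "distinct F"
    and disj: "\<And>x y q. x \<in> set F \<Longrightarrow> y \<in> set F \<Longrightarrow> q \<in> set (snd x) \<Longrightarrow> q \<in> set (snd y) \<Longrightarrow> x = y"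
    and ap: "\<And>x. x \<in> set F \<Longrightarrow> ap x = pull (f x)"
    and T: "\<And>x. x \<in> set F \<Longrightarrow> T x \<subseteq> set (snd x)"
    and f: "\<And>x s i. x \<in> set F \<Longrightarrow> i \<notin> T x \<Longrightarrow> f x s i = s i"
      "\<And>x s s' i. x \<in> set F \<Longrightarrow> i \<in> T x \<Longrightarrow> \<forall>q\<in>set (snd x). s q = s' q \<Longrightarrow> f x s i = f x s' i"
    and g: "\<And>x s i. x \<in> set F \<Longrightarrow> i \<in> T x \<Longrightarrow> g s i = f x s i"
      "\<And>s i. \<forall>x\<in>set F. i \<notin> T x \<Longrightarrow> g s i = s i"
  shows "fold ap F \<phi> = pull g \<phi>"
proof -
  have "fold ap F \<phi> = fold (\<lambda>x. pull (f x)) F \<phi>" by (intro fold_cong) (simp_all add: ap)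
  also have "\<dots> = pull (foldr f F) \<phi>" by (simp only: fold_pull)
  also have "foldr f F = g"
  proof (intro ext)
    fix s i
    have *: "(\<forall>x\<in>set F. \<forall>i\<in>T x. foldr f F s i = f x s i) \<and>
      (\<forall>i. (\<forall>x\<in>set F. i \<notin> T x) \<longrightarrow> foldr f F s i = s i)"
    proof (rule foldr_parallel[OF assms(1)])
      fix x i and s s' :: assignment
      assume x: "x \<in> set F" and i: "i \<in> T x"
        and eq: "\<And>i. (\<And>x'. x' \<in> set F \<Longrightarrow> x' \<noteq> x \<Longrightarrow> i \<notin> T x') \<Longrightarrow> s i = s' i"
      have "s q = s' q" if "q \<in> set (snd x)" for q
      proof (rule eq)
        fix x' assume "x' \<in> set F" "x' \<noteq> x"
        then show "q \<notin> T x'" using T[of x'] disj[of x x' q] x that by blast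
      qed
      then show "f x s i = f x s' i" using f(2)[OF x i] by blast
    next
      fix x y assume "x \<in> set F" "y \<in> set F" "x \<noteq> y"
      then show "T x \<inter> T y = {}" using T[of x] T[of y] disj[of x y] by blast
    qed (fact f(1))
    show "foldr f F s i = g s i"
    proof (cases "\<exists>x\<in>set F. i \<in> T x")
      case True
      with * g(1) show ?thesis by metis
    next
      case False
      with * g(2) show ?thesis by metis
    qed
  qed
  finally show ?thesis .
qed

section \<open>The interaction graph of a layer, with edges from controls to targets\<close>

definition fan_edge :: "layer \<Rightarrow> nat \<Rightarrow> nat \<Rightarrow> bool" where
  "fan_edge L i j \<longleftrightarrow> (\<exists>k qs. (Fanout k, i # qs) \<in> set L \<and> j \<in> set qs)"

definition tof_edge :: "layer \<Rightarrow> nat \<Rightarrow> nat \<Rightarrow> bool" where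
  "tof_edge L i j \<longleftrightarrow> (\<exists>k qs. (Toffoli k, qs @ [j]) \<in> set L \<and> i \<in> set qs)"

text \<open>An empty conjunction is true, so edges alone would flip every qubit that has no incoming
  edge; targets have to be recorded separately.\<close>

definition tof_target :: "layer \<Rightarrow> nat \<Rightarrow> bool" where
  "tof_target L j \<longleftrightarrow> (\<exists>k qs. (Toffoli k, qs @ [j]) \<in> set L)"

lemma fold_filter_if: "fold F (filter P xs) = fold (\<lambda>x. if P x then F x else id) xs"
  by (induction xs) auto

locale disjoint_layer =
  fixes n :: nat and L :: layer
  assumes len: "x \<in> set L \<Longrightarrow> length (snd x) = arity (fst x)"
    and bound: "x \<in> set L \<Longrightarrow> set (snd x) \<subseteq> {..<n}"
    and dist: "x \<in> set L \<Longrightarrow> distinct (snd x)"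
    and disj: "x \<in> set L \<Longrightarrow> y \<in> set L \<Longrightarrow> q \<in> set (snd x) \<Longrightarrow> q \<in> set (snd y) \<Longrightarrow> x = y"
    and distinct_L: "distinct L"
begin

lemma ap_commute:
  assumes "x \<in> set L" "y \<in> set L"
  shows "ap x (ap y \<phi>) = ap y (ap x \<phi>)"
proof (cases "x = y")
  case False
  obtain g ps h qs where xy: "x = (g, ps)" "y = (h, qs)" by force
  have "set ps \<inter> set qs = {}" using disj[OF assms] False xy by auto
  then show ?thesis unfolding xy
    by (intro local_op_commute[OF local_op_ap local_op_ap]) (use len assms xy in auto)
qed simp

text \<open>Putting the identity where the layer has no gate gives a sweep over all data qubits,
  which is the form in which a stage with switched gates is computed.\<close>

lemma single_action:
  assumes "arity g = 1" "\<And>q. ap (g, [q]) = sq U q"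
  shows "fold ap (filter (\<lambda>x. fst x = g) L) \<phi> =
    fold (\<lambda>q. sq (if (g, [q]) \<in> set L then U else idm) q) [0..<n] \<phi>"
proof -
  let ?F = "filter (\<lambda>x. fst x = g) L"
  have single: "x = (g, [hd (snd x)])" if "x \<in> set ?F" for x
  proof -
    obtain h qs where "x = (h, qs)" by force
    with that len[of x] assms(1) show ?thesis by (auto simp: length_Suc_conv)
  qed
  have "fold ap ?F \<phi> = fold (\<lambda>x. sq U (hd (snd x))) ?F \<phi>"
    by (rule fold_cong) (use single assms(2) in \<open>metis\<close>)+
  also have "\<dots> = fold (sq U) (map (\<lambda>x. hd (snd x)) ?F) \<phi>"
    by (simp add: fold_map comp_def)
  also have "\<dots> = fold (sq U) (filter (\<lambda>q. (g, [q]) \<in> set L) [0..<n]) \<phi>"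
  proof (rule fold_same_mset)
    show "sq U x (sq U y \<phi>) = sq U y (sq U x \<phi>)" for x y \<phi>
      by (cases "x = y") (auto simp: sq_commute)
    show "distinct (map (\<lambda>x. hd (snd x)) ?F)"
      unfolding distinct_map
    proof
      show "inj_on (\<lambda>x. hd (snd x)) (set ?F)"
        using single by (intro inj_onI) metis
    qed (simp add: distinct_L)
    show "set (map (\<lambda>x. hd (snd x)) ?F) = set (filter (\<lambda>q. (g, [q]) \<in> set L) [0..<n])"
    proof (intro set_eqI iffI)
      fix q assume "q \<in> set (map (\<lambda>x. hd (snd x)) ?F)"
      then obtain x where x: "x \<in> set ?F" "q = hd (snd x)" by auto
      with single[OF x(1)] have "(g, [q]) \<in> set L" by auto
      with bound[OF this] show "q \<in> set (filter (\<lambda>q. (g, [q]) \<in> set L) [0..<n])" by simp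
    next
      fix q assume "q \<in> set (filter (\<lambda>q. (g, [q]) \<in> set L) [0..<n])"
      then show "q \<in> set (map (\<lambda>x. hd (snd x)) ?F)" by force
    qed
  qed simp
  also have "\<dots> = fold (\<lambda>q. sq (if (g, [q]) \<in> set L then U else idm) q) [0..<n] \<phi>"
    unfolding fold_filter_if by (rule fold_cong) (auto simp: sq_idm_fun)
  finally show ?thesis .
qed

lemma fan_edge_control: "fan_edge L i j \<Longrightarrow> \<not> fan_edge L k i"
proof
  assume "fan_edge L i j" "fan_edge L k i"
  then obtain k1 ps k2 qs where *: "(Fanout k1, i # ps) \<in> set L" "j \<in> set ps"
    "(Fanout k2, k # qs) \<in> set L" "i \<in> set qs" unfolding fan_edge_def by blast
  then have "i # ps = k # qs" using disj[OF *(1,3), of i] by simp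
  with dist[OF *(3)] * show False by auto
qed

lemma fan_edge_unique: "fan_edge L i j \<Longrightarrow> fan_edge L i' j \<Longrightarrow> i = i'"
proof -
  assume "fan_edge L i j" "fan_edge L i' j"
  then obtain k1 ps k2 qs where *: "(Fanout k1, i # ps) \<in> set L" "j \<in> set ps"
    "(Fanout k2, i' # qs) \<in> set L" "j \<in> set qs" unfolding fan_edge_def by blast
  then show ?thesis using disj[OF *(1,3), of j] by simp
qed

lemma tof_edge_control: "tof_edge L i j \<Longrightarrow> \<not> tof_target L i \<and> i \<noteq> j"
proof -
  assume "tof_edge L i j"
  then obtain k1 ps where 1: "(Toffoli k1, ps @ [j]) \<in> set L" "i \<in> set ps" unfolding tof_edge_def by blast
  with dist[OF 1(1)] have "i \<noteq> j" by auto
  moreover have False if "tof_target L i"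
  proof -
    from that obtain k2 qs where 2: "(Toffoli k2, qs @ [i]) \<in> set L" unfolding tof_target_def by blast
    with disj[OF 1(1) 2, of i] 1 \<open>i \<noteq> j\<close> show False by simp
  qed
  ultimately show ?thesis by blast
qed

abbreviation "is_fan \<equiv> \<lambda>x :: placed_gate. \<exists>k. fst x = Fanout k"
abbreviation "is_tof \<equiv> \<lambda>x :: placed_gate. \<exists>k. fst x = Toffoli k"

lemma fan_action:
  "fold ap (filter is_fan L) \<phi> = pull (add_data n (\<lambda>s j. \<exists>i<n. fan_edge L i j \<and> s i)) \<phi>"
proof -
  let ?F = "filter is_fan L"
  let ?f = "\<lambda>x :: placed_gate. fan (hd (snd x)) (tl (snd x))"
  have shape: "x = (Fanout (length (snd x) - 1), hd (snd x) # tl (snd x))" if "x \<in> set ?F" for x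
  proof -
    obtain h qs where "x = (h, qs)" by force
    with that len[of x] show ?thesis by (auto simp: length_Suc_conv)
  qed
  have args: "set (snd x) = insert (hd (snd x)) (set (tl (snd x)))" if "x \<in> set ?F" for x
    using shape[OF that] by (metis list.simps(15) snd_conv)
  show ?thesis
  proof (rule parallel_action[where f = ?f and T = "\<lambda>x. set (tl (snd x))"])
    show "ap x = pull (?f x)" if "x \<in> set ?F" for x
      by (subst shape[OF that]) simp
    show "add_data n (\<lambda>s j. \<exists>i<n. fan_edge L i j \<and> s i) s p = ?f x s p"
      if x: "x \<in> set ?F" "p \<in> set (tl (snd x))" for x s p
    proof -
      have edge: "fan_edge L (hd (snd x)) p"
        unfolding fan_edge_def using shape[OF x(1)] x by (metis filter_is_subset subset_iff)
      have "set (snd x) \<subseteq> {..<n}" using bound x(1) by simp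
      then have "hd (snd x) < n" "p < n" using args[OF x(1)] x(2) by auto
      moreover from this have "(\<exists>i<n. fan_edge L i p \<and> s i) \<longleftrightarrow> s (hd (snd x))"
        using edge fan_edge_unique[OF edge] by blast
      ultimately show ?thesis using x(2) by (simp add: add_data_def fan_def)
    qed
    show "add_data n (\<lambda>s j. \<exists>i<n. fan_edge L i j \<and> s i) s p = s p"
      if "\<forall>x\<in>set ?F. p \<notin> set (tl (snd x))" for s p
    proof -
      have "\<not> fan_edge L i p" for i using that unfolding fan_edge_def by force
      then show ?thesis by (simp add: add_data_def)
    qed
  qed (use args disj in \<open>auto simp: distinct_L fan_def\<close>)
qed

lemma tof_action:
  "fold ap (filter is_tof L) \<phi> =
    pull (add_data n (\<lambda>s j. tof_target L j \<and> (\<forall>i<n. tof_edge L i j \<longrightarrow> s i))) \<phi>"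
proof -
  let ?F = "filter is_tof L"
  let ?f = "\<lambda>x :: placed_gate. tof (butlast (snd x)) (last (snd x))"
  have shape: "x = (Toffoli (length (snd x) - 1), butlast (snd x) @ [last (snd x)])" if "x \<in> set ?F" for x
  proof -
    obtain h qs where "x = (h, qs)" by force
    with that len[of x] show ?thesis by (auto simp: length_Suc_conv_rev)
  qed
  have args: "set (snd x) = insert (last (snd x)) (set (butlast (snd x)))" if "x \<in> set ?F" for x
    using arg_cong[OF shape[OF that], of "\<lambda>x. set (snd x)"] by simp
  show ?thesis
  proof (rule parallel_action[where f = ?f and T = "\<lambda>x. {last (snd x)}"])
    show "ap x = pull (?f x)" if "x \<in> set ?F" for x
      by (subst shape[OF that]) simp
    show "add_data n (\<lambda>s j. tof_target L j \<and> (\<forall>i<n. tof_edge L i j \<longrightarrow> s i)) s p = ?f x s p"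
      if x: "x \<in> set ?F" "p \<in> {last (snd x)}" for x s p
    proof -
      have "(Toffoli (length (snd x) - 1), butlast (snd x) @ [p]) \<in> set L"
        using shape[OF x(1)] x by auto
      then have "tof_target L p" and edge: "i \<in> set (butlast (snd x)) \<Longrightarrow> tof_edge L i p" for i
        unfolding tof_target_def tof_edge_def by blast+
      moreover have "i \<in> set (butlast (snd x))" if i: "tof_edge L i p" for i
      proof -
        obtain k qs where e: "(Toffoli k, qs @ [p]) \<in> set L" "i \<in> set qs"
          using i unfolding tof_edge_def by blast
        then have "x = (Toffoli k, qs @ [p])"
          using disj[of x "(Toffoli k, qs @ [p])" p] x args[OF x(1)] by auto
        with e show ?thesis by simp
      qed
      moreover have "set (snd x) \<subseteq> {..<n}" using bound x(1) by simp
      then have "\<forall>i\<in>set (butlast (snd x)). i < n" "p < n" using args[OF x(1)] x(2) by auto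
      moreover from this edge calculation(3)
      have "(\<forall>i<n. tof_edge L i p \<longrightarrow> s i) \<longleftrightarrow> (\<forall>i\<in>set (butlast (snd x)). s i)" by blast
      ultimately show ?thesis using x(2) by (simp add: add_data_def tof_def)
    qed
    show "add_data n (\<lambda>s j. tof_target L j \<and> (\<forall>i<n. tof_edge L i j \<longrightarrow> s i)) s p = s p"
      if "\<forall>x\<in>set ?F. p \<notin> {last (snd x)}" for s p
    proof -
      have "\<not> tof_target L p" using that unfolding tof_target_def by force
      then show ?thesis by (simp add: add_data_def)
    qed
  qed (use args disj in \<open>auto simp: distinct_L tof_def\<close>)
qed

text \<open>All gates of the layer commute, so any order of the kinds is correct; this one is the
  order of the stages in \<open>block\<close>.\<close>

lemma layer_action:
  "fold ap L \<phi> = fold ap (filter is_tof L) (fold ap (filter is_fan L)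
      (fold ap (filter (\<lambda>x. fst x = Hadamard) L) (fold ap (filter (\<lambda>x. fst x = PiEighth) L) \<phi>)))"
proof -
  let ?L = "filter (\<lambda>x. fst x = PiEighth) L @ filter (\<lambda>x. fst x = Hadamard) L @
    filter is_fan L @ filter is_tof L"
  have "fst x = PiEighth \<or> fst x = Hadamard \<or> is_fan x \<or> is_tof x" for x by (cases "fst x") auto
  then have "fold ap L \<phi> = fold ap ?L \<phi>"
    by (intro fold_same_mset ap_commute) (auto simp: distinct_L)
  then show ?thesis by simp
qed

end

lemma disjoint_layerI:
  assumes "layer_over G n L"
  shows "disjoint_layer n L"
proof
  have "case x of (g, qs) \<Rightarrow> g \<in> G \<and> length qs = arity g \<and> set qs \<subseteq> {..<n}" if "x \<in> set L" for x
    using assms that unfolding layer_over_def by blast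
  then have L: "distinct (concat (map snd L))" "\<And>x. x \<in> set L \<Longrightarrow> length (snd x) = arity (fst x)"
    "\<And>x. x \<in> set L \<Longrightarrow> set (snd x) \<subseteq> {..<n}"
    using assms unfolding layer_over_def by (simp_all add: case_prod_unfold)
  then show "x \<in> set L \<Longrightarrow> length (snd x) = arity (fst x)" "x \<in> set L \<Longrightarrow> set (snd x) \<subseteq> {..<n}" for x
    by blast+
  show "x \<in> set L \<Longrightarrow> distinct (snd x)" for x
    using distinct_concat_nth[OF L(1)] by simp
  \<comment> \<open>Disjointness of the argument lists excludes a repeated gate only if the lists
    are nonempty, which holds as every arity is positive.\<close>
  have ne: "snd x \<noteq> []" if "x \<in> set L" for x
    using L(2)[OF that] by (cases "fst x") auto
  have "distinct (concat (map snd L)) \<Longrightarrow> (\<forall>x\<in>set L. snd x \<noteq> []) \<Longrightarrow>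
    distinct L \<and> (\<forall>x\<in>set L. \<forall>y\<in>set L. \<forall>q. q \<in> set (snd x) \<longrightarrow> q \<in> set (snd y) \<longrightarrow> x = y)"
  proof (induction L)
    case (Cons a L)
    then have IH: "distinct L" "\<forall>x\<in>set L. \<forall>y\<in>set L. \<forall>q. q \<in> set (snd x) \<longrightarrow> q \<in> set (snd y) \<longrightarrow> x = y"
      and a: "\<And>x q. x \<in> set L \<Longrightarrow> q \<in> set (snd a) \<Longrightarrow> q \<notin> set (snd x)" by auto
    have "a \<notin> set L"
    proof
      assume "a \<in> set L"
      moreover obtain q where "q \<in> set (snd a)" using Cons.prems(2) by (cases "snd a") auto
      ultimately show False using a by blast
    qed
    with IH a show ?case by auto
  qed simp
  with L(1) ne show "distinct L"
    "x \<in> set L \<Longrightarrow> y \<in> set L \<Longrightarrow> q \<in> set (snd x) \<Longrightarrow> q \<in> set (snd y) \<Longrightarrow> x = y" for x y q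
    by blast+
qed

section \<open>Computing with the blocks\<close>

lemma fold_map_ap: "fold ap (map f xs) = fold (\<lambda>x. ap (f x)) xs"
  by (rule ext) (simp add: fold_map comp_def)

lemma runf_map: "runf (map F w) \<phi> = fold (\<lambda>x. fold ap (F x)) w \<phi>"
  by (induction w arbitrary: \<phi>) auto

lemma runf_cell_word:
  assumes "\<forall>(g, rs)\<in>set w. length rs = arity g"
  shows "runf (cell_word w n) \<phi> =
    fold (\<lambda>k. fold (\<lambda>(g, rs). ap (g, map (\<lambda>r. blk n r (fst k) (snd k)) rs)) w) (pairs n) \<phi>"
proof -
  let ?F = "\<lambda>x k. ap (fst x, map (\<lambda>r. blk n r (fst k) (snd k)) (snd x))"
  have "runf (cell_word w n) \<phi> = fold (\<lambda>x. fold (?F x) (pairs n)) w \<phi>"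
    unfolding cell_word_def runf_map cells_def case_prod_unfold fold_map_ap ..
  also have "\<dots> = fold (\<lambda>k. fold (\<lambda>x. ?F x k) w) (pairs n) \<phi>"
  proof (rule fold_rows[OF distinct_pairs])
    fix k k' x y \<phi>
    assume *: "k \<in> set (pairs n)" "k' \<in> set (pairs n)" "k \<noteq> k'" "x \<in> set w" "y \<in> set w"
    show "?F x k (?F y k' \<phi>) = ?F y k' (?F x k \<phi>)"
      by (rule local_op_commute[OF local_op_ap local_op_ap])
        (use assms * in \<open>auto simp: case_prod_unfold prod_eq_iff\<close>)
  qed
  finally show ?thesis by (simp add: case_prod_unfold)
qed

lemma runf_row_word:
  assumes "set w \<subseteq> {Hadamard, PiEighth}"
  shows "runf (row_word w n) \<phi> = fold (sq (wmat w)) [0..<n] \<phi>"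
proof -
  have ap: "ap (g, [q]) = sq (gmat g) q" if "g \<in> set w" for g q
    using that assms by auto
  have "runf (row_word w n) \<phi> = fold (\<lambda>g. fold (\<lambda>q. ap (g, [q])) [0..<n]) w \<phi>"
    unfolding row_word_def runf_map row_def fold_map_ap ..
  also have "\<dots> = fold (\<lambda>g. fold (\<lambda>q. sq (gmat g) q) [0..<n]) w \<phi>"
    by (rule fold_cong) (simp_all add: ap)
  also have "\<dots> = fold (\<lambda>q. fold (\<lambda>g. sq (gmat g) q) w) [0..<n] \<phi>"
    by (rule fold_rows) (auto simp: sq_commute)
  also have "(\<lambda>q. fold (\<lambda>g. sq (gmat g) q) w) = sq (wmat w)"
    by (intro ext) (simp add: fold_sq_word)
  finally show ?thesis .
qed

text \<open>The layer is itself a \<open>disjoint_layer\<close>, so the analysis of arbitrary fanout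
  layers applies to the gates of the universal circuit too. The register of size \<open>N\<close> is
  chosen to end with block \<open>a\<close>.\<close>

lemma runf_fan_rows: "fold ap (fan_rows a n) \<phi> = pull (add_blk n a (\<lambda>s i j. s i)) \<phi>"
proof -
  define N where "N = n + Suc a * (n * n)"
  have less: "blk n a i j < N" if "i < n" "j < n" for i j
    unfolding N_def by (rule blk_less[OF lessI that])
  have "n \<le> N" by (simp add: N_def)
  interpret disjoint_layer N "fan_rows a n"
    by (rule disjoint_layerI[of UNIV], rule layer_over_fan_rows[OF N_def]) auto
  have "(Fanout k, i # qs) \<in> set (fan_rows a n) \<longleftrightarrow> k = n \<and> i < n \<and> qs = map (blk n a i) [0..<n]"
    for k i qs
    by (auto simp: fan_rows_def)
  then have edge: "fan_edge (fan_rows a n) i p \<longleftrightarrow> i < n \<and> (\<exists>j<n. p = blk n a i j)" for i p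
    unfolding fan_edge_def by auto
  have "filter is_fan (fan_rows a n) = fan_rows a n"
    by (auto simp: fan_rows_def filter_id_conv)
  then have "fold ap (fan_rows a n) \<phi> =
      pull (add_data N (\<lambda>s j. \<exists>i<N. fan_edge (fan_rows a n) i j \<and> s i)) \<phi>"
    using fan_action[of \<phi>] by simp
  also have "add_data N (\<lambda>s j. \<exists>i<N. fan_edge (fan_rows a n) i j \<and> s i) = add_blk n a (\<lambda>s i j. s i)"
    unfolding edge
    using \<open>n \<le> N\<close> by (intro ext) (auto simp: add_data_def add_blk_def less)
  finally show ?thesis .
qed

text \<open>The assumption says that \<open>F\<close> does not read block \<open>b\<close>, so the
  cells can be updated one after the other.\<close>

lemma foldr_cells:
  assumes "\<And>s s' i j. i < n \<Longrightarrow> j < n \<Longrightarrow> (\<And>p. (\<And>i' j'. i' < n \<Longrightarrow> j' < n \<Longrightarrow> p \<noteq> blk n b i' j') \<Longrightarrow> s p = s' p) \<Longrightarrow>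
    F s i j = F s' i j"
  shows "foldr (\<lambda>k s. s(blk n b (fst k) (snd k) := (s (blk n b (fst k) (snd k)) \<noteq> F s (fst k) (snd k))))
    (pairs n) = add_blk n b F"
proof
  fix s
  let ?f = "\<lambda>k s. s(blk n b (fst k) (snd k) := (s (blk n b (fst k) (snd k)) \<noteq> F s (fst k) (snd k)))"
  have *: "(\<forall>k\<in>set (pairs n). \<forall>p\<in>{blk n b (fst k) (snd k)}. foldr ?f (pairs n) s p = ?f k s p) \<and>
    (\<forall>p. (\<forall>k\<in>set (pairs n). p \<notin> {blk n b (fst k) (snd k)}) \<longrightarrow> foldr ?f (pairs n) s p = s p)"
  proof (rule foldr_parallel)
    fix k p and s s' :: assignment
    assume k: "k \<in> set (pairs n)" and p: "p \<in> {blk n b (fst k) (snd k)}"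
      and eq: "\<And>p. (\<And>k'. k' \<in> set (pairs n) \<Longrightarrow> k' \<noteq> k \<Longrightarrow> p \<notin> {blk n b (fst k') (snd k')}) \<Longrightarrow> s p = s' p"
    have "F s (fst k) (snd k) = F s' (fst k) (snd k)"
    proof (rule assms)
      fix p assume p: "\<And>i' j'. i' < n \<Longrightarrow> j' < n \<Longrightarrow> p \<noteq> blk n b i' j'"
      show "s p = s' p"
      proof (rule eq)
        fix k' assume "k' \<in> set (pairs n)"
        with p[of "fst k'" "snd k'"] show "p \<notin> {blk n b (fst k') (snd k')}" by auto
      qed
    qed (use k in auto)
    moreover have "s p = s' p" using k p by (intro eq) (auto simp: prod_eq_iff)
    ultimately show "?f k s p = ?f k s' p" using p by simp
  qed (auto simp: distinct_pairs prod_eq_iff)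
  show "foldr ?f (pairs n) s = add_blk n b F s"
  proof
    fix p
    show "foldr ?f (pairs n) s p = add_blk n b F s p"
    proof (cases "\<exists>i<n. \<exists>j<n. p = blk n b i j")
      case True
      then obtain i j where "i < n" "j < n" "p = blk n b i j" by blast
      with conjunct1[OF *, rule_format, of "(i, j)"] show ?thesis by auto
    next
      case False
      then have "foldr ?f (pairs n) s p = s p" using conjunct2[OF *] by auto
      with False show ?thesis by (auto simp: add_blk_def)
    qed
  qed
qed

lemma runf_gadget:
  assumes "a \<noteq> b" "a \<noteq> m" "m \<noteq> b"
  shows "runf (cell_word (gadget a m b) n) \<phi> =
    pull (add_blk n b (\<lambda>s i j. s (blk n a i j) \<and> s (blk n m i j))) \<phi>"
proof -
  have "runf (cell_word (gadget a m b) n) \<phi> = fold (\<lambda>k. pull (tof [blk n a (fst k) (snd k), blk n m (fst k) (snd k)]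
      (blk n b (fst k) (snd k)))) (pairs n) \<phi>"
  proof (subst runf_cell_word)
    show "\<forall>(g, rs)\<in>set (gadget a m b). length rs = arity g" by (auto simp: gadget_def)
    show "fold (\<lambda>k. fold (\<lambda>(g, rs). ap (g, map (\<lambda>r. blk n r (fst k) (snd k)) rs)) (gadget a m b)) (pairs n) \<phi> =
     fold (\<lambda>k. pull (tof [blk n a (fst k) (snd k), blk n m (fst k) (snd k)]
      (blk n b (fst k) (snd k)))) (pairs n) \<phi>"
    proof (rule fold_cong)
      fix k assume "k \<in> set (pairs n)"
      then have k: "fst k < n" "snd k < n" by auto
      show "fold (\<lambda>(g, rs). ap (g, map (\<lambda>r. blk n r (fst k) (snd k)) rs)) (gadget a m b) =
         pull (tof [blk n a (fst k) (snd k), blk n m (fst k) (snd k)] (blk n b (fst k) (snd k)))"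
        by (rule ext, rule gadget[where h = "\<lambda>r. blk n r (fst k) (snd k)"]) (use assms k in simp_all)
    qed simp_all
  qed
  also have "\<dots> = pull (add_blk n b (\<lambda>s i j. s (blk n a i j) \<and> s (blk n m i j))) \<phi>"
  proof -
    have "tof [x, y] t = (\<lambda>s. s(t := (s t \<noteq> (s x \<and> s y))))" for x y t
      by (rule ext) (simp add: tof_def)
    moreover have "foldr (\<lambda>k s. s(blk n b (fst k) (snd k) := (s (blk n b (fst k) (snd k)) \<noteq>
        (s (blk n a (fst k) (snd k)) \<and> s (blk n m (fst k) (snd k)))))) (pairs n) =
        add_blk n b (\<lambda>s i j. s (blk n a i j) \<and> s (blk n m i j))"
    proof (rule foldr_cells)
      fix s s' :: assignment and i j
      assume ij: "i < n" "j < n"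
        and eq: "\<And>p. (\<And>i' j'. i' < n \<Longrightarrow> j' < n \<Longrightarrow> p \<noteq> blk n b i' j') \<Longrightarrow> s p = s' p"
      have "s (blk n a i j) = s' (blk n a i j)" "s (blk n m i j) = s' (blk n m i j)"
        by (rule eq; use ij assms in simp)+
      then show "(s (blk n a i j) \<and> s (blk n m i j)) = (s' (blk n a i j) \<and> s' (blk n m i j))" by simp
    qed
    ultimately show ?thesis by (simp only: fold_pull)
  qed
  finally show ?thesis .
qed

lemma runf_copy:
  assumes "m \<noteq> b"
  shows "runf (cell_word [(Fanout 1, [m, b])] n) \<phi> = pull (add_blk n b (\<lambda>s i j. s (blk n m i j))) \<phi>"
proof -
  have "runf (cell_word [(Fanout 1, [m, b])] n) \<phi> =
      pull (foldr (\<lambda>k s. s(blk n b (fst k) (snd k) := (s (blk n b (fst k) (snd k)) \<noteq> s (blk n m (fst k) (snd k)))))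
        (pairs n)) \<phi>"
    by (simp add: runf_cell_word fan_one[abs_def] fold_pull)
  also have "\<dots> = pull (add_blk n b (\<lambda>s i j. s (blk n m i j))) \<phi>"
    by (subst foldr_cells) (use assms in auto)
  finally show ?thesis .
qed

definition multiply :: "nat \<Rightarrow> nat \<Rightarrow> nat \<Rightarrow> nat \<Rightarrow> circuit" where
  "multiply a b m n = fan_rows a n # cell_word (gadget a m b) n @ [fan_rows a n]"

text \<open>The contents of block \<open>a\<close> are not assumed to be zero here. A formula valid
  for all assignments makes the map an involution everywhere, as \<open>pull_eq_on_supp\<close>
  demands.\<close>

definition mul_map :: "nat \<Rightarrow> nat \<Rightarrow> nat \<Rightarrow> nat \<Rightarrow> assignment \<Rightarrow> assignment" where
  "mul_map a b m n = add_blk n b (\<lambda>s i j. (s (blk n a i j) \<noteq> s i) \<and> s (blk n m i j))"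

lemma runf_multiply:
  assumes "a \<noteq> b" "a \<noteq> m" "m \<noteq> b"
  shows "runf (multiply a b m n) \<phi> = pull (mul_map a b m n) \<phi>"
proof -
  let ?A = "add_blk n a (\<lambda>s i j. s i)"
  let ?B = "add_blk n b (\<lambda>s i j. s (blk n a i j) \<and> s (blk n m i j))"
  have "runf (multiply a b m n) \<phi> = pull (\<lambda>s. ?A (?B (?A s))) \<phi>"
    by (simp add: multiply_def runf_fan_rows runf_gadget[OF assms] pull_pull)
  also have "(\<lambda>s. ?A (?B (?A s))) = mul_map a b m n"
  proof (intro ext)
    fix s p
    consider (A) i j where "i < n" "j < n" "p = blk n a i j" | (B) i j where "i < n" "j < n" "p = blk n b i j"
      | (N) "\<And>i j. i < n \<Longrightarrow> j < n \<Longrightarrow> p \<noteq> blk n a i j \<and> p \<noteq> blk n b i j" by blast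
    then show "?A (?B (?A s)) p = mul_map a b m n s p"
    proof cases
      case N
      then show ?thesis by (auto simp: mul_map_def add_blk_def[of n a] add_blk_def[of n b])
    qed (use assms in \<open>auto simp: mul_map_def\<close>)
  qed
  finally show ?thesis .
qed

text \<open>Conjugation by Hadamard gates swaps control and target of CNOT, so a fanout gate collects a parity.\<close>

definition parity :: "nat \<Rightarrow> nat \<Rightarrow> circuit" where
  "parity b n = [row Hadamard n, cells Hadamard [b] n, fan_cols b n, row Hadamard n, cells Hadamard [b] n]"

text \<open>The controls are all at positions from \<open>n\<close> on and the flipped qubits below
  \<open>n\<close>, so the flips read unchanged values and add up modulo 2.\<close>

lemma foldr_fan_parity:
  assumes "\<forall>(c, t)\<in>set ps. c < n \<and> n \<le> t"
  shows "foldr (\<lambda>(c, t). fan t [c]) ps s =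
    add_data n (\<lambda>s p. odd (length (filter (\<lambda>(c, t). c = p \<and> s t) ps))) s"
  using assms
proof (induction ps)
  case Nil
  then show ?case by (simp add: add_data_def)
next
  case (Cons p ps)
  obtain c t where p: "p = (c, t)" by force
  with Cons show ?case by (auto simp: fan_one add_data_def fun_eq_iff)
qed

text \<open>\<open>fan_cols\<close> is a product of CNOTs from data qubit \<open>j\<close> to the
  cells of column \<open>j\<close>. After conjugation each of them points the other way, so data
  qubit \<open>j\<close> is flipped once for every cell of its column that is set.\<close>

lemma runf_parity:
  "runf (parity b n) \<phi> = pull (add_data n (\<lambda>s p. odd (length (filter (\<lambda>i. s (blk n b i p)) [0..<n])))) \<phi>"
  (is "_ = pull ?R \<phi>")
proof -
  define Q where "Q = [0..<n] @ map (\<lambda>k. blk n b (fst k) (snd k)) (pairs n)"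
  \<comment> \<open>The pairs of control and target of these CNOTs before conjugation.\<close>
  define ps where "ps = concat (map (\<lambda>j. map (\<lambda>i. (j, blk n b i j)) [0..<n]) [0..<n])"
  have Q: "distinct Q"
    by (auto simp: Q_def distinct_map distinct_pairs inj_on_def prod_eq_iff)
  have H: "fold ap (cells Hadamard [b] n) (fold ap (row Hadamard n) \<phi>) = fold (sq hmat) Q \<phi>" for \<phi>
    by (simp add: Q_def cells_def row_def fold_map_ap fold_map comp_def case_prod_unfold)
  have "fold ap (fan_cols b n) \<phi> = fold (\<lambda>(c, t). pull (fan c [t])) ps \<phi>" for \<phi>
  proof -
    have "fan j (map (\<lambda>i. blk n b i j) [0..<n]) = foldr (\<lambda>t. fan j [t]) (map (\<lambda>i. blk n b i j) [0..<n])"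
      if "j < n" for j
      by (rule fan_foldr) (use that in \<open>auto simp: distinct_map inj_on_def\<close>)
    then have "fold ap (fan_cols b n) \<phi> =
        fold (\<lambda>j. pull (foldr (\<lambda>t. fan j [t]) (map (\<lambda>i. blk n b i j) [0..<n]))) [0..<n] \<phi>"
      unfolding fan_cols_def fold_map_ap by (intro fold_cong) auto
    also have "\<dots> = fold (\<lambda>(c, t). pull (fan c [t])) ps \<phi>"
    proof -
      have "fold (\<lambda>j. pull (foldr (\<lambda>t. fan j [t]) (map (\<lambda>i. blk n b i j) [0..<n]))) js \<phi> =
        fold (\<lambda>(c, t). pull (fan c [t])) (concat (map (\<lambda>j. map (\<lambda>i. (j, blk n b i j)) [0..<n]) js)) \<phi>" for js
        by (induction js arbitrary: \<phi>) (simp_all add: fold_map comp_def flip: fold_pull)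
      then show ?thesis by (simp add: ps_def)
    qed
    finally show ?thesis .
  qed
  then have "runf (parity b n) \<phi> =
      fold (sq hmat) Q (fold (\<lambda>(c, t). pull (fan c [t])) ps (fold (sq hmat) Q \<phi>))"
    by (simp add: parity_def H)
  also have "\<dots> = fold (\<lambda>(c, t). pull (fan t [c])) ps \<phi>"
    by (rule conjugate_fans[OF Q]) (auto simp: ps_def Q_def image_iff Bex_def split_paired_Ex; blast)
  also have "\<dots> = pull (foldr (\<lambda>(c, t). fan t [c]) ps) \<phi>"
    using fold_pull[of "\<lambda>(c, t). fan t [c]" ps \<phi>] by (simp add: case_prod_unfold)
  also have "foldr (\<lambda>(c, t). fan t [c]) ps =
      ?R"
  proof (intro ext)
    fix s p
    \<comment> \<open>Only the pairs that come from column \<open>p\<close> have first component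
      \<open>p\<close>, and they are in bijection with the rows.\<close>
    have len: "length (filter (\<lambda>(c, t). c = p \<and> s t) ps) = length (filter (\<lambda>i. s (blk n b i p)) [0..<n])"
      if "p < n"
    proof -
      have "length (filter (\<lambda>(c, t). c = p \<and> s t) (concat (map (\<lambda>j. map (\<lambda>i. (j, blk n b i j)) [0..<n]) js))) =
        length (filter (\<lambda>i. s (blk n b i p)) [0..<n])" if "distinct js" "p \<in> set js" for js
        using that
      proof (induction js)
        case (Cons j js)
        have "filter (\<lambda>(c, t). c = p \<and> s t) (concat (map (\<lambda>j. map (\<lambda>i. (j, blk n b i j)) [0..<n]) js)) = []"
          if "p \<notin> set js" using that by (auto simp: filter_empty_conv)
        with Cons show ?case by (auto simp: filter_map comp_def filter_empty_conv)
      qed simp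
      with that show ?thesis by (simp add: ps_def)
    qed
    show "foldr (\<lambda>(c, t). fan t [c]) ps s p =
      ?R s p"
      by (subst foldr_fan_parity[of _ n]) (auto simp: ps_def add_data_def len[unfolded ps_def])
  qed
  finally show ?thesis .
qed

lemma runf_tof_cols:
  "fold ap (tof_cols b n) \<phi> = pull (add_data n (\<lambda>s p. \<forall>i<n. s (blk n b i p))) \<phi>"
proof -
  define N where "N = n + Suc b * (n * n)"
  have less: "blk n b i j < N" if "i < n" "j < n" for i j
    unfolding N_def by (rule blk_less[OF lessI that])
  have "n \<le> N" by (simp add: N_def)
  interpret disjoint_layer N "tof_cols b n"
    by (rule disjoint_layerI[of UNIV], rule layer_over_tof_cols[OF N_def]) auto
  have "(Toffoli k, qs @ [p]) \<in> set (tof_cols b n) \<longleftrightarrow>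
      k = n \<and> p < n \<and> qs = map (\<lambda>i. blk n b i p) [0..<n]" for k qs p
    by (auto simp: tof_cols_def)
  then have target: "tof_target (tof_cols b n) p \<longleftrightarrow> p < n"
    and edge: "tof_edge (tof_cols b n) q p \<longleftrightarrow> p < n \<and> (\<exists>i<n. q = blk n b i p)" for p q
    unfolding tof_edge_def tof_target_def by auto
  have "filter is_tof (tof_cols b n) = tof_cols b n"
    by (auto simp: tof_cols_def filter_id_conv)
  then have "fold ap (tof_cols b n) \<phi> = pull (add_data N (\<lambda>s j. tof_target (tof_cols b n) j \<and>
      (\<forall>i<N. tof_edge (tof_cols b n) i j \<longrightarrow> s i))) \<phi>"
    using tof_action[of \<phi>] by simp
  also have "add_data N (\<lambda>s j. tof_target (tof_cols b n) j \<and>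
      (\<forall>i<N. tof_edge (tof_cols b n) i j \<longrightarrow> s i)) = add_data n (\<lambda>s p. \<forall>i<n. s (blk n b i p))"
  proof (intro ext)
    fix s p
    have "(\<forall>q<N. (p < n \<and> (\<exists>i<n. q = blk n b i p)) \<longrightarrow> s q) \<longleftrightarrow> (\<forall>i<n. s (blk n b i p))" if "p < n"
      using less that by blast
    then show "add_data N (\<lambda>s j. tof_target (tof_cols b n) j \<and>
        (\<forall>i<N. tof_edge (tof_cols b n) i j \<longrightarrow> s i)) s p = add_data n (\<lambda>s p. \<forall>i<n. s (blk n b i p)) s p"
      using \<open>n \<le> N\<close> unfolding edge target add_data_def by auto
  qed
  finally show ?thesis .
qed

section \<open>Simulating one kind of gate\<close>

text \<open>Phases do not alter basis states, so the second multiplication finds the same products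
  and clears them. Only the exponents 1, for T, and 4, for Z, are used.\<close>

definition phase_stage :: "nat \<Rightarrow> nat \<Rightarrow> nat \<Rightarrow> nat \<Rightarrow> nat \<Rightarrow> circuit" where
  "phase_stage k a b m n =
     multiply a b m n @ cell_word (replicate k (PiEighth, [b])) n @ multiply a b m n"

definition hadamard_stage :: "nat \<Rightarrow> nat \<Rightarrow> nat \<Rightarrow> nat \<Rightarrow> circuit" where
  "hadamard_stage a b m n = row_word vword_inv n @ phase_stage 4 a b m n @ row_word vword n"

definition fanout_stage :: "nat \<Rightarrow> nat \<Rightarrow> nat \<Rightarrow> nat \<Rightarrow> circuit" where
  "fanout_stage a b m n = multiply a b m n @ parity b n @ multiply a b m n"

definition toffoli_stage :: "nat \<Rightarrow> nat \<Rightarrow> nat \<Rightarrow> nat \<Rightarrow> nat \<Rightarrow> circuit" where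
  "toffoli_stage a b m m' n =
     multiply a b m n @ cell_word [(Fanout 1, [m', b])] n @ [tof_cols b n] @
     cell_word [(Fanout 1, [m', b])] n @ multiply a b m n"

section \<open>Updates of blocks and data as involutions\<close>

lemma add_blk_other: "\<forall>i<n. \<forall>j<n. p \<noteq> blk n b i j \<Longrightarrow> add_blk n b F s p = s p"
  by (auto simp: add_blk_def)

lemma add_data_other: "\<not> p < n \<Longrightarrow> add_data n F s p = s p"
  by (simp add: add_data_def)

lemma assignment_cases:
  fixes n b p :: nat
  obtains (data) "p < n" | (block) i j where "i < n" "j < n" "p = blk n b i j"
  | (other) "\<not> p < n" "\<forall>i<n. \<forall>j<n. p \<noteq> blk n b i j"
  by blast

lemma mul_map_simps [simp]:
  "i < n \<Longrightarrow> j < n \<Longrightarrow> mul_map a b m n s (blk n b i j) =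
    (s (blk n b i j) \<noteq> ((s (blk n a i j) \<noteq> s i) \<and> s (blk n m i j)))"
  "i < n \<Longrightarrow> j < n \<Longrightarrow> r \<noteq> b \<Longrightarrow> mul_map a b m n s (blk n r i j) = s (blk n r i j)"
  "i < n \<Longrightarrow> mul_map a b m n s i = s i"
  by (simp_all add: mul_map_def)

lemma mul_map_other:
  "\<forall>i<n. \<forall>j<n. p \<noteq> blk n b i j \<Longrightarrow> mul_map a b m n s p = s p"
  by (simp add: mul_map_def add_blk_other)

lemma add_blk_involution:
  assumes "\<And>s i j. i < n \<Longrightarrow> j < n \<Longrightarrow> F (add_blk n b F s) i j = F s i j"
  shows "add_blk n b F (add_blk n b F s) = s"
proof
  fix p
  show "add_blk n b F (add_blk n b F s) p = s p"
    by (cases p rule: assignment_cases[where n = n and b = b]) (auto simp: assms add_blk_other)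
qed

lemma add_data_involution:
  assumes "\<And>s i. i < n \<Longrightarrow> F (add_data n F s) i = F s i"
  shows "add_data n F (add_data n F s) = s"
proof
  fix p
  show "add_data n F (add_data n F s) p = s p"
    by (cases "p < n") (auto simp: assms add_data_other)
qed

lemma fold_phase:
  assumes "distinct ks"
  shows "fold (\<lambda>k. sq (dmat (u k)) (h k)) ks \<phi> s = (\<Prod>k\<in>set ks. if s (h k) then u k else 1) * \<phi> s"
  using assms by (induction ks arbitrary: \<phi>) (simp_all add: sq_dmat)

text \<open>\<open>E\<close> singles out the basis states with a prescribed encoding and both
  ancilla blocks clear. By \<open>E_cong\<close> it ignores the data qubits, hence the support
  condition survives every gate on them.\<close>

locale encoded =
  fixes n a b :: nat and E :: "assignment \<Rightarrow> bool"
  assumes ab: "a \<noteq> b"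
    and zero: "E s \<Longrightarrow> i < n \<Longrightarrow> j < n \<Longrightarrow> \<not> s (blk n a i j)" "E s \<Longrightarrow> i < n \<Longrightarrow> j < n \<Longrightarrow> \<not> s (blk n b i j)"
    and E_cong: "(\<And>p. n \<le> p \<Longrightarrow> s p = s' p) \<Longrightarrow> E s = E s'"
begin

definition supp :: "wave \<Rightarrow> bool" where
  "supp \<phi> \<longleftrightarrow> (\<forall>s. \<phi> s \<noteq> 0 \<longrightarrow> E s)"

lemma supp_sq: "q < n \<Longrightarrow> supp \<phi> \<Longrightarrow> supp (sq U q \<phi>)"
proof -
  assume q: "q < n" and "supp \<phi>"
  have "E (s(q := x)) = E s" for s x by (rule E_cong) (use q in auto)
  with \<open>supp \<phi>\<close> show ?thesis unfolding supp_def sq_def by (metis add.right_neutral mult_zero_right)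
qed

lemma supp_fold_sq: "set qs \<subseteq> {..<n} \<Longrightarrow> supp \<phi> \<Longrightarrow> supp (fold (\<lambda>q. sq (U q) q) qs \<phi>)"
  by (induction qs arbitrary: \<phi>) (auto simp: supp_sq)

lemma E_add_data: "E (add_data n F s) = E s"
  by (rule E_cong) (simp add: add_data_other)

lemma supp_add_data: "supp \<phi> \<Longrightarrow> supp (pull (add_data n F) \<phi>)"
  unfolding supp_def pull_def using E_add_data by blast

text \<open>An involution that preserves \<open>E\<close> preserves its complement, too.\<close>
lemma pull_eq_on_supp:
  assumes "supp \<phi>" "\<And>s. q (q s) = s" "\<And>s. E s \<Longrightarrow> q s = g s" "\<And>s. E (g s) = E s"
  shows "pull q \<phi> = pull g \<phi>"
proof
  fix s
  show "pull q \<phi> s = pull g \<phi> s"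
  proof (cases "E s")
    case True
    then show ?thesis by (simp add: pull_def assms(3))
  next
    case False
    then have "\<not> E (q s)" using assms by metis
    then have "\<phi> (q s) = 0" "\<phi> (g s) = 0" using assms(1,4) False unfolding supp_def by blast+
    then show ?thesis by (simp add: pull_def)
  qed
qed

context
  fixes m :: nat
  assumes m: "a \<noteq> m" "m \<noteq> b"
begin

lemma mul_map_involution: "mul_map a b m n (mul_map a b m n s) = s"
  unfolding mul_map_def by (rule add_blk_involution) (use ab m in simp)

text \<open>The two multiplications cancel and leave a product of phases over all cells, evaluated
  where \<open>b\<close> holds the products. Cells off the diagonal contribute 1 since the matrix
  vanishes there, so one factor per data qubit remains.\<close>

lemma runf_phase_stage:
  assumes "supp \<phi>" and M: "\<And>s i j. E s \<Longrightarrow> i < n \<Longrightarrow> j < n \<Longrightarrow> s (blk n m i j) \<longleftrightarrow> i = j \<and> P i"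
  shows "runf (phase_stage k a b m n) \<phi> =
    fold (\<lambda>q. sq (if P q then dmat (\<omega> ^ k) else idm) q) [0..<n] \<phi>" (is "_ = ?R")
proof
  fix s
  let ?f = "mul_map a b m n"
  have word: "runf (cell_word (replicate k (PiEighth, [b])) n) \<psi> =
      fold (\<lambda>p. sq (dmat (\<omega> ^ k)) (blk n b (fst p) (snd p))) (pairs n) \<psi>" for \<psi>
  proof -
    have "\<forall>(g, rs)\<in>set (replicate k (PiEighth, [b])). length rs = arity g" by auto
    from runf_cell_word[OF this, of n \<psi>] show ?thesis
      by (simp add: fold_replicate sq_dmat_power[abs_def])
  qed
  have "runf (phase_stage k a b m n) \<phi> s =
      (\<Prod>p\<in>set (pairs n). if ?f s (blk n b (fst p) (snd p)) then \<omega> ^ k else 1) * \<phi> s"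
    by (simp add: phase_stage_def runf_multiply[OF ab m] word pull_def fold_phase distinct_pairs
        mul_map_involution del: set_product)
  also have "\<dots> = (\<Prod>q\<in>{..<n}. if P q \<and> s q then \<omega> ^ k else 1) * \<phi> s"
  \<comment> \<open>Both sides are multiples of the amplitude at \<open>s\<close>, so only
    assignments in the support matter.\<close>
  proof (cases "\<phi> s = 0")
    case False
    then have E: "E s" using assms(1) unfolding supp_def by blast
    have "(\<Prod>p\<in>set (pairs n). if ?f s (blk n b (fst p) (snd p)) then \<omega> ^ k else 1) =
        (\<Prod>p\<in>{..<n} \<times> {..<n}. if fst p = snd p then (if P (fst p) \<and> s (fst p) then \<omega> ^ k else 1) else 1)"
      by (rule prod.cong) (auto simp: zero[OF E] M[OF E])
    also have "\<dots> = (\<Prod>i<n. \<Prod>j<n. if i = j then (if P i \<and> s i then \<omega> ^ k else 1) else 1)"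
      unfolding prod.cartesian_product by (rule prod.cong) auto
    also have "\<dots> = (\<Prod>i<n. if P i \<and> s i then \<omega> ^ k else 1)"
      by (rule prod.cong) (simp_all add: prod.delta')
    finally show ?thesis by simp
  qed simp
  also have "\<dots> = ?R s"
  proof -
    have "(\<lambda>q. sq (if P q then dmat (\<omega> ^ k) else idm) q) = (\<lambda>q. sq (dmat (if P q then \<omega> ^ k else 1)) q)"
      by (auto simp: fun_eq_iff dmat_def idm_def intro!: arg_cong2[of _ _ _ _ "\<lambda>U. sq U _ _"])
    then have "?R s =
      (\<Prod>q\<in>set [0..<n]. if s q then (if P q then \<omega> ^ k else 1) else 1) * \<phi> s"
      by (simp only: fold_phase distinct_upt)
    also have "(\<Prod>q\<in>set [0..<n]. if s q then (if P q then \<omega> ^ k else 1) else 1) =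
        (\<Prod>q\<in>{..<n}. if P q \<and> s q then \<omega> ^ k else 1)"
      by (rule prod.cong) auto
    finally show ?thesis ..
  qed
  finally show "runf (phase_stage k a b m n) \<phi> s =
    ?R s" .
qed

lemma runf_hadamard_stage:
  assumes "supp \<phi>" and M: "\<And>s i j. E s \<Longrightarrow> i < n \<Longrightarrow> j < n \<Longrightarrow> s (blk n m i j) \<longleftrightarrow> i = j \<and> P i"
  shows "runf (hadamard_stage a b m n) \<phi> = fold (\<lambda>q. sq (if P q then hmat else idm) q) [0..<n] \<phi>"
proof -
  let ?W = "fold (\<lambda>q. sq (wmat vword_inv) q) [0..<n] \<phi>"
  have "supp ?W" by (rule supp_fold_sq) (use assms(1) in auto)
  then have "runf (phase_stage 4 a b m n) ?W =
      fold (\<lambda>q. sq (if P q then dmat (- 1) else idm) q) [0..<n] ?W"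
    by (rule runf_phase_stage[where k = 4, unfolded omega_power_4]) (rule M)
  then have "runf (hadamard_stage a b m n) \<phi> = fold (\<lambda>q. sq (wmat vword) q) [0..<n]
      (fold (\<lambda>q. sq (if P q then dmat (- 1) else idm) q) [0..<n] ?W)"
    by (simp add: hadamard_stage_def runf_row_word vword_def vword_inv_def)
  also have "\<dots> = fold (\<lambda>q. sq (mprod (wmat vword)
      (mprod (if P q then dmat (- 1) else idm) (wmat vword_inv))) q) [0..<n] \<phi>"
    by (simp only: fold_sq_fold_sq distinct_upt)
  also have "(\<lambda>q. mprod (wmat vword) (mprod (if P q then dmat (- 1) else idm) (wmat vword_inv))) =
      (\<lambda>q. if P q then hmat else idm)"
  proof -
    have id: "mprod idm U = U" for U by (auto simp: fun_eq_iff mprod_def idm_def)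
    show ?thesis by (rule ext) (simp add: id vword_conjugate vword_inverse)
  qed
  finally show ?thesis by metis
qed

text \<open>By \<open>unique\<close> a column of products contains at most one true cell, so its
  parity is the value of the selected control. By \<open>control\<close> a selected control is not a
  target and keeps its value, so the second multiplication clears its products.\<close>

lemma runf_fanout_stage:
  assumes "supp \<phi>" and M: "\<And>s i j. E s \<Longrightarrow> i < n \<Longrightarrow> j < n \<Longrightarrow> s (blk n m i j) \<longleftrightarrow> M i j"
    and unique: "\<And>i i' j. i < n \<Longrightarrow> i' < n \<Longrightarrow> j < n \<Longrightarrow> M i j \<Longrightarrow> M i' j \<Longrightarrow> i = i'"
    and control: "\<And>i j k. i < n \<Longrightarrow> j < n \<Longrightarrow> k < n \<Longrightarrow> M i j \<Longrightarrow> \<not> M k i"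
  shows "runf (fanout_stage a b m n) \<phi> = pull (add_data n (\<lambda>s j. \<exists>i<n. M i j \<and> s i)) \<phi>"
proof -
  let ?f = "mul_map a b m n"
  let ?p = "add_data n (\<lambda>s p. odd (length (filter (\<lambda>i. s (blk n b i p)) [0..<n])))"
  let ?g = "add_data n (\<lambda>s j. \<exists>i<n. M i j \<and> s i)"
  have "runf (fanout_stage a b m n) \<phi> = pull (\<lambda>s. ?f (?p (?f s))) \<phi>"
    by (simp add: fanout_stage_def runf_multiply[OF ab m] runf_parity pull_pull)
  also have "\<dots> = pull ?g \<phi>"
  proof (rule pull_eq_on_supp[OF assms(1)])
    fix s
    have "?p (?p s) = s" for s by (rule add_data_involution) simp
    \<comment> \<open>A conjugate of an involution by an involution is an involution.\<close>
    then show "?f (?p (?f (?f (?p (?f s))))) = s" by (simp only: mul_map_involution)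
    show "E (?g s) = E s" by (rule E_add_data)
    assume E: "E s"
    have len: "odd (length (filter (\<lambda>i. ?f s (blk n b i j)) [0..<n])) \<longleftrightarrow> (\<exists>i<n. M i j \<and> s i)"
      if j: "j < n" for j
    proof -
      have eq: "filter (\<lambda>i. ?f s (blk n b i j)) [0..<n] = filter (\<lambda>i. M i j \<and> s i) [0..<n]"
        by (rule filter_cong) (use j zero[OF E] M[OF E] in auto)
      show ?thesis
      proof (cases "\<exists>i<n. M i j \<and> s i")
        case True
        then obtain i where i: "i < n" "M i j" "s i" by blast
        have "set (filter (\<lambda>i. M i j \<and> s i) [0..<n]) = {i}"
          using i j unique by auto
        moreover have "distinct (filter (\<lambda>i. M i j \<and> s i) [0..<n])" by simp
        ultimately have "length (filter (\<lambda>i. M i j \<and> s i) [0..<n]) = 1"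
          by (metis distinct_card card.empty card_insert_disjoint empty_iff finite.emptyI One_nat_def)
        with True eq show ?thesis by simp
      next
        case False
        then have "filter (\<lambda>i. M i j \<and> s i) [0..<n] = []" by (auto simp: filter_empty_conv)
        with False eq show ?thesis by simp
      qed
    qed
    show "?f (?p (?f s)) = ?g s"
    proof
      fix p
      show "?f (?p (?f s)) p = ?g s p"
      proof (cases p rule: assignment_cases[where n = n and b = b])
        case data
        then show ?thesis by (simp add: len)
      next
        case (block i j)
        \<comment> \<open>Clearing the cell requires an unchanged control only where the matrix
          entry is set; elsewhere both products are false.\<close>
        have keep: "?p (?f s) i = s i" if "M i j"
          using len[OF block(1)] control[OF block(1,2) _ that] block by auto
        have "?f (?p (?f s)) (blk n b i j) =
            ((s i \<and> M i j) \<noteq> (?p (?f s) i \<and> M i j))"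
          using block ab m zero[OF E] M[OF E] by (simp del: add_data_simps(1))
        with keep show ?thesis using block zero[OF E] by auto
      next
        case other
        then show ?thesis by (simp add: mul_map_other add_blk_other add_data_other)
      qed
    qed
  qed
  finally show ?thesis .
qed

lemma runf_toffoli_stage:
  assumes "supp \<phi>" and M: "\<And>s i j. E s \<Longrightarrow> i < n \<Longrightarrow> j < n \<Longrightarrow> s (blk n m i j) \<longleftrightarrow> M i j"
    and m': "a \<noteq> m'" "m' \<noteq> b"
    and M': "\<And>s i j. E s \<Longrightarrow> i < n \<Longrightarrow> j < n \<Longrightarrow>
      s (blk n m' i j) \<longleftrightarrow> (if i = j then tgt j else \<not> M i j)"
    and control: "\<And>i j. i < n \<Longrightarrow> j < n \<Longrightarrow> M i j \<Longrightarrow> \<not> tgt i \<and> i \<noteq> j"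
  shows "runf (toffoli_stage a b m m' n) \<phi> =
    pull (add_data n (\<lambda>s j. tgt j \<and> (\<forall>i<n. M i j \<longrightarrow> s i))) \<phi>"
proof -
  let ?f = "mul_map a b m n"
  let ?c = "add_blk n b (\<lambda>s i j. s (blk n m' i j))"
  let ?t = "add_data n (\<lambda>s p. \<forall>i<n. s (blk n b i p))"
  let ?g = "add_data n (\<lambda>s j. tgt j \<and> (\<forall>i<n. M i j \<longrightarrow> s i))"
  have "runf (toffoli_stage a b m m' n) \<phi> = pull (\<lambda>s. ?f (?c (?t (?c (?f s))))) \<phi>"
    by (simp add: toffoli_stage_def runf_multiply[OF ab m] runf_tof_cols runf_copy[OF m'(2), simplified] pull_pull)
  also have "\<dots> = pull ?g \<phi>"
  proof (rule pull_eq_on_supp[OF assms(1)])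
    fix s
    have "?t (?t s) = s" for s by (rule add_data_involution) simp
    moreover have "?c (?c s) = s" for s by (rule add_blk_involution) (use m' in simp)
    ultimately show "?f (?c (?t (?c (?f (?f (?c (?t (?c (?f s))))))))) = s"
      by (simp only: mul_map_involution)
    show "E (?g s) = E s" by (rule E_add_data)
    assume E: "E s"
    \<comment> \<open>A selected control contributes its value, added to false; an unselected one
      contributes false added to true, the neutral element of the conjunction. On the diagonal
      \<open>M j j\<close> is excluded by \<open>control\<close>, so only \<open>tgt j\<close>
      remains.\<close>
    have cf: "?c (?f s) (blk n b i j) \<longleftrightarrow> (if i = j then tgt j else M i j \<longrightarrow> s i)"
      if "i < n" "j < n" for i j
      using that m m' ab zero[OF E] M[OF E] M'[OF E] control[OF that] by auto
    have all: "(\<forall>i<n. ?c (?f s) (blk n b i j)) \<longleftrightarrow> tgt j \<and> (\<forall>i<n. M i j \<longrightarrow> s i)" if "j < n" for j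
    proof -
      have "(\<forall>i<n. ?c (?f s) (blk n b i j)) \<longleftrightarrow> (\<forall>i<n. if i = j then tgt j else M i j \<longrightarrow> s i)"
        using cf that by blast
      then show ?thesis using that control by auto
    qed
    have data: "?t (?c (?f s)) j = ?g s j" if "j < n" for j
      using that by (simp add: all del: add_blk_simps(1,2))
    show "?f (?c (?t (?c (?f s)))) = ?g s"
    proof
      fix p
      show "?f (?c (?t (?c (?f s)))) p = ?g s p"
      proof (cases p rule: assignment_cases[where n = n and b = b])
        case data
        then show ?thesis using all by simp
      next
        case (block i j)
        have keep: "?t (?c (?f s)) i = s i" if "M i j"
          using data[OF block(1)] control[OF block(1,2) that] block by simp
        have "?f (?c (?t (?c (?f s)))) (blk n b i j) =
            ((s i \<and> M i j) \<noteq> (?t (?c (?f s)) i \<and> M i j))"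
          using block ab m m' zero[OF E] M[OF E] by (simp del: add_data_simps(1)) blast
        with keep show ?thesis using block zero[OF E] by auto
      next
        case other
        then show ?thesis by (simp add: mul_map_other add_blk_other add_data_other)
      qed
    qed
  qed
  finally show ?thesis .
qed

end

end

section \<open>The universal circuit\<close>

text \<open>Blocks \<open>5 * l\<close> to \<open>5 * l + 4\<close> hold the encoding of layer
  \<open>l\<close>; blocks \<open>5 * d\<close> and \<open>5 * d + 1\<close> are the ancillas behind
  all encoding blocks and are shared by all layers. The flag \<open>t\<close> tells whether the gate
  family has unbounded Toffoli gates.\<close>

definition block :: "bool \<Rightarrow> nat \<Rightarrow> nat \<Rightarrow> nat \<Rightarrow> circuit" where
  "block t d l n =
     phase_stage 1 (5 * d) (5 * d + 1) (5 * l) n @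
     hadamard_stage (5 * d) (5 * d + 1) (5 * l + 1) n @
     fanout_stage (5 * d) (5 * d + 1) (5 * l + 2) n @
     (if t then toffoli_stage (5 * d) (5 * d + 1) (5 * l + 3) (5 * l + 4) n else [])"

text \<open>
  The last block is added to the selected controls before the big AND: off the diagonal it turns
  the unselected ones into true, and its diagonal keeps columns that are no targets false.
\<close>

definition enc_bit :: "layer \<Rightarrow> nat \<Rightarrow> nat \<Rightarrow> nat \<Rightarrow> bool" where
  "enc_bit L k i j =
     (if k = 0 then i = j \<and> (PiEighth, [i]) \<in> set L
      else if k = 1 then i = j \<and> (Hadamard, [i]) \<in> set L
      else if k = 2 then fan_edge L i j
      else if k = 3 then tof_edge L i j
      else if i = j then tof_target L j else \<not> tof_edge L i j)"

lemma (in encoded) runf_block: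
  assumes "supp \<phi>" "layer_over G n L" "t \<or> (\<forall>k. Toffoli k \<notin> G)"
    and "l < d" "a = 5 * d" "b = 5 * d + 1"
    and enc: "\<And>s k i j. E s \<Longrightarrow> k < 5 \<Longrightarrow> i < n \<Longrightarrow> j < n \<Longrightarrow> s (blk n (5 * l + k) i j) = enc_bit L k i j"
  shows "runf (block t d l n) \<phi> = fold ap L \<phi> \<and> supp (runf (block t d l n) \<phi>)"
proof -
  interpret L: disjoint_layer n L by (rule disjoint_layerI[OF assms(2)])
  let ?F = "\<lambda>P. fold ap (filter P L)"
  define \<phi>1 where "\<phi>1 = ?F (\<lambda>x. fst x = PiEighth) \<phi>"
  define \<phi>2 where "\<phi>2 = ?F (\<lambda>x. fst x = Hadamard) \<phi>1"
  define \<phi>3 where "\<phi>3 = ?F L.is_fan \<phi>2"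
  define \<phi>4 where "\<phi>4 = ?F L.is_tof \<phi>3"
  have m: "a \<noteq> 5 * l + k" "5 * l + k \<noteq> b" if "k < 5" for k
    using assms(4-6) that by auto
  have m2: "a \<noteq> 5 * l + 2" "5 * l + 2 \<noteq> b" and m3: "a \<noteq> 5 * l + 3" "5 * l + 3 \<noteq> b"
    using m[of 2] m[of 3] by auto
  have 1: "\<phi>1 = fold (\<lambda>q. sq (if (PiEighth, [q]) \<in> set L then dmat \<omega> else idm) q) [0..<n] \<phi>"
    unfolding \<phi>1_def by (rule L.single_action) auto
  have s1: "supp \<phi>1" unfolding 1 by (rule supp_fold_sq) (use assms(1) in auto)
  have r1: "runf (phase_stage 1 a b (5 * l + 0) n) \<phi> = \<phi>1"
    unfolding 1
    by (rule runf_phase_stage[where k = 1, unfolded power_one_right])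
      (use assms(1) enc[of _ 0] m[of 0] in \<open>auto simp: enc_bit_def\<close>)
  have 2: "\<phi>2 = fold (\<lambda>q. sq (if (Hadamard, [q]) \<in> set L then hmat else idm) q) [0..<n] \<phi>1"
    unfolding \<phi>2_def by (rule L.single_action) auto
  have s2: "supp \<phi>2" unfolding 2 by (rule supp_fold_sq) (use s1 in auto)
  have r2: "runf (hadamard_stage a b (5 * l + 1) n) \<phi>1 = \<phi>2"
    unfolding 2
    by (rule runf_hadamard_stage) (use s1 enc[of _ 1] m[of 1] in \<open>auto simp: enc_bit_def\<close>)
  have 3: "\<phi>3 = pull (add_data n (\<lambda>s j. \<exists>i<n. fan_edge L i j \<and> s i)) \<phi>2"
    unfolding \<phi>3_def by (rule L.fan_action)
  have s3: "supp \<phi>3" unfolding 3 by (rule supp_add_data[OF s2])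
  have r3: "runf (fanout_stage a b (5 * l + 2) n) \<phi>2 = \<phi>3"
    unfolding 3
  proof (rule runf_fanout_stage[OF m2 s2])
    show "s (blk n (5 * l + 2) i j) = fan_edge L i j" if "E s" "i < n" "j < n" for s i j
      using enc[of s 2 i j] that by (simp add: enc_bit_def)
  qed (use L.fan_edge_unique L.fan_edge_control in auto)
  have 4: "\<phi>4 = pull (add_data n (\<lambda>s j. tof_target L j \<and> (\<forall>i<n. tof_edge L i j \<longrightarrow> s i))) \<phi>3"
    unfolding \<phi>4_def by (rule L.tof_action)
  have s4: "supp \<phi>4" unfolding 4 by (rule supp_add_data[OF s3])
  have r4: "runf (toffoli_stage a b (5 * l + 3) (5 * l + 4) n) \<phi>3 = \<phi>4"
    unfolding 4
  proof (rule runf_toffoli_stage[OF m3 s3])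
    show "s (blk n (5 * l + 3) i j) = tof_edge L i j" if "E s" "i < n" "j < n" for s i j
      using enc[of s 3 i j] that by (simp add: enc_bit_def)
    show "s (blk n (5 * l + 4) i j) = (if i = j then tof_target L j else \<not> tof_edge L i j)"
      if "E s" "i < n" "j < n" for s i j
      using enc[of s 4 i j] that by (simp add: enc_bit_def)
  qed (use m[of 4] L.tof_edge_control in auto)
  have "fold ap L \<phi> = \<phi>4"
    unfolding \<phi>1_def \<phi>2_def \<phi>3_def \<phi>4_def by (rule L.layer_action)
  moreover have "\<phi>4 = \<phi>3" if "\<not> t"
  proof -
    have "filter L.is_tof L = []"
      using that assms(2,3) by (fastforce simp: filter_empty_conv layer_over_def)
    then show ?thesis by (simp add: \<phi>4_def)
  qed
  moreover have "block t d l n = phase_stage 1 a b (5 * l + 0) n @ hadamard_stage a b (5 * l + 1) n @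
      fanout_stage a b (5 * l + 2) n @
      (if t then toffoli_stage a b (5 * l + 3) (5 * l + 4) n else [])"
    by (simp add: block_def assms(5,6))
  then have "runf (block t d l n) \<phi> = (if t then \<phi>4 else \<phi>3)"
    by (cases t) (simp_all only: simp_thms if_True if_False append_Nil2 concat_append fold_append
        comp_def r1 r2 r3 r4)
  ultimately show ?thesis using s3 s4 by auto
qed

definition circ :: "bool \<Rightarrow> nat \<Rightarrow> nat \<Rightarrow> circuit" where
  "circ t n d = concat (map (\<lambda>l. block t d l n) [0..<d])"

definition univ :: "bool \<Rightarrow> nat \<Rightarrow> nat \<Rightarrow> universal_circuit" where
  "univ t n d = \<lparr>enc_qubits = 5 * (d * (n * n)), anc_qubits = 2 * (n * n), layers = circ t n d\<rparr>"

section \<open>Validity and depth of the universal circuit\<close>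

context
  fixes G :: "gate set" and n R N :: nat
  assumes N: "N = n + R * (n * n)"
begin

lemma circuit_over_row_word:
  "set w \<subseteq> {Hadamard, PiEighth} \<Longrightarrow> {Hadamard, PiEighth} \<subseteq> G \<Longrightarrow> circuit_over G N (row_word w n)"
  by (auto simp: circuit_over_def row_word_def intro!: layer_over_row[OF N])

lemma circuit_over_cell_word:
  "\<forall>(g, rs)\<in>set w. g \<in> G \<and> length rs = arity g \<and> set rs \<subseteq> {..<R} \<and> distinct rs \<Longrightarrow>
    circuit_over G N (cell_word w n)"
  by (auto simp: circuit_over_def cell_word_def intro!: layer_over_cells[OF N])

lemma circuit_over_append: "circuit_over G N (C @ D) \<longleftrightarrow> circuit_over G N C \<and> circuit_over G N D"
  by (auto simp: circuit_over_def)

lemma circuit_over_Cons: "circuit_over G N (L # C) \<longleftrightarrow> layer_over G N L \<and> circuit_over G N C"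
  by (auto simp: circuit_over_def)

lemma circuit_over_Nil: "circuit_over G N []"
  by (simp add: circuit_over_def)

lemma circuit_over_multiply:
  assumes "{Hadamard, PiEighth, Fanout 1, Fanout n} \<subseteq> G" "a < R" "b < R" "m < R" "a \<noteq> b" "a \<noteq> m" "m \<noteq> b"
  shows "circuit_over G N (multiply a b m n)"
proof -
  have "circuit_over G N (cell_word (gadget a m b) n)"
    by (rule circuit_over_cell_word) (use assms in \<open>auto simp: gadget_def\<close>)
  then show ?thesis
    using assms
    by (simp add: multiply_def circuit_over_Cons circuit_over_append circuit_over_Nil layer_over_fan_rows[OF N])
qed

lemma circuit_over_block:
  assumes "{Hadamard, PiEighth, Fanout 1, Fanout n} \<subseteq> G" "t \<Longrightarrow> Toffoli n \<in> G" "l < d" "R = 5 * d + 2"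
  shows "circuit_over G N (block t d l n)"
proof -
  have mul: "circuit_over G N (multiply (5 * d) (5 * d + 1) (5 * l + k) n)" if "k < 5" for k
    by (rule circuit_over_multiply) (use that assms in auto)
  have T: "circuit_over G N (cell_word (replicate k (PiEighth, [5 * d + 1])) n)" for k
    by (rule circuit_over_cell_word) (use assms in auto)
  have C: "circuit_over G N (cell_word [(Fanout 1, [5 * l + 4, 5 * d + 1])] n)"
    by (rule circuit_over_cell_word) (use assms in auto)
  have W: "circuit_over G N (row_word vword n)" "circuit_over G N (row_word vword_inv n)"
    by (rule circuit_over_row_word; use assms in \<open>auto simp: vword_def vword_inv_def\<close>)+
  have P: "circuit_over G N (parity (5 * d + 1) n)"
    unfolding parity_def circuit_over_Cons
    by (intro conjI layer_over_row[OF N] layer_over_cells[OF N] layer_over_fan_cols[OF N] circuit_over_Nil)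
      (use assms in auto)
  have F: "t \<Longrightarrow> layer_over G N (tof_cols (5 * d + 1) n)"
    by (rule layer_over_tof_cols[OF N]) (use assms in auto)
  show ?thesis
    using mul[of 0] mul[of 1] mul[of 2] mul[of 3] T[of 1] T[of 4] C W P F
    by (simp add: block_def phase_stage_def hadamard_stage_def fanout_stage_def toffoli_stage_def
        circuit_over_append circuit_over_Cons circuit_over_Nil)
qed

end

lemma circuit_over_univ:
  assumes "{Hadamard, PiEighth, Fanout 1, Fanout n} \<subseteq> G" "t \<Longrightarrow> Toffoli n \<in> G"
  shows "circuit_over G (num_qubits n (univ t n d)) (layers (univ t n d))"
proof -
  have N: "num_qubits n (univ t n d) = n + (5 * d + 2) * (n * n)"
    by (simp add: num_qubits_def univ_def algebra_simps)
  have "circuit_over G (num_qubits n (univ t n d)) (block t d l n)" if "l < d" for l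
    by (rule circuit_over_block[OF N]) (use assms that in auto)
  then show ?thesis by (auto simp: univ_def circ_def circuit_over_def)
qed

text \<open>The gadget has length 33 and \<open>multiply\<close> 35, which gives 313 layers with the
  Toffoli stage and 240 without; 400 is a round bound.\<close>

lemma length_block: "length (block t d l n) \<le> 400"
  by (simp add: block_def phase_stage_def hadamard_stage_def fanout_stage_def toffoli_stage_def
      multiply_def parity_def cell_word_def row_word_def gadget_def vword_def vword_inv_def)

lemma depth_univ: "depth (layers (univ t n d)) \<le> 400 * d"
proof -
  have "length (concat (map (\<lambda>l. block t d l n) ls)) \<le> 400 * length ls" for ls
  proof (induction ls)
    case (Cons l ls)
    then show ?case using length_block[of t d l n] by simp
  qed simp
  from this[of "[0..<d]"] show ?thesis by (simp add: univ_def circ_def)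
qed

section \<open>Correctness of the universal circuit\<close>

lemma runf_circ:
  assumes enc: "encoded n (5 * d) (5 * d + 1) E"
    and C: "length C = d" "circuit_over G n C" "t \<or> (\<forall>k. Toffoli k \<notin> G)"
    and bits: "\<And>s l k i j. E s \<Longrightarrow> l < d \<Longrightarrow> k < 5 \<Longrightarrow> i < n \<Longrightarrow> j < n \<Longrightarrow>
      s (blk n (5 * l + k) i j) = enc_bit (C ! l) k i j"
    and supp: "\<And>s. \<phi> s \<noteq> 0 \<Longrightarrow> E s"
  shows "runf (circ t n d) \<phi> = runf C \<phi>"
proof -
  interpret encoded n "5 * d" "5 * d + 1" E by (rule enc)
  have "runf (concat (map (\<lambda>l. block t d l n) [0..<k])) \<phi> = runf (take k C) \<phi> \<and>
      supp (runf (concat (map (\<lambda>l. block t d l n) [0..<k])) \<phi>)" if "k \<le> d" for k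
    using that
  proof (induction k)
    case 0
    then show ?case using supp by (simp add: supp_def)
  next
    case (Suc k)
    let ?\<psi> = "runf (concat (map (\<lambda>l. block t d l n) [0..<k])) \<phi>"
    have "layer_over G n (C ! k)" using C Suc.prems by (simp add: circuit_over_def)
    then have "runf (block t d k n) ?\<psi> = fold ap (C ! k) ?\<psi> \<and> supp (runf (block t d k n) ?\<psi>)"
      using Suc C bits by (intro runf_block) auto
    moreover have "runf (concat (map (\<lambda>l. block t d l n) [0..<Suc k])) \<phi> = runf (block t d k n) ?\<psi>"
      by simp
    moreover have "?\<psi> = runf (take k C) \<phi>" using Suc by simp
    moreover have "runf (take (Suc k) C) \<phi> = fold ap (C ! k) (runf (take k C) \<phi>)"
      using Suc.prems C(1) by (simp add: take_Suc_conv_app_nth)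
    ultimately show ?case by metis
  qed
  from this[of d] C(1) show ?thesis by (simp add: circ_def)
qed

lemma layer_over_mono:
  assumes "layer_over G n L" "n \<le> N" shows "layer_over G N L"
proof -
  have "{..<n} \<subseteq> {..<N}" using assms(2) by auto
  with assms(1) show ?thesis unfolding layer_over_def case_prod_unfold by (meson subset_trans)
qed

theorem universal_univ:
  assumes "{Hadamard, PiEighth, Fanout 1, Fanout n} \<subseteq> G" "t \<Longrightarrow> Toffoli n \<in> G"
    and "t \<or> (\<forall>k. Toffoli k \<notin> G)" "n > 0"
  shows "universal_for n (circuits_of_depth G n d) (univ t n d)"
  unfolding universal_for_def
proof
  fix C0 assume "C0 \<in> circuits_of_depth G n d"
  then have C0: "circuit_over G n C0" "length C0 \<le> d" by (auto simp: circuits_of_depth_def)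
  \<comment> \<open>Empty layers extend the circuit to depth exactly \<open>d\<close> without
    changing its action, so that every block simulates some layer.\<close>
  define C where "C = C0 @ replicate (d - length C0) []"
  have C: "length C = d" "circuit_over G n C"
    using C0 by (auto simp: C_def circuit_over_def) (simp add: layer_over_def)
  \<comment> \<open>The prescribed content of qubit \<open>n + q\<close>: the base \<open>n\<close>
    digits of \<open>q\<close> recover block number, row and column. The test
    \<open>r < 5 * d\<close> makes it false on the ancilla blocks, so \<open>E\<close> below covers
    encoding and ancillas alike.\<close>
  define e where "e q = (let r = q div n div n in
    r < 5 * d \<and> enc_bit (C ! (r div 5)) (r mod 5) (q div n mod n) (q mod n))" for q
  define x where "x = map e [0..<5 * (d * (n * n))]"
  let ?U = "univ t n d" and ?N = "n + (5 * d + 2) * (n * n)" and ?z = "replicate (2 * (n * n)) False"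
  have N: "num_qubits n ?U = ?N"
    by (simp add: num_qubits_def univ_def algebra_simps)
  define E where "E s \<longleftrightarrow> (\<forall>q. n + q < ?N \<longrightarrow> s (n + q) = e q)" for s :: assignment
  have e_blk: "e ((r * n + i) * n + j) \<longleftrightarrow> r < 5 * d \<and> enc_bit (C ! (r div 5)) (r mod 5) i j"
    if "i < n" "j < n" for r i j
    using that by (simp add: e_def div_mult_self3 Let_def)
  have E_blk: "s (blk n r i j) = (r < 5 * d \<and> enc_bit (C ! (r div 5)) (r mod 5) i j)"
    if "E s" "i < n" "j < n" "r < 5 * d + 2" for s r i j
    using that blk_less[of r "5 * d + 2" i n j] e_blk[of i j r]
    unfolding E_def blk_def by (metis add.assoc)
  have enc: "encoded n (5 * d) (5 * d + 1) E"
  proof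
    show "E s = E s'" if "\<And>p. n \<le> p \<Longrightarrow> s p = s' p" for s s'
      using that by (simp add: E_def)
  qed (simp_all add: E_blk)
  have bits: "s (blk n (5 * l + k) i j) = enc_bit (C ! l) k i j"
    if "E s" "l < d" "k < 5" "i < n" "j < n" for s l k i j
    using E_blk[OF that(1,4,5), of "5 * l + k"] that by simp
  have len_x: "length x = 5 * (d * (n * n))" by (simp add: x_def)
  show "\<exists>x\<in>bitstrings (enc_qubits ?U). \<forall>y\<in>bitstrings n.
      run (layers ?U) (ket (y @ x @ replicate (anc_qubits ?U) False)) =
      tensor n (run C0 (ket y)) (ket (x @ replicate (anc_qubits ?U) False))"
  proof (intro bexI ballI)
    show "x \<in> bitstrings (enc_qubits ?U)" by (simp add: bitstrings_def univ_def len_x)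
    fix y :: "bool list" assume "y \<in> bitstrings n"
    then have y: "length y = n" by (simp add: bitstrings_def)
    let ?w = "y @ x @ ?z"
    have w: "length ?w = ?N" by (simp add: y len_x algebra_simps)
    define \<phi> where "\<phi> s = (of_bool (\<forall>i<?N. s i = ?w ! i) :: complex)" for s :: assignment
    \<comment> \<open>Here \<open>n > 0\<close> matters, since the block number is obtained by
      dividing by \<open>n * n\<close>.\<close>
    have e_anc: "\<not> e q" if "\<not> q < 5 * (d * (n * n))" for q
    proof -
      have "5 * d * (n * n) \<le> q" using that by simp
      then have "5 * d \<le> q div (n * n)"
        using assms(4) by (simp add: less_eq_div_iff_mult_less_eq)
      then show ?thesis by (simp add: e_def div_mult2_eq Let_def)
    qed
    have "?w ! (n + q) = e q" if "n + q < ?N" for q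
    proof (cases "q < 5 * (d * (n * n))")
      case True
      then show ?thesis by (simp add: nth_append y len_x) (simp add: x_def)
    next
      case False
      then have "q - 5 * (d * (n * n)) < 2 * (n * n)" using that by (simp add: algebra_simps)
      with False show ?thesis by (simp add: nth_append y len_x e_anc)
    qed
    then have supp: "E s" if "\<phi> s \<noteq> 0" for s
      using that unfolding \<phi>_def E_def by (auto split: if_splits)
    have "run (layers ?U) (ket ?w) = lift ?N (runf (layers ?U) \<phi>)"
      unfolding ket_lift[OF w] \<phi>_def[symmetric]
      by (rule run_lift[OF circuit_over_univ[where t = t and d = d, OF assms(1,2), unfolded N]])
    also have "runf (layers ?U) \<phi> = runf C \<phi>"
      unfolding univ_def universal_circuit.simps
      by (rule runf_circ[OF enc C assms(3)]; (rule bits | rule supp); assumption)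
    also have "runf C \<phi> = runf C0 \<phi>" by (simp add: C_def)
    \<comment> \<open>\<open>run_lift\<close> is read backwards, with the small circuit placed on
      the large register; \<open>run_tensor\<close> can then separate the data qubits.\<close>
    also have "lift ?N (runf C0 \<phi>) = run C0 (ket ?w)"
    proof -
      have "circuit_over G ?N C0"
        using C0(1) layer_over_mono[of G n _ ?N] by (simp add: circuit_over_def)
      from run_lift[OF this] show ?thesis unfolding ket_lift[OF w] \<phi>_def[symmetric] by simp
    qed
    also have "\<dots> = tensor n (run C0 (ket y)) (ket (x @ ?z))"
      by (simp add: tensor_ket[OF y, symmetric] run_tensor[OF C0(1)])
    finally show "run (layers ?U) (ket (y @ x @ replicate (anc_qubits ?U) False)) =
      tensor n (run C0 (ket y)) (ket (x @ replicate (anc_qubits ?U) False))"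
      by (simp add: univ_def)
  qed
qed

section \<open>Loop programs\<close>

type_synonym store = "nat \<Rightarrow> nat"

text \<open>Increment is the only arithmetic; sums come from sequencing and products from loops. A
  loop holds the only comparison that has to be implemented.\<close>

datatype cmd = Inc nat | Clear nat | Out char | OutBin nat | Seq cmd cmd | For nat nat cmd

primrec iter :: "(store \<Rightarrow> store \<times> string) \<Rightarrow> nat \<Rightarrow> store \<Rightarrow> store \<times> string" where
  "iter f 0 z = (z, [])"
| "iter f (Suc k) z =
     (fst (f (fst (iter f k z))), snd (iter f k z) @ snd (f (fst (iter f k z))))"

definition bump :: "nat \<Rightarrow> store \<times> string \<Rightarrow> store \<times> string" where
  "bump v p = ((fst p)(v := Suc (fst p v)), snd p)"

text \<open>The number of passes is fixed on entry to a loop, whereas the compiled loop compares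
  counter and bound in every round. They agree for well-formed programs, whose bodies assign
  neither.\<close>

primrec exec :: "cmd \<Rightarrow> store \<Rightarrow> store \<times> string" where
  "exec (Inc r) z = (z(r := Suc (z r)), [])"
| "exec (Clear r) z = (z(r := 0), [])"
| "exec (Out c) z = (z, [c])"
| "exec (OutBin r) z = (z, binary (z r))"
| "exec (Seq a b) z =
     (fst (exec b (fst (exec a z))), snd (exec a z) @ snd (exec b (fst (exec a z))))"
| "exec (For v s b) z =
     iter (\<lambda>z. bump v (exec b z)) (z s) (z(v := 0))"

text \<open>\<open>V\<close> is the set of protected registers: the inputs and the counters of the
  enclosing loops. Bounds must be taken from it, so an inner loop may run up to an outer
  counter.\<close>

primrec wf_cmd :: "nat set \<Rightarrow> cmd \<Rightarrow> bool" where
  "wf_cmd V (Inc r) \<longleftrightarrow> r \<notin> V"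
| "wf_cmd V (Clear r) \<longleftrightarrow> r \<notin> V"
| "wf_cmd V (Out c) \<longleftrightarrow> True"
| "wf_cmd V (OutBin r) \<longleftrightarrow> True"
| "wf_cmd V (Seq a b) \<longleftrightarrow> wf_cmd V a \<and> wf_cmd V b"
| "wf_cmd V (For v s b) \<longleftrightarrow> s \<in> V \<and> v \<notin> V \<and> wf_cmd (insert v V) b"

text \<open>
  As no loop bound is ever assigned in a well-formed program, the registers stay polynomial in the
  initial values of the loop bounds.
\<close>

primrec growth :: "nat \<Rightarrow> cmd \<Rightarrow> nat" where
  "growth B (Inc r) = 1"
| "growth B (Clear r) = 0"
| "growth B (Out c) = 0"
| "growth B (OutBin r) = 0"
| "growth B (Seq a b) = growth B a + growth B b"
| "growth B (For v s b) = B * Suc (growth B b)"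

lemma fst_bump [simp]: "fst (bump v p) = (fst p)(v := Suc (fst p v))"
  and snd_bump [simp]: "snd (bump v p) = snd p"
  by (simp_all add: bump_def)

abbreviation body :: "nat \<Rightarrow> cmd \<Rightarrow> store \<Rightarrow> store \<times> string" where
  "body v b \<equiv> (\<lambda>z. bump v (exec b z))"

lemma wf_preserves:
  "wf_cmd V c \<Longrightarrow> v \<in> V \<Longrightarrow> fst (exec c z) v = z v"
proof (induction c arbitrary: V v z)
  case (Seq a b)
  then show ?case by auto
next
  case (For u s b)
  have *: "fst (iter (body u b) k (z(u := 0))) v = z v" for k
  proof (induction k)
    case 0
    with For.prems show ?case by auto
  next
    case (Suc k)
    with For.IH[of "insert u V" v] For.prems show ?case
      by auto
  qed
  then show ?case by simp
qed auto

lemma iter_counter: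
  assumes "wf_cmd (insert v V) b"
  shows "fst (iter (body v b) k (z(v := 0))) v = k"
    "u \<in> V \<Longrightarrow> v \<notin> V \<Longrightarrow> fst (iter (body v b) k (z(v := 0))) u = z u"
  using assms
  by (induction k)
    (auto simp: wf_preserves[OF assms])

lemma exec_growth:
  "wf_cmd V c \<Longrightarrow> \<forall>v\<in>V. z v \<le> B \<Longrightarrow> fst (exec c z) r \<le> z r + growth B c"
proof (induction c arbitrary: V z r)
  case (Seq a b)
  then have "\<forall>v\<in>V. fst (exec a z) v \<le> B" by (auto simp: wf_preserves)
  with Seq.IH(2)[of V "fst (exec a z)" r] Seq.IH(1)[of V z r] Seq.prems show ?case
    by auto
next
  case (For v s b)
  have *: "fst (iter (body v b) k (z(v := 0))) r \<le> z r + k * Suc (growth B b)" if "k \<le> z s" for k r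
    using that
  proof (induction k arbitrary: r)
    case (Suc k)
    let ?\<tau> = "fst (iter (body v b) k (z(v := 0)))"
    \<comment> \<open>The counter is below the loop bound and thus obeys \<open>B\<close> itself, so
      the induction hypothesis applies with the counter among the protected registers.\<close>
    have "\<forall>u\<in>insert v V. ?\<tau> u \<le> B"
      using For.prems Suc.prems by (force simp: iter_counter(1)[of v V] iter_counter(2)[of v V])
    then have "fst (exec b ?\<tau>) r \<le> ?\<tau> r + growth B b" for r
      using For.IH[of "insert v V"] For.prems by simp
    from this[of v] this[of r] Suc.IH[of v] Suc.IH[of r] Suc.prems
    show ?case by (cases "r = v") (simp_all add: fun_upd_same fun_upd_other del: fun_upd_apply)
  qed simp
  have "z s * Suc (growth B b) \<le> B * Suc (growth B b)"
    using For.prems by (intro mult_le_mono1) auto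
  with *[of "z s" r] show ?case by simp
qed auto

text \<open>\<open>K\<close> and \<open>e\<close> depend on the program only. The condition
  \<open>B \<ge> 1\<close> lets exponents be enlarged when two bounds are combined.\<close>

lemma growth_polynomial: "\<exists>K e. \<forall>B\<ge>1. growth B c \<le> K * B ^ e"
proof (induction c)
  case (Seq a b)
  then obtain K e L f where *: "\<And>B. B \<ge> 1 \<Longrightarrow> growth B a \<le> K * B ^ e"
    "\<And>B. B \<ge> 1 \<Longrightarrow> growth B b \<le> L * B ^ f" by blast
  have "growth B (Seq a b) \<le> (K + L) * B ^ (e + f)" if "B \<ge> 1" for B
  proof -
    have "K * B ^ e \<le> K * B ^ (e + f)" "L * B ^ f \<le> L * B ^ (e + f)"
      using that by (intro mult_le_mono2 power_increasing; simp)+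
    with *[OF that] have "growth B a + growth B b \<le> K * B ^ (e + f) + L * B ^ (e + f)" by linarith
    then show ?thesis by (simp add: add_mult_distrib)
  qed
  then show ?case by blast
next
  case (For v s b)
  then obtain K e where *: "\<And>B. B \<ge> 1 \<Longrightarrow> growth B b \<le> K * B ^ e" by blast
  have "growth B (For v s b) \<le> (K + 1) * B ^ (Suc e)" if "B \<ge> 1" for B
  proof -
    have "1 \<le> B ^ e" using that by simp
    with *[OF that] have "Suc (growth B b) \<le> (K + 1) * B ^ e" by simp
    then have "B * Suc (growth B b) \<le> B * ((K + 1) * B ^ e)" by (rule mult_le_mono2)
    then show ?thesis by (simp add: algebra_simps)
  qed
  then show ?case by blast
next
  case (Inc r) show ?case by (intro exI[of _ 1] exI[of _ 0]) simp
qed auto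

section \<open>Functions computed and strings printed by loop programs\<close>

text \<open>
  Register 0 accumulates sums, registers \<open>1, ..., k\<close> hold the inputs and the variables of the
  enclosing loops. An environment lists the latter, innermost loop first.
\<close>

primrec env :: "nat \<Rightarrow> store \<Rightarrow> nat list" where
  "env 0 z = []"
| "env (Suc k) z = z (Suc k) # env k z"

lemma env_cong: "(\<And>v. v \<in> {1..k} \<Longrightarrow> z v = \<tau> v) \<Longrightarrow> env k z = env k \<tau>"
  by (induction k) auto

definition var :: "nat \<Rightarrow> (nat list \<Rightarrow> nat) \<Rightarrow> bool" where
  "var k g \<longleftrightarrow> (\<exists>r\<in>{1..k}. \<forall>z. g (env k z) = z r)"

text \<open>The value is added to register 0 instead of being stored there, so that composing
  programs adds polynomials and looping multiplies them.\<close>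

definition pol :: "nat \<Rightarrow> (nat list \<Rightarrow> nat) \<Rightarrow> bool" where
  "pol k p \<longleftrightarrow> (\<exists>c. wf_cmd {1..k} c \<and>
     (\<forall>z. snd (exec c z) = [] \<and> fst (exec c z) 0 = z 0 + p (env k z)))"

text \<open>The existence of a program is the property itself. Introduction rules that follow the
  shape of the string then replace the writing of an explicit program.\<close>

definition gen :: "nat \<Rightarrow> (nat list \<Rightarrow> string) \<Rightarrow> bool" where
  "gen k f \<longleftrightarrow> (\<exists>c. wf_cmd {1..k} c \<and> (\<forall>z. snd (exec c z) = f (env k z)))"

lemma env_exec: "wf_cmd {1..k} c \<Longrightarrow> env k (fst (exec c z)) = env k z"
  by (rule env_cong) (rule wf_preserves)

lemma var_hd: "var (Suc k) hd"
  unfolding var_def by (rule bexI[of _ "Suc k"]) auto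

lemma var_tl: "var k g \<Longrightarrow> var (Suc k) (\<lambda>e. g (tl e))"
  unfolding var_def by fastforce

lemma atLeastAtMost_insert: "insert (Suc k) {1..k} = {1..Suc k}" by auto

lemma gen_char: "gen k (\<lambda>_. [c])"
  unfolding gen_def by (rule exI[of _ "Out c"]) simp

lemma gen_append:
  assumes "gen k f" "gen k g" shows "gen k (\<lambda>e. f e @ g e)"
proof -
  obtain c where c: "wf_cmd {1..k} c" "\<And>z. snd (exec c z) = f (env k z)"
    using assms(1) unfolding gen_def by blast
  obtain c' where "wf_cmd {1..k} c'" "\<And>z. snd (exec c' z) = g (env k z)"
    using assms(2) unfolding gen_def by blast
  with c show ?thesis unfolding gen_def
    by (intro exI[of _ "Seq c c'"]) (auto simp: env_exec)
qed

lemma gen_Cons: "gen k f \<Longrightarrow> gen k (\<lambda>e. c # f e)"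
  using gen_append[OF gen_char] by simp

lemma env_Suc_iter:
  assumes "wf_cmd {1..Suc k} c"
  shows "env (Suc k) (fst (iter (body (Suc k) c) j (z(Suc k := 0)))) = j # env k z"
proof -
  have wf: "wf_cmd (insert (Suc k) {1..k}) c" using assms by (simp only: atLeastAtMost_insert)
  have "env k (fst (iter (body (Suc k) c) j (z(Suc k := 0)))) = env k z"
    by (rule env_cong) (simp add: iter_counter(2)[OF wf])
  then show ?thesis by (simp add: iter_counter(1)[OF wf])
qed

lemma gen_loop:
  assumes "var k g" "gen (Suc k) (\<lambda>e. f (hd e) (tl e))"
  shows "gen k (\<lambda>e. concat (map (\<lambda>v. f v e) [0..<g e]))"
proof -
  obtain c where wf: "wf_cmd {1..Suc k} c"
    and c: "\<And>z. snd (exec c z) = f (hd (env (Suc k) z)) (tl (env (Suc k) z))"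
    using assms(2) unfolding gen_def by blast
  obtain r where r: "r \<in> {1..k}" "\<And>z. g (env k z) = z r"
    using assms(1) unfolding var_def by blast
  have "snd (iter (body (Suc k) c) j (z(Suc k := 0))) = concat (map (\<lambda>v. f v (env k z)) [0..<j])"
    for j z
    by (induction j)
      (simp_all add: c env_Suc_iter[OF wf] fun_upd_other del: env.simps fun_upd_apply)
  then show ?thesis
    unfolding gen_def using r wf
    by (intro exI[of _ "For (Suc k) r c"]) (auto simp: atLeastAtMost_insert[simplified])
qed

text \<open>Multiplication is repeated addition. One factor must be a variable because it becomes a
  loop bound; longer monomials arise by nesting.\<close>

lemma pol_times:
  assumes "var k g" "pol (Suc k) (\<lambda>e. p (tl e))"
  shows "pol k (\<lambda>e. g e * p e)"
proof -
  obtain c where wf: "wf_cmd {1..Suc k} c" and c: "\<And>z. snd (exec c z) = []"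
     "\<And>z. fst (exec c z) 0 = z 0 + p (tl (env (Suc k) z))"
    using assms(2) unfolding pol_def by blast
  obtain r where r: "r \<in> {1..k}" "\<And>z. g (env k z) = z r"
    using assms(1) unfolding var_def by blast
  have "snd (iter (body (Suc k) c) j (z(Suc k := 0))) = []"
    "fst (iter (body (Suc k) c) j (z(Suc k := 0))) 0 = z 0 + j * p (env k z)" for j z
    by (induction j)
      (simp_all add: c env_Suc_iter[OF wf] fun_upd_other del: env.simps fun_upd_apply)
  then show ?thesis
    unfolding pol_def using r wf
    by (intro exI[of _ "For (Suc k) r c"]) (auto simp: atLeastAtMost_insert[simplified])
qed

lemma pol_one: "pol k (\<lambda>_. 1)"
  unfolding pol_def by (rule exI[of _ "Inc 0"]) simp

lemma pol_zero: "pol k (\<lambda>_. 0)"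
  \<comment> \<open>A program that does nothing of interest: register \<open>Suc k\<close> is
    neither the accumulator nor a protected register.\<close>
  unfolding pol_def by (rule exI[of _ "Clear (Suc k)"]) simp

lemma pol_add:
  assumes "pol k p" "pol k q" shows "pol k (\<lambda>e. p e + q e)"
proof -
  obtain c where c: "wf_cmd {1..k} c"
    "\<And>z. snd (exec c z) = [] \<and> fst (exec c z) 0 = z 0 + p (env k z)"
    using assms(1) unfolding pol_def by blast
  obtain c' where "wf_cmd {1..k} c'"
    "\<And>z. snd (exec c' z) = [] \<and> fst (exec c' z) 0 = z 0 + q (env k z)"
    using assms(2) unfolding pol_def by blast
  with c show ?thesis unfolding pol_def
    by (intro exI[of _ "Seq c c'"]) (auto simp: env_exec)
qed

lemma pol_var: "var k g \<Longrightarrow> pol k g"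
  using pol_times[of k g "\<lambda>_. 1"] pol_one by simp

lemma pol_scale: "pol k p \<Longrightarrow> pol k (\<lambda>e. m * p e)"
  by (induction m) (simp_all add: pol_zero pol_add)

lemma gen_binary:
  assumes "pol k p" shows "gen k (\<lambda>e. binary (p e))"
proof -
  from assms obtain c where c: "wf_cmd {1..k} c"
    "\<And>z. snd (exec c z) = [] \<and> fst (exec c z) 0 = z 0 + p (env k z)"
    unfolding pol_def by blast
  have "env k (z(0 := 0)) = env k z" for z by (rule env_cong) auto
  with c show ?thesis unfolding gen_def
    by (intro exI[of _ "Seq (Clear 0) (Seq c (OutBin 0))"]) auto
qed

section \<open>Compiling loop programs to transducers\<close>

datatype instr =
  IInc nat | IClear nat | IOut char | IBin nat | IJEq nat nat nat | IJmp nat | IRead nat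

type_synonym cell = "char option"
type_synonym cell_map = "nat \<Rightarrow> cell"

definition keep :: "cell list \<Rightarrow> (cell \<times> move) list" where
  "keep us = map (\<lambda>u. (u, Stay)) us"

abbreviation mark :: "cell" where "mark \<equiv> Some (CHR ''$'')"

text \<open>
  A work tape has the mark in cell 0, where the head rests between instructions, and then the
  binary digits of a register, least significant first. State \<open>4 * pc + m\<close> is phase \<open>m\<close> of the
  instruction at \<open>pc\<close>; the states above that put every tape into this form.
\<close>

fun micro :: "nat \<Rightarrow> nat \<Rightarrow> instr \<Rightarrow> cell \<Rightarrow> cell list \<Rightarrow>
    nat \<times> move \<times> (cell \<times> move) list \<times> cell" where
  "micro pc m (IInc r) a us =
     (let u = us ! r in
      if m = 0 then (4 * pc + 1, Stay, (keep us)[r := (u, Go_Right)], None)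
      else if m = 1 then
        if u = Some (CHR ''1'')
        then (4 * pc + 1, Stay, (keep us)[r := (Some (CHR ''0''), Go_Right)], None)
        else (4 * pc + 2, Stay, (keep us)[r := (Some (CHR ''1''), Go_Left)], None)
      else if u = mark then (4 * Suc pc, Stay, (keep us)[r := (u, Stay)], None)
      else (4 * pc + 2, Stay, (keep us)[r := (u, Go_Left)], None))"
| "micro pc m (IClear r) a us =
     (let u = us ! r in
      if m = 0 then (4 * pc + 1, Stay, (keep us)[r := (u, Go_Right)], None)
      else if m = 1 then (4 * pc + 3, Stay, (keep us)[r := (Some (CHR ''0''), Go_Right)], None)
      else if m = 3 then
        if u = None then (4 * pc + 2, Stay, (keep us)[r := (u, Go_Left)], None)
        else (4 * pc + 3, Stay, (keep us)[r := (None, Go_Right)], None)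
      else if u = mark then (4 * Suc pc, Stay, (keep us)[r := (u, Stay)], None)
      else (4 * pc + 2, Stay, (keep us)[r := (u, Go_Left)], None))"
| "micro pc m (IBin r) a us =
     (let u = us ! r in
      if m = 0 then (4 * pc + 1, Stay, (keep us)[r := (u, Go_Right)], None)
      else if m = 1 then
        if u = None then (4 * pc + 3, Stay, (keep us)[r := (u, Go_Left)], None)
        else (4 * pc + 1, Stay, (keep us)[r := (u, Go_Right)], None)
      else if u = mark then (4 * Suc pc, Stay, (keep us)[r := (u, Stay)], None)
      else (4 * pc + 3, Stay, (keep us)[r := (u, Go_Left)], u))"
| "micro pc m (IJEq r s t) a us =
     (let u = us ! r; v = us ! s in
      if m = 0 then (4 * pc + 1, Stay, (keep us)[r := (u, Go_Right), s := (v, Go_Right)], None)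
      else if m = 1 then
        if u \<noteq> v then (4 * pc + 3, Stay, (keep us)[r := (u, Go_Left), s := (v, Go_Left)], None)
        else if u = None
        then (4 * pc + 2, Stay, (keep us)[r := (u, Go_Left), s := (v, Go_Left)], None)
        else (4 * pc + 1, Stay, (keep us)[r := (u, Go_Right), s := (v, Go_Right)], None)
      else if u = mark
      then (if m = 2 then 4 * t else 4 * Suc pc, Stay, (keep us)[r := (u, Stay), s := (v, Stay)], None)
      else (4 * pc + m, Stay, (keep us)[r := (u, Go_Left), s := (v, Go_Left)], None))"
| "micro pc m (IOut c) a us = (4 * Suc pc, Stay, keep us, Some c)"
| "micro pc m (IJmp t) a us = (4 * t, Stay, keep us, None)"
| "micro pc m (IRead t) a us =
     (if a = Some (CHR ''1'') then 4 * Suc pc else 4 * t, Go_Right, keep us, None)"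

primrec target :: "instr \<Rightarrow> nat" where
  "target (IInc r) = 0" | "target (IClear r) = 0" | "target (IOut c) = 0" | "target (IBin r) = 0"
| "target (IJEq r s t) = t" | "target (IJmp t) = t" | "target (IRead t) = t"

text \<open>Halting is running off the end of the program: the halting state is phase 0 of the first
  address after it. Jump targets may therefore equal the length of the program.\<close>

definition machine :: "nat \<Rightarrow> instr list \<Rightarrow> char transducer" where
  "machine R P =
     \<lparr>num_states = 4 * length P + 4, num_tapes = R, start_state = 4 * length P + 1,
      halt_state = 4 * length P,
      trans = (\<lambda>q a us.
        if q < 4 * length P then micro (q div 4) (q mod 4) (P ! (q div 4)) a us
        else if q = 4 * length P + 1
        then (4 * length P + 2, Go_Right, map (\<lambda>_. (mark, Go_Right)) us, None)
        else (0, Stay, map (\<lambda>_. (Some (CHR ''0''), Go_Left)) us, None))\<rparr>"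

lemma transducer_machine:
  assumes "\<forall>i\<in>set P. target i \<le> length P"
  shows "transducer (machine R P)"
proof -
  have "case micro pc m (P ! pc) a us of (q', _, acts, _) \<Rightarrow>
      q' < 4 * length P + 4 \<and> length acts = R"
    if "pc < length P" "m < 4" "length us = R" for pc m a us
    using assms[rule_format, OF nth_mem[OF that(1)]] that
    by (cases "P ! pc") (auto simp: Let_def keep_def)
  then show ?thesis
    by (auto simp: transducer_def machine_def)
qed

section \<open>Binary numerals on tapes\<close>

definition tape :: "string \<Rightarrow> cell_map" where
  "tape xs p = (case p of 0 \<Rightarrow> mark | Suc i \<Rightarrow> if i < length xs then Some (xs ! i) else None)"

lemma tape_0 [simp]: "tape xs 0 = mark"
  by (simp add: tape_def)

lemma tape_Suc [simp]: "tape xs (Suc i) = (if i < length xs then Some (xs ! i) else None)"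
  by (simp add: tape_def)

text \<open>With the least significant digit next to the mark a carry travels away from it and the
  number can grow at the far end. Printing on the way back to the mark yields the most significant
  digit first.\<close>

definition lsb :: "nat \<Rightarrow> string" where
  "lsb k = rev (binary k)"

lemma lsb_rec:
  "lsb k = (if odd k then CHR ''1'' else CHR ''0'') # (if k < 2 then [] else lsb (k div 2))"
  unfolding lsb_def by (subst binary.simps) simp

fun incr :: "string \<Rightarrow> string" where
  "incr [] = ''1''"
| "incr (x # xs) = (if x = CHR ''1'' then CHR ''0'' # incr xs else CHR ''1'' # xs)"

lemma lsb_Suc: "lsb (Suc k) = incr (lsb k)"
proof (induction k rule: less_induct)
  case (less k)
  consider "k = 0" | "k = 1" | "k \<ge> 2" "even k" | "k \<ge> 2" "odd k" by linarith
  then show ?case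
  proof cases
    case 4
    then have "Suc k div 2 = Suc (k div 2)" by presburger
    with 4 less[of "k div 2"] show ?thesis
      by (subst (1 2) lsb_rec) auto
  next
    case 3
    then have "Suc k div 2 = k div 2" by presburger
    with 3 show ?thesis by (subst (1 2) lsb_rec) auto
  next
    case 1 then show ?thesis by (subst (1 2) lsb_rec) simp
  next
    case 2
    have "lsb (Suc 0) = ''1''" by (subst lsb_rec) simp
    then show ?thesis using 2 by (subst (1) lsb_rec) simp
  qed
qed

lemma lsb_digits: "set (lsb k) \<subseteq> {CHR ''0'', CHR ''1''}"
proof (induction k rule: less_induct)
  case (less k)
  show ?case by (subst lsb_rec) (use less[of "k div 2"] in auto)
qed

lemma lsb_nonempty: "lsb k \<noteq> []"
  by (subst lsb_rec) simp

text \<open>Numerals have no leading zeros, so comparing two tapes cell by cell decides equality of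
  the registers.\<close>

lemma lsb_inj: "lsb k = lsb l \<Longrightarrow> k = l"
proof (induction k arbitrary: l rule: less_induct)
  case (less k)
  from less.prems have eq: "odd k = odd l"
    "(if k < 2 then [] else lsb (k div 2)) = (if l < 2 then [] else lsb (l div 2))"
    by (subst (asm) (1 2) lsb_rec, simp split: if_splits)+
  show ?case
  proof (cases "k < 2")
    case True
    with eq lsb_nonempty[of "l div 2"] have "l < 2" by (metis)
    with True eq(1) show ?thesis by (auto simp: less_2_cases_iff)
  next
    case False
    with eq lsb_nonempty[of "k div 2"] have "\<not> l < 2" by metis
    with False eq less.IH[of "k div 2" "l div 2"] have "k div 2 = l div 2" by simp
    with eq(1) show ?thesis by presburger
  qed
qed

lemma lsb_length: "1 \<le> k \<Longrightarrow> real (length (lsb k)) \<le> 1 + log 2 (real k)"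
proof (induction k rule: less_induct)
  case (less k)
  show ?case
  proof (cases "k < 2")
    case True
    then show ?thesis using less.prems by (subst lsb_rec) auto
  next
    case False
    have "length (lsb k) = Suc (length (lsb (k div 2)))"
      using False by (subst lsb_rec) simp
    then have "real (length (lsb k)) \<le> 2 + log 2 (real (k div 2))"
      using less.IH[of "k div 2"] False by simp
    also have "\<dots> \<le> 2 + log 2 (real k / 2)"
    proof -
      have "real (k div 2) \<le> real k / 2" "real (k div 2) > 0" using False by (auto simp: real_of_nat_div)
      then show ?thesis by simp
    qed
    also have "\<dots> = 1 + log 2 (real k)" using False by (simp add: log_divide)
    finally show ?thesis .
  qed
qed

lemma lsb_length_mono: "k \<le> l \<Longrightarrow> length (lsb k) \<le> length (lsb l)"
proof (induction l arbitrary: k rule: less_induct)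
  case (less l)
  show ?case
  proof (cases "k < 2")
    case True
    then have "length (lsb k) = 1" by (subst lsb_rec) simp
    with lsb_nonempty[of l] show ?thesis by (simp add: Suc_leI)
  next
    case False
    with less show ?thesis
      by (subst (1 2) lsb_rec) (auto intro!: less.IH div_le_mono)
  qed
qed

type_synonym tapes = "(cell_map \<times> nat) list"

abbreviation cfg :: "nat \<Rightarrow> nat \<Rightarrow> tapes \<Rightarrow> string \<Rightarrow> char config" where
  "cfg q h W o1 \<equiv> \<lparr>control = q, in_head = h, work = W, out = o1\<rparr>"

abbreviation act :: "cell \<times> move \<Rightarrow> cell_map \<times> nat \<Rightarrow> cell_map \<times> nat" where
  "act \<equiv> \<lambda>(a, m) (t, p). (t(p := a), shift m p)"

abbreviation scan :: "tapes \<Rightarrow> cell list" where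
  "scan W \<equiv> map (\<lambda>(t, p). t p) W"

lemma act_keep: "map2 act (keep (scan W)) W = W"
  by (rule nth_equalityI) (auto simp: keep_def split: prod.split)

lemma act_one:
  "r < length W \<Longrightarrow>
   map2 act ((keep (scan (W[r := (t, p)])))[r := (a, m)]) (W[r := (t, p)]) =
     W[r := (t(p := a), shift m p)]"
  by (rule nth_equalityI) (auto simp: keep_def nth_list_update split: prod.split)

lemma act_two:
  "r < length W \<Longrightarrow> s < length W \<Longrightarrow> r \<noteq> s \<Longrightarrow>
   map2 act ((keep (scan (W[r := (t, p), s := (t', p')])))[r := (a, m), s := (a', m')])
     (W[r := (t, p), s := (t', p')]) =
     W[r := (t(p := a), shift m p), s := (t'(p' := a'), shift m' p')]"
  by (rule nth_equalityI) (auto simp: keep_def nth_list_update split: prod.split)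

section \<open>Runs of the machine within a space bound\<close>

locale machine_run =
  fixes R :: nat and P :: "instr list" and inp :: string and S :: nat
begin

abbreviation M :: "char transducer" where "M \<equiv> machine R P"

definition fits :: "char config \<Rightarrow> bool" where
  "fits c \<longleftrightarrow> (\<forall>(t, p)\<in>set (work c). Suc p \<le> S)"

text \<open>The space bound is part of the step relation, so a proof of reachability bounds the
  space of the run as well. Only the final configuration has to be checked separately.\<close>

definition nxt :: "char config \<Rightarrow> char config \<Rightarrow> bool" where
  "nxt c c' \<longleftrightarrow> fits c \<and> c' = step M inp c"

abbreviation reach :: "char config \<Rightarrow> char config \<Rightarrow> bool" where
  "reach \<equiv> nxt\<^sup>*\<^sup>*"

lemma reach_steps:
  assumes "reach c c'"
  shows "\<exists>t. (step M inp ^^ t) c = c' \<and> (\<forall>t'<t. fits ((step M inp ^^ t') c))"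
  using assms
proof (induction rule: rtranclp_induct)
  case base
  show ?case by (rule exI[of _ 0]) simp
next
  case (step c1 c2)
  then obtain t where "(step M inp ^^ t) c = c1" "\<forall>t'<t. fits ((step M inp ^^ t') c)" by blast
  with step(2) show ?case
    by (intro exI[of _ "Suc t"]) (auto simp: nxt_def less_Suc_eq)
qed

definition home :: "store \<Rightarrow> tapes" where
  "home z = map (\<lambda>r. (tape (lsb (z r)), 0)) [0..<R]"

lemma length_home [simp]: "length (home z) = R"
  by (simp add: home_def)

lemma home_upd: "r < R \<Longrightarrow> (home z)[r := (tape (lsb k), 0)] = home (z(r := k))"
  by (rule nth_equalityI) (auto simp: home_def nth_list_update)

lemma home_same: "r < R \<Longrightarrow> (home z)[r := (tape (lsb (z r)), 0)] = home z"
  by (simp add: home_upd)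

lemma fits_home: "S \<ge> 1 \<Longrightarrow> fits (cfg q h (home z) w)"
  by (auto simp: fits_def home_def)

lemma fits_one:
  assumes "Suc p \<le> S" shows "fits (cfg q h ((home z)[r := (t, p)]) w)"
proof -
  have "set ((home z)[r := (t, p)]) \<subseteq> insert (t, p) (set (home z))" by (rule set_update_subset_insert)
  with assms show ?thesis by (auto simp: fits_def home_def)
qed

lemma fits_two:
  assumes "Suc p \<le> S" "Suc p' \<le> S"
  shows "fits (cfg q h ((home z)[r := (t, p), s := (t', p')]) w)"
proof -
  have "set ((home z)[r := (t, p), s := (t', p')]) \<subseteq>
      insert (t', p') (insert (t, p) (set (home z)))"
    using set_update_subset_insert[of "(home z)[r := (t, p)]" s "(t', p')"]
      set_update_subset_insert[of "home z" r "(t, p)"] by blast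
  with assms show ?thesis by (auto simp: fits_def home_def)
qed

lemma step_machine:
  assumes "pc < length P" "m < 4"
    and "micro pc m (P ! pc) (input_cell inp h) (scan W) = (q, mv, acts, b)"
  shows "step M inp (cfg (4 * pc + m) h W w) =
    cfg q (min (shift mv h) (Suc (length inp))) (map2 act acts W)
      (w @ (case b of None \<Rightarrow> [] | Some s \<Rightarrow> [s]))"
  using assms by (auto simp: step_def machine_def)

lemma nxt_one:
  assumes "pc < length P" "m < 4" "h \<le> Suc (length inp)" "r < R" "Suc p \<le> S"
    and "\<And>us. us ! r = t p \<Longrightarrow>
      micro pc m (P ! pc) (input_cell inp h) us = (q, Stay, (keep us)[r := (a, mv)], b)"
  shows "nxt (cfg (4 * pc + m) h ((home z)[r := (t, p)]) w)
    (cfg q h ((home z)[r := (t(p := a), shift mv p)])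
      (w @ (case b of None \<Rightarrow> [] | Some s \<Rightarrow> [s])))"
proof -
  have "micro pc m (P ! pc) (input_cell inp h) (scan ((home z)[r := (t, p)])) =
      (q, Stay, (keep (scan ((home z)[r := (t, p)])))[r := (a, mv)], b)"
    by (rule assms(6)) (use \<open>r < R\<close> in simp)
  from step_machine[OF assms(1,2) this, of w] show ?thesis
    using assms(3-5) by (simp add: nxt_def fits_one act_one del: map_map)
qed

lemma nxt_two:
  assumes "pc < length P" "m < 4" "h \<le> Suc (length inp)" "r < R" "s < R" "r \<noteq> s"
    "Suc p \<le> S" "Suc p' \<le> S"
    and "\<And>us. us ! r = t p \<Longrightarrow> us ! s = t' p' \<Longrightarrow>
      micro pc m (P ! pc) (input_cell inp h) us =
        (q, Stay, (keep us)[r := (a, mv), s := (a', mv')], None)"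
  shows "nxt (cfg (4 * pc + m) h ((home z)[r := (t, p), s := (t', p')]) w)
    (cfg q h ((home z)[r := (t(p := a), shift mv p), s := (t'(p' := a'), shift mv' p')]) w)"
proof -
  let ?W = "(home z)[r := (t, p), s := (t', p')]"
  have "micro pc m (P ! pc) (input_cell inp h) (scan ?W) =
      (q, Stay, (keep (scan ?W))[r := (a, mv), s := (a', mv')], None)"
    by (rule assms(9)) (use assms(4-6) in \<open>simp_all add: nth_list_update\<close>)
  from step_machine[OF assms(1,2) this, of w] show ?thesis
    using assms(3-8) by (simp add: nxt_def fits_two act_two del: map_map)
qed

lemma nxt_none:
  assumes "pc < length P" "h \<le> Suc (length inp)" "S \<ge> 1"
    and "\<And>us. micro pc 0 (P ! pc) (input_cell inp h) us = (q, mv, keep us, b)"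
  shows "nxt (cfg (4 * pc) h (home z) w)
    (cfg q (min (shift mv h) (Suc (length inp))) (home z)
      (w @ (case b of None \<Rightarrow> [] | Some s \<Rightarrow> [s])))"
  using step_machine[where w = w, OF assms(1) _ assms(4)] assms(2-)
  by (simp add: nxt_def fits_home act_keep)

lemma nxt_write:
  assumes "pc < length P" "m < 4" "h \<le> Suc (length inp)" "r < R" "Suc p \<le> S"
    and "\<And>us. us ! r = t p \<Longrightarrow>
      micro pc m (P ! pc) (input_cell inp h) us = (q, Stay, (keep us)[r := (a, mv)], None)"
    and "t(p := a) = t'" "shift mv p = p'"
  shows "nxt (cfg (4 * pc + m) h ((home z)[r := (t, p)]) w)
    (cfg q h ((home z)[r := (t', p')]) w)"
  using nxt_one[of pc m h r p t q a mv None, OF assms(1-6)] assms(7,8) by simp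

lemma nxt_move:
  assumes "pc < length P" "m < 4" "h \<le> Suc (length inp)" "r < R" "Suc p \<le> S"
    and "\<And>us. us ! r = t p \<Longrightarrow>
      micro pc m (P ! pc) (input_cell inp h) us = (q, Stay, (keep us)[r := (t p, mv)], None)"
    and "shift mv p = p'"
  shows "nxt (cfg (4 * pc + m) h ((home z)[r := (t, p)]) w)
    (cfg q h ((home z)[r := (t, p')]) w)"
  using nxt_write[OF assms(1-6) _ assms(7)] by simp

lemmas nxt_reach = converse_rtranclp_into_rtranclp[of nxt]

context
  fixes pc h r :: nat
  assumes pc: "pc < length P" and h: "h \<le> Suc (length inp)" and r: "r < R"
begin

abbreviation cur :: "nat \<Rightarrow> cell_map \<Rightarrow> nat \<Rightarrow> store \<Rightarrow> string \<Rightarrow> char config" where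
  "cur m t p z w \<equiv> cfg (4 * pc + m) h ((home z)[r := (t, p)]) w"

abbreviation ret :: "cell_map \<Rightarrow> store \<Rightarrow> string \<Rightarrow> char config" where
  "ret t z w \<equiv> cfg (4 * Suc pc) h ((home z)[r := (t, 0)]) w"

lemma rewind:
  assumes "P ! pc = IInc r \<or> P ! pc = IClear r"
    and "t 0 = mark" "\<And>i. 0 < i \<Longrightarrow> i \<le> p \<Longrightarrow> t i \<noteq> mark" "Suc p \<le> S"
  shows "reach (cur 2 t p z w) (ret t z w)"
  using assms(3,4)
proof (induction p)
  case 0
  show ?case
    by (rule r_into_rtranclp, rule nxt_move[where mv = Stay, OF pc _ h r])
      (use assms 0 in \<open>auto simp: Let_def\<close>)
next
  case (Suc p)
  have "t (Suc p) \<noteq> mark" using Suc.prems by simp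
  then have "nxt (cur 2 t (Suc p) z w) (cur 2 t p z w)"
    by (intro nxt_move[where mv = Go_Left, OF pc _ h r])
      (use assms(1,2) Suc.prems in \<open>auto simp: Let_def\<close>)
  moreover have "reach (cur 2 t p z w) (ret t z w)"
    using Suc by simp
  ultimately show ?case by (rule nxt_reach)
qed

lemma leave_home:
  assumes "P ! pc = IInc r \<or> P ! pc = IClear r \<or> P ! pc = IBin r" "S \<ge> 1"
  shows "nxt (cfg (4 * pc) h (home z) w) (cur 1 (tape (lsb (z r))) 1 z w)"
proof -
  have "nxt (cur 0 (tape (lsb (z r))) 0 z w)
    (cur 1 (tape (lsb (z r))) 1 z w)"
    by (rule nxt_move[where mv = Go_Right, OF pc _ h r]) (use assms in \<open>auto simp: Let_def\<close>)
  then show ?thesis using r by (simp add: home_same)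
qed

lemma tape_upd: "(tape (ys @ x # xs))(Suc (length ys) := Some y) = tape (ys @ y # xs)"
  by (rule ext) (auto simp: tape_def nth_append nth_Cons split: nat.split)

lemma tape_ext: "(tape ys)(Suc (length ys) := Some y) = tape (ys @ [y])"
  by (rule ext) (auto simp: tape_def nth_append nth_Cons split: nat.split)

lemma tape_not_mark: "CHR ''$'' \<notin> set xs \<Longrightarrow> 0 < i \<Longrightarrow> tape xs i \<noteq> mark"
  by (cases i) (auto simp: in_set_conv_nth)

text \<open>\<open>ys\<close> are the digits already passed and set to 0, \<open>xs\<close> those
  still to be incremented, with the head on the first of them. The two cells besides the digits are
  the mark and the blank that a last carry may fill.\<close>

lemma run_carry:
  assumes "P ! pc = IInc r" "length ys + length xs + 2 \<le> S"
    "CHR ''$'' \<notin> set ys" "CHR ''$'' \<notin> set xs"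
  shows "reach (cur 1 (tape (ys @ xs)) (Suc (length ys)) z w)
    (ret (tape (ys @ incr xs)) z w)"
  using assms(2-)
proof (induction xs arbitrary: ys)
  case Nil
  have "nxt (cur 1 (tape ys) (Suc (length ys)) z w)
    (cur 2 (tape (ys @ ''1'')) (length ys) z w)"
    by (rule nxt_write[where mv = Go_Left and a = "Some (CHR ''1'')", OF pc _ h r])
      (use assms(1) Nil in \<open>auto simp: Let_def tape_ext simp del: fun_upd_apply\<close>)
  moreover have "reach (cur 2 (tape (ys @ ''1'')) (length ys) z w)
     (ret (tape (ys @ ''1'')) z w)"
    by (intro rewind tape_not_mark tape_0) (use assms(1) Nil in auto)
  ultimately have "reach (cur 1 (tape ys) (Suc (length ys)) z w)
     (ret (tape (ys @ ''1'')) z w)" by (rule nxt_reach)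
  then show ?case by simp
next
  case (Cons x xs)
  show ?case
  proof (cases "x = CHR ''1''")
    case True
    have "nxt (cur 1 (tape (ys @ x # xs)) (Suc (length ys)) z w)
      (cur 1 (tape (ys @ CHR ''0'' # xs)) (Suc (Suc (length ys))) z w)"
      by (rule nxt_write[where mv = Go_Right and a = "Some (CHR ''0'')", OF pc _ h r])
        (use assms(1) Cons.prems True in \<open>auto simp: Let_def tape_upd simp del: fun_upd_apply\<close>)
    moreover have "reach (cur 1 (tape (ys @ CHR ''0'' # xs)) (Suc (Suc (length ys))) z w)
      (ret (tape (ys @ incr (x # xs))) z w)"
      using Cons.IH[of "ys @ ''0''"] Cons.prems True by simp
    ultimately show ?thesis by (rule nxt_reach)
  next
    case False
    have "nxt (cur 1 (tape (ys @ x # xs)) (Suc (length ys)) z w)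
      (cur 2 (tape (ys @ CHR ''1'' # xs)) (length ys) z w)"
      by (rule nxt_write[where mv = Go_Left and a = "Some (CHR ''1'')", OF pc _ h r])
        (use assms(1) Cons.prems False in \<open>auto simp: Let_def tape_upd simp del: fun_upd_apply\<close>)
    moreover have "reach (cur 2 (tape (ys @ CHR ''1'' # xs)) (length ys) z w)
     (ret (tape (ys @ CHR ''1'' # xs)) z w)"
      by (intro rewind tape_not_mark tape_0) (use assms(1) Cons.prems in auto)
    ultimately have "reach (cur 1 (tape (ys @ x # xs)) (Suc (length ys)) z w)
       (ret (tape (ys @ CHR ''1'' # xs)) z w)" by (rule nxt_reach)
    with False show ?thesis by simp
  qed
qed

lemma lsb_not_mark: "CHR ''$'' \<notin> set (lsb k)"
  using lsb_digits[of k] by auto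

lemma run_Inc:
  assumes "P ! pc = IInc r" "length (lsb (z r)) + 2 \<le> S"
  shows "reach (cfg (4 * pc) h (home z) w) (cfg (4 * Suc pc) h (home (z(r := Suc (z r)))) w)"
proof -
  have "nxt (cfg (4 * pc) h (home z) w) (cur 1 (tape (lsb (z r))) 1 z w)"
    by (rule leave_home) (use assms in auto)
  moreover have "reach (cur 1 (tape (lsb (z r))) 1 z w)
    (cfg (4 * Suc pc) h (home (z(r := Suc (z r)))) w)"
    using run_carry[of "[]" "lsb (z r)" z w] assms lsb_not_mark[of "z r"] r
    by (simp add: home_upd flip: lsb_Suc)
  ultimately show ?thesis by (rule nxt_reach)
qed

text \<open>The state of a tape during clearing, when the head has arrived at cell
  \<open>k\<close>.\<close>

definition erased :: "string \<Rightarrow> nat \<Rightarrow> cell_map" where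
  "erased xs k p = (if p = 0 then mark else if p = 1 then Some (CHR ''0'')
     else if p < k then None else tape xs p)"

lemma erased_upd: "2 \<le> k \<Longrightarrow> (erased xs k)(k := None) = erased xs (Suc k)"
  by (auto simp: fun_eq_iff erased_def)

lemma erased_all: "length xs < k \<Longrightarrow> erased xs k = tape ''0''"
  by (auto simp: fun_eq_iff erased_def tape_def split: nat.split)

lemma run_erase:
  assumes "P ! pc = IClear r" "2 \<le> k" "k \<le> length xs + 1" "length xs + 2 \<le> S"
    "CHR ''$'' \<notin> set xs"
  shows "reach (cur 3 (erased xs k) k z w) (ret (tape ''0'') z w)"
  using assms(2,3)
proof (induction "length xs + 1 - k" arbitrary: k)
  case 0
  then have k: "k = length xs + 1" and k_gt: "length xs < k" by simp_all
  then have None: "erased xs k k = None" using 0 by (auto simp: erased_def tape_def split: nat.split)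
  have "nxt (cur 3 (erased xs k) k z w) (cur 2 (erased xs k) (k - 1) z w)"
    by (rule nxt_move[where mv = Go_Left, OF pc _ h r])
      (use assms k None in \<open>auto simp: Let_def\<close>)
  moreover have "reach (cur 2 (erased xs k) (k - 1) z w) (ret (tape ''0'') z w)"
    unfolding erased_all[of xs k, OF k_gt]
    by (intro rewind tape_not_mark tape_0) (use assms k in auto)
  ultimately show ?case by (rule nxt_reach)
next
  case (Suc n)
  then have "erased xs k k \<noteq> None" by (auto simp: erased_def tape_def split: nat.splits)
  then have "nxt (cur 3 (erased xs k) k z w)
      (cur 3 (erased xs (Suc k)) (Suc k) z w)"
    by (intro nxt_write[where mv = Go_Right and a = None, OF pc _ h r])
      (use assms Suc.prems in \<open>auto simp: Let_def erased_upd simp del: fun_upd_apply\<close>)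
  moreover have "reach (cur 3 (erased xs (Suc k)) (Suc k) z w)
    (ret (tape ''0'') z w)"
    by (rule Suc.hyps(1)) (use Suc in auto)
  ultimately show ?case by (rule nxt_reach)
qed

lemma lsb_0: "lsb 0 = ''0''"
  by (subst lsb_rec) simp

lemma run_Clear:
  assumes "P ! pc = IClear r" "length (lsb (z r)) + 2 \<le> S"
  shows "reach (cfg (4 * pc) h (home z) w) (cfg (4 * Suc pc) h (home (z(r := 0))) w)"
proof -
  let ?t = "tape (lsb (z r))"
  have "nxt (cfg (4 * pc) h (home z) w) (cur 1 (?t) 1 z w)"
    by (rule leave_home) (use assms in auto)
  moreover have "?t(1 := Some (CHR ''0'')) = erased (lsb (z r)) 2"
    by (auto simp: fun_eq_iff erased_def)
  then have "nxt (cur 1 (?t) 1 z w) (cur 3 (erased (lsb (z r)) 2) 2 z w)"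
    by (intro nxt_write[where mv = Go_Right and a = "Some (CHR ''0'')", OF pc _ h r])
     (use assms in \<open>auto simp: Let_def simp del: fun_upd_apply\<close>)
  moreover have "reach (cur 3 (erased (lsb (z r)) 2) 2 z w)
    (cfg (4 * Suc pc) h (home (z(r := 0))) w)"
    using run_erase[of 2 "lsb (z r)" z w] assms lsb_not_mark[of "z r"] lsb_nonempty[of "z r"] r
      home_upd[of r z 0]
    by (simp add: lsb_0 Suc_le_eq)
  ultimately show ?thesis by (blast intro: nxt_reach)
qed

text \<open>Digits are output while the head moves left, which explains the reversal.\<close>

lemma run_read_off:
  assumes "P ! pc = IBin r" "i \<le> length xs" "length xs + 2 \<le> S" "CHR ''$'' \<notin> set xs"
  shows "reach (cur 3 (tape xs) i z w) (ret (tape xs) z (w @ rev (take i xs)))"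
  using assms(2)
proof (induction i arbitrary: w)
  case 0
  have "nxt (cur 3 (tape xs) 0 z w) (ret (tape xs) z w)"
    by (rule nxt_move[where mv = Stay, OF pc _ h r]) (use assms 0 in \<open>auto simp: Let_def\<close>)
  then show ?case by simp
next
  case (Suc i)
  have "tape xs (Suc i) \<noteq> mark" using tape_not_mark[OF assms(4)] by blast
  then have "nxt (cur 3 (tape xs) (Suc i) z w)
     (cur 3 ((tape xs)(Suc i := tape xs (Suc i))) (shift Go_Left (Suc i)) z
       (w @ (case tape xs (Suc i) of None \<Rightarrow> [] | Some s \<Rightarrow> [s])))"
    by (intro nxt_one[OF pc _ h r])
      (use assms Suc.prems in \<open>auto simp: Let_def simp del: tape_Suc\<close>)
  then have "nxt (cur 3 (tape xs) (Suc i) z w) (cur 3 (tape xs) i z (w @ [xs ! i]))"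
    unfolding fun_upd_triv using Suc.prems by simp
  moreover have "reach (cur 3 (tape xs) i z (w @ [xs ! i]))
    (ret (tape xs) z (w @ rev (take (Suc i) xs)))"
    using Suc.IH[of "w @ [xs ! i]"] Suc.prems by (simp add: take_Suc_conv_app_nth)
  ultimately show ?case by (rule nxt_reach)
qed

lemma run_to_end:
  assumes "P ! pc = IBin r" "i \<le> length xs" "length xs + 2 \<le> S"
  shows "reach (cur 1 (tape xs) (Suc i) z w) (cur 3 (tape xs) (length xs) z w)"
  using assms(2)
proof (induction "length xs - i" arbitrary: i)
  case 0
  then show ?case
    by (intro r_into_rtranclp, intro nxt_move[where mv = Go_Left, OF pc _ h r])
      (use assms in \<open>auto simp: Let_def\<close>)
next
  case (Suc n)
  then have "nxt (cur 1 (tape xs) (Suc i) z w) (cur 1 (tape xs) (Suc (Suc i)) z w)"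
    by (intro nxt_move[where mv = Go_Right, OF pc _ h r]) (use assms in \<open>auto simp: Let_def\<close>)
  moreover have "reach (cur 1 (tape xs) (Suc (Suc i)) z w)
    (cur 3 (tape xs) (length xs) z w)"
    by (rule Suc.hyps(1)) (use Suc in auto)
  ultimately show ?case by (rule nxt_reach)
qed

lemma run_Bin:
  assumes "P ! pc = IBin r" "length (lsb (z r)) + 2 \<le> S"
  shows "reach (cfg (4 * pc) h (home z) w) (cfg (4 * Suc pc) h (home z) (w @ binary (z r)))"
proof -
  let ?x = "lsb (z r)"
  have "nxt (cfg (4 * pc) h (home z) w) (cur 1 (tape ?x) 1 z w)"
    by (rule leave_home) (use assms in auto)
  moreover have "reach (cur 1 (tape ?x) 1 z w) (cur 3 (tape ?x) (length ?x) z w)"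
    using run_to_end[of 0 ?x z w] assms by simp
  moreover have "reach (cur 3 (tape ?x) (length ?x) z w)
      (cfg (4 * Suc pc) h (home z) (w @ binary (z r)))"
    using run_read_off[of "length ?x" ?x z w] assms lsb_not_mark[of "z r"] r
    by (simp add: home_same) (simp add: lsb_def)
  ultimately show ?thesis by (meson nxt_reach rtranclp_trans)
qed

end

end

context machine_run begin

lemma nxt_two_move:
  assumes "pc < length P" "m < 4" "h \<le> Suc (length inp)" "r < R" "s < R" "r \<noteq> s"
    "Suc p \<le> S"
    and "\<And>us. us ! r = t p \<Longrightarrow> us ! s = t' p \<Longrightarrow>
      micro pc m (P ! pc) (input_cell inp h) us =
        (q, Stay, (keep us)[r := (t p, mv), s := (t' p, mv)], None)"
    and "shift mv p = p'"
  shows "nxt (cfg (4 * pc + m) h ((home z)[r := (t, p), s := (t', p)]) w)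
    (cfg q h ((home z)[r := (t, p'), s := (t', p')]) w)"
  using nxt_two[of pc m h r s p p t t' q "t p" mv "t' p" mv, OF assms(1-7,7,8)] assms(9) by simp

context
  fixes pc h r s t :: nat
  assumes pc: "pc < length P" and h: "h \<le> Suc (length inp)" and r: "r < R" "s < R" "r \<noteq> s"
    and instr: "P ! pc = IJEq r s t"
begin

abbreviation both :: "string \<Rightarrow> string \<Rightarrow> nat \<Rightarrow> store \<Rightarrow> tapes" where
  "both xs ys p z \<equiv> (home z)[r := (tape xs, p), s := (tape ys, p)]"

text \<open>Phases 2 and 3 remember the outcome of the comparison on the way back. Both heads are
  always at the same position, so testing one tape for the mark is enough.\<close>

lemma rewind_both:
  assumes "m = 2 \<or> m = 3" "CHR ''$'' \<notin> set xs" "Suc p \<le> S"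
  shows "reach (cfg (4 * pc + m) h (both xs ys p z) w)
    (cfg (if m = 2 then 4 * t else 4 * Suc pc) h (both xs ys 0 z) w)"
  using assms(3)
proof (induction p)
  case 0
  show ?case
    by (rule r_into_rtranclp, rule nxt_two_move[where mv = Stay, OF pc _ h r])
      (use assms instr 0 in \<open>auto simp: Let_def\<close>)
next
  case (Suc p)
  have "tape xs (Suc p) \<noteq> mark" using tape_not_mark[OF pc h r(1) assms(2)] by blast
  then have "nxt (cfg (4 * pc + m) h (both xs ys (Suc p) z) w)
     (cfg (4 * pc + m) h (both xs ys p z) w)"
    by (intro nxt_two_move[where mv = Go_Left, OF pc _ h r])
      (use assms instr Suc.prems in \<open>auto simp: Let_def simp del: tape_Suc\<close>)
  moreover have "reach (cfg (4 * pc + m) h (both xs ys p z) w)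
    (cfg (if m = 2 then 4 * t else 4 * Suc pc) h (both xs ys 0 z) w)"
    using Suc by simp
  ultimately show ?case by (rule nxt_reach)
qed

text \<open>The heads advance together while the digits agree. A blank against a digit counts as a
  difference, so lengths need no test of their own.\<close>

lemma run_compare:
  assumes "CHR ''$'' \<notin> set xs" "length xs + 2 \<le> S" "length ys + 2 \<le> S"
    and "i \<le> length xs" "i \<le> length ys" "take i xs = take i ys"
  shows "reach (cfg (4 * pc + 1) h (both xs ys (Suc i) z) w)
    (cfg (if xs = ys then 4 * t else 4 * Suc pc) h (both xs ys 0 z) w)"
  using assms(4-)
proof (induction "length xs - i" arbitrary: i rule: less_induct)
  case less
  consider (diff) "tape xs (Suc i) \<noteq> tape ys (Suc i)"
    | (fin) "tape xs (Suc i) = None" "tape ys (Suc i) = None"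
    | (cont) "tape xs (Suc i) = tape ys (Suc i)" "tape xs (Suc i) \<noteq> None" by metis
  then show ?case
  proof cases
    case diff
    then have "xs \<noteq> ys" by auto
    have "nxt (cfg (4 * pc + 1) h (both xs ys (Suc i) z) w) (cfg (4 * pc + 3) h (both xs ys i z) w)"
      by (rule nxt_two_move[where mv = Go_Left, OF pc _ h r])
        (use diff assms less.prems instr in \<open>auto simp: Let_def simp del: tape_Suc\<close>)
    moreover have "reach (cfg (4 * pc + 3) h (both xs ys i z) w)
        (cfg (if 3 = (2::nat) then 4 * t else 4 * Suc pc) h (both xs ys 0 z) w)"
      by (rule rewind_both) (use assms less.prems in auto)
    ultimately have "reach (cfg (4 * pc + 1) h (both xs ys (Suc i) z) w)
      (cfg (if 3 = (2::nat) then 4 * t else 4 * Suc pc) h (both xs ys 0 z) w)" by (rule nxt_reach)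
    with \<open>xs \<noteq> ys\<close> show ?thesis by simp
  next
    case fin
    with less.prems have "i = length xs" "i = length ys" by (auto split: if_splits)
    with less.prems have "xs = ys" by simp
    have "nxt (cfg (4 * pc + 1) h (both xs ys (Suc i) z) w) (cfg (4 * pc + 2) h (both xs ys i z) w)"
      by (rule nxt_two_move[where mv = Go_Left, OF pc _ h r])
        (use fin assms less.prems instr in \<open>auto simp: Let_def simp del: tape_Suc\<close>)
    moreover have "reach (cfg (4 * pc + 2) h (both xs ys i z) w)
        (cfg (if 2 = (2::nat) then 4 * t else 4 * Suc pc) h (both xs ys 0 z) w)"
      by (rule rewind_both) (use assms less.prems in auto)
    ultimately have "reach (cfg (4 * pc + 1) h (both xs ys (Suc i) z) w)
      (cfg (if 2 = (2::nat) then 4 * t else 4 * Suc pc) h (both xs ys 0 z) w)" by (rule nxt_reach)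
    with \<open>xs = ys\<close> show ?thesis by simp
  next
    case cont
    then have i: "i < length xs" "i < length ys" "xs ! i = ys ! i" by (auto split: if_splits)
    have "nxt (cfg (4 * pc + 1) h (both xs ys (Suc i) z) w)
        (cfg (4 * pc + 1) h (both xs ys (Suc (Suc i)) z) w)"
      by (rule nxt_two_move[where mv = Go_Right, OF pc _ h r])
        (use cont i assms less.prems instr in \<open>auto simp: Let_def simp del: tape_Suc\<close>)
    moreover have "reach (cfg (4 * pc + 1) h (both xs ys (Suc (Suc i)) z) w)
      (cfg (if xs = ys then 4 * t else 4 * Suc pc) h (both xs ys 0 z) w)"
      by (rule less.hyps) (use i less.prems in \<open>auto simp: take_Suc_conv_app_nth\<close>)
    ultimately show ?thesis by (rule nxt_reach)
  qed
qed

lemma run_JEq: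
  assumes "length (lsb (z r)) + 2 \<le> S" "length (lsb (z s)) + 2 \<le> S"
  shows "reach (cfg (4 * pc) h (home z) w)
    (cfg (4 * (if z r = z s then t else Suc pc)) h (home z) w)"
proof -
  let ?xs = "lsb (z r)" and ?ys = "lsb (z s)"
  have home: "both ?xs ?ys 0 z = home z" using r by (simp add: home_same)
  have "nxt (cfg (4 * pc + 0) h (both ?xs ?ys 0 z) w) (cfg (4 * pc + 1) h (both ?xs ?ys 1 z) w)"
    by (rule nxt_two_move[where mv = Go_Right, OF pc _ h r])
      (use assms instr in \<open>auto simp: Let_def\<close>)
  moreover have "reach (cfg (4 * pc + 1) h (both ?xs ?ys 1 z) w)
      (cfg (if ?xs = ?ys then 4 * t else 4 * Suc pc) h (both ?xs ?ys 0 z) w)"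
    using run_compare[of ?xs ?ys 0] assms lsb_not_mark[OF pc h r(1)] by simp
  ultimately have "reach (cfg (4 * pc + 0) h (both ?xs ?ys 0 z) w)
      (cfg (if ?xs = ?ys then 4 * t else 4 * Suc pc) h (both ?xs ?ys 0 z) w)"
    by (rule nxt_reach)
  moreover have "?xs = ?ys \<longleftrightarrow> z r = z s" using lsb_inj by auto
  ultimately show ?thesis by (simp add: home if_distrib)
qed

end

lemma run_Out:
  assumes "pc < length P" "h \<le> Suc (length inp)" "S \<ge> 1" "P ! pc = IOut c"
  shows "reach (cfg (4 * pc) h (home z) w) (cfg (4 * Suc pc) h (home z) (w @ [c]))"
  using nxt_none[of pc h "4 * Suc pc" Stay "Some c" z w] assms
  by (intro r_into_rtranclp) auto

lemma run_Jmp: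
  assumes "pc < length P" "h \<le> Suc (length inp)" "S \<ge> 1" "P ! pc = IJmp t"
  shows "reach (cfg (4 * pc) h (home z) w) (cfg (4 * t) h (home z) w)"
  using nxt_none[of pc h "4 * t" Stay None z w] assms
  by (intro r_into_rtranclp) auto

end

section \<open>Compilation and its correctness\<close>

primrec csize :: "cmd \<Rightarrow> nat" where
  "csize (Inc r) = 1" | "csize (Clear r) = 1" | "csize (Out c) = 1" | "csize (OutBin r) = 1"
| "csize (Seq a b) = csize a + csize b"
| "csize (For v s b) = csize b + 4"

text \<open>Jump targets are absolute, hence the address \<open>n\<close> of the first instruction
  as an argument. A loop clears its counter, tests at \<open>n + 1\<close>, has its body at
  \<open>n + 2\<close>, and leaves to the address after its final jump.\<close>

primrec compile :: "nat \<Rightarrow> cmd \<Rightarrow> instr list" where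
  "compile n (Inc r) = [IInc r]"
| "compile n (Clear r) = [IClear r]"
| "compile n (Out c) = [IOut c]"
| "compile n (OutBin r) = [IBin r]"
| "compile n (Seq a b) = compile n a @ compile (n + csize a) b"
| "compile n (For v s b) =
     IClear v # IJEq v s (n + 4 + csize b) # compile (n + 2) b @ [IInc v, IJmp (n + 1)]"

primrec regs :: "cmd \<Rightarrow> nat set" where
  "regs (Inc r) = {r}" | "regs (Clear r) = {r}" | "regs (Out c) = {}" | "regs (OutBin r) = {r}"
| "regs (Seq a b) = regs a \<union> regs b"
| "regs (For v s b) = {v, s} \<union> regs b"

lemma length_comp [simp]: "length (compile n c) = csize c"
  by (induction c arbitrary: n) auto

lemma target_comp: "i \<in> set (compile n c) \<Longrightarrow> target i \<le> n + csize c"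
proof (induction c arbitrary: n)
  case (Seq a b)
  then show ?case by (auto dest!: Seq.IH)
next
  case (For v s b)
  then show ?case by (auto dest!: For.IH)
qed auto

lemma finite_regs: "finite (regs c)"
  by (induction c) auto

context machine_run begin

definition code_at :: "nat \<Rightarrow> instr list \<Rightarrow> bool" where
  "code_at n is \<longleftrightarrow> n + length is \<le> length P \<and> (\<forall>i<length is. P ! (n + i) = is ! i)"

lemma code_at_Cons: "code_at n (i # is) \<longleftrightarrow> n < length P \<and> P ! n = i \<and> code_at (Suc n) is"
  by (auto simp: code_at_def nth_Cons' All_less_Suc2)

lemma code_at_append: "code_at n (is @ js) \<longleftrightarrow> code_at n is \<and> code_at (n + length is) js"
proof -
  have "(\<forall>i<length is + length js. Q i) \<longleftrightarrow>
      (\<forall>i<length is. Q i) \<and> (\<forall>i<length js. Q (length is + i))" for Q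
  proof (intro iffI conjI allI impI)
    fix i
    assume *: "(\<forall>i<length is. Q i) \<and> (\<forall>i<length js. Q (length is + i))"
      and i: "i < length is + length js"
    show "Q i"
    proof (cases "i < length is")
      case False
      then have "Q (length is + (i - length is))" using * i by (intro conjunct2[OF *, rule_format]) simp
      with False show ?thesis by simp
    qed (use * in simp)
  qed auto
  from this[of "\<lambda>i. P ! (n + i) = (is @ js) ! i"]
  show ?thesis by (auto simp: code_at_def nth_append add.assoc simp del: All_less_Suc)
qed

end

context machine_run begin

text \<open>\<open>X\<close> bounds all registers throughout the run, as the initial values plus the
  growth of the program stay below it; \<open>S\<close> has room for any numeral up to
  \<open>X\<close> and two more cells.\<close>

lemma run_comp:
  assumes "\<And>k. k \<le> X \<Longrightarrow> length (lsb k) + 2 \<le> S" "h \<le> Suc (length inp)"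
  shows "wf_cmd V c \<Longrightarrow> regs c \<subseteq> {..<R} \<Longrightarrow> V \<subseteq> {..<R} \<Longrightarrow> \<forall>v\<in>V. z v \<le> B \<Longrightarrow>
    \<forall>r<R. z r + growth B c \<le> X \<Longrightarrow> code_at n (compile n c) \<Longrightarrow>
    reach (cfg (4 * n) h (home z) w)
      (cfg (4 * (n + csize c)) h (home (fst (exec c z))) (w @ snd (exec c z)))"
proof (induction c arbitrary: V z n w)
  case (Inc r)
  from Inc.prems have r: "r < R" and n: "n < length P" "P ! n = IInc r" by (simp_all add: code_at_Cons)
  from Inc.prems(5) r have "z r \<le> X" by (meson add_leD1)
  from run_Inc[OF n(1) assms(2) r n(2), of z w] assms(1)[OF this] show ?case by (simp add: fun_upd_def)
next
  case (Clear r)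
  from Clear.prems have r: "r < R" and n: "n < length P" "P ! n = IClear r" by (simp_all add: code_at_Cons)
  from Clear.prems(5) r have "z r \<le> X" by (meson add_leD1)
  from run_Clear[OF n(1) assms(2) r n(2), of z w] assms(1)[OF this] show ?case by (simp add: fun_upd_def)
next
  case (OutBin r)
  from OutBin.prems have r: "r < R" and n: "n < length P" "P ! n = IBin r" by (simp_all add: code_at_Cons)
  from OutBin.prems(5) r have "z r \<le> X" by (meson add_leD1)
  from run_Bin[OF n(1) assms(2) r n(2), of z w] assms(1)[OF this] show ?case by (simp add: fun_upd_def)
next
  case (Out c)
  have "S \<ge> 1" using assms(1)[of 0] by simp
  with Out show ?case using run_Out[of n h c z w] assms(2) by (simp add: code_at_Cons)
next
  case (Seq a b)
  let ?\<tau> = "fst (exec a z)"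
  have "reach (cfg (4 * n) h (home z) w)
      (cfg (4 * (n + csize a)) h (home ?\<tau>) (w @ snd (exec a z)))"
    using Seq.prems by (intro Seq.IH(1)[of V]) (auto simp: code_at_append)
  moreover have "reach (cfg (4 * (n + csize a)) h (home ?\<tau>) (w @ snd (exec a z)))
    (cfg (4 * (n + csize a + csize b)) h (home (fst (exec b ?\<tau>)))
      ((w @ snd (exec a z)) @ snd (exec b ?\<tau>)))"
  proof (rule Seq.IH(2)[of V])
    show "\<forall>v\<in>V. ?\<tau> v \<le> B" using Seq.prems wf_preserves[of V a] by simp
    show "\<forall>r<R. ?\<tau> r + growth B b \<le> X"
    proof (intro allI impI)
      fix r assume "r < R"
      with exec_growth[of V a z B r] Seq.prems have "?\<tau> r \<le> z r + growth B a"
        "z r + growth B (Seq a b) \<le> X" by auto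
      then show "?\<tau> r + growth B b \<le> X" by simp
    qed
  qed (use Seq.prems in \<open>auto simp: code_at_append\<close>)
  ultimately show ?case by (simp add: add.assoc)
next
  case (For v s b)
  define \<tau> where "\<tau> k = fst (iter (body v b) k (z(v := 0)))" for k
  define u where "u k = w @ snd (iter (body v b) k (z(v := 0)))" for k
  have wf: "wf_cmd (insert v V) b" and v: "v \<notin> V" and s: "s \<in> V" and R: "v < R" "s < R"
    using For.prems by auto
  have code: "n < length P" "P ! n = IClear v" "Suc n < length P"
    "P ! Suc n = IJEq v s (n + 4 + csize b)" "code_at (n + 2) (compile (n + 2) b)"
    "n + 2 + csize b < length P" "P ! (n + 2 + csize b) = IInc v"
    "n + 3 + csize b < length P" "P ! (n + 3 + csize b) = IJmp (Suc n)"
    using For.prems(6) by (simp_all add: code_at_Cons code_at_append add.commute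
        add.left_commute numeral_eq_Suc)
  have \<tau>: "\<tau> k v = k" "x \<in> V \<Longrightarrow> \<tau> k x = z x" for k x
    using iter_counter[OF wf] v by (auto simp: \<tau>_def)
  have \<tau>Suc: "\<tau> (Suc k) = (fst (exec b (\<tau> k)))(v := Suc (fst (exec b (\<tau> k)) v))"
    "u (Suc k) = u k @ snd (exec b (\<tau> k))" for k
    by (simp_all add: \<tau>_def u_def)
  have zs: "z s \<le> B" using For.prems s by blast
  have bound: "\<tau> k x \<le> z x + k * Suc (growth B b)" if "k \<le> z s" for k x
    using that
  proof (induction k arbitrary: x)
    case 0
    then show ?case by (simp add: \<tau>_def)
  next
    case (Suc k)
    have "\<forall>y\<in>insert v V. \<tau> k y \<le> B"
      using For.prems(4) Suc.prems zs by (auto simp: \<tau>)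
    from exec_growth[OF wf this] have "fst (exec b (\<tau> k)) x \<le> \<tau> k x + growth B b" for x .
    from this[of x] this[of v] Suc.IH[of x] Suc.prems
    show ?case by (auto simp: \<tau>Suc(1) \<tau>)
  qed
  \<comment> \<open>Stated for \<open>Suc k\<close> passes, so that after \<open>k\<close> of them
    there is still room for the body and the increment of the counter.\<close>
  have X: "z x + Suc k * Suc (growth B b) \<le> X" if "Suc k \<le> z s" "x < R" for k x
  proof -
    have "Suc k * Suc (growth B b) \<le> B * Suc (growth B b)"
      using that zs by (intro mult_le_mono1) auto
    then show ?thesis using For.prems(5)[rule_format, OF \<open>x < R\<close>] by simp
  qed
  have \<tau>X: "\<tau> k x \<le> X" if "k \<le> z s" "x < R" for k x
  proof -
    have "k * Suc (growth B b) \<le> B * Suc (growth B b)"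
      using that zs by (intro mult_le_mono1) auto
    then show ?thesis using For.prems(5)[rule_format, OF \<open>x < R\<close>] bound[OF that(1), of x] by simp
  qed
  have loop: "reach (cfg (4 * n) h (home z) w) (cfg (4 * Suc n) h (home (\<tau> k)) (u k))"
    if "k \<le> z s" for k
    using that
  proof (induction k)
    case 0
    have "z v \<le> X" using For.prems(5) R by auto
    then show ?case
      using run_Clear[OF code(1) assms(2) R(1) code(2), of z w] assms(1) by (simp add: \<tau>_def u_def fun_upd_def)
  next
    case (Suc k)
    let ?\<tau>' = "fst (exec b (\<tau> k))"
    have "reach (cfg (4 * Suc n) h (home (\<tau> k)) (u k))
       (cfg (4 * (if \<tau> k v = \<tau> k s then n + 4 + csize b else Suc (Suc n))) h (home (\<tau> k)) (u k))"
      using Suc.prems For.prems R v s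
      by (intro run_JEq[OF code(3) assms(2)] code assms(1) \<tau>X) auto
    then have 1: "reach (cfg (4 * Suc n) h (home (\<tau> k)) (u k)) (cfg (4 * (n + 2)) h (home (\<tau> k)) (u k))"
      using Suc.prems s by (simp add: \<tau>)
    have 2: "reach (cfg (4 * (n + 2)) h (home (\<tau> k)) (u k))
      (cfg (4 * (n + 2 + csize b)) h (home ?\<tau>') (u k @ snd (exec b (\<tau> k))))"
    proof (rule For.IH[OF wf])
      show "\<forall>x\<in>insert v V. \<tau> k x \<le> B" using For.prems(4) Suc.prems zs by (auto simp: \<tau>)
      show "\<forall>r<R. \<tau> k r + growth B b \<le> X"
      proof (intro allI impI)
        fix r assume "r < R"
        with bound[of k r] X[of k r] Suc.prems show "\<tau> k r + growth B b \<le> X" by simp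
      qed
    qed (use For.prems code R in auto)
    have "?\<tau>' v = k" using wf_preserves[OF wf] by (simp add: \<tau>)
    then have 3: "reach (cfg (4 * (n + 2 + csize b)) h (home ?\<tau>') (u (Suc k)))
      (cfg (4 * (n + 3 + csize b)) h (home (\<tau> (Suc k))) (u (Suc k)))"
      using run_Inc[OF code(6) assms(2) R(1) code(7), of ?\<tau>' "u (Suc k)"] \<tau>X[of k v] Suc.prems R
        assms(1)[of k]
      by (simp add: \<tau>Suc(1) \<tau> numeral_eq_Suc)
    have "S \<ge> 1" using assms(1)[of 0] by simp
    from run_Jmp[OF code(8) assms(2) this code(9)]
    have 4: "reach (cfg (4 * (n + 3 + csize b)) h (home (\<tau> (Suc k))) (u (Suc k)))
      (cfg (4 * Suc n) h (home (\<tau> (Suc k))) (u (Suc k)))" .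
    from Suc 1 2 3 4 show ?case unfolding \<tau>Suc(2) by (meson Suc_leD rtranclp_trans)
  qed
  have "reach (cfg (4 * Suc n) h (home (\<tau> (z s))) (u (z s)))
     (cfg (4 * (if \<tau> (z s) v = \<tau> (z s) s then n + 4 + csize b else Suc (Suc n))) h
       (home (\<tau> (z s))) (u (z s)))"
    using For.prems R v s
    by (intro run_JEq[OF code(3) assms(2)] code assms(1) \<tau>X) auto
  with loop[of "z s"] have "reach (cfg (4 * n) h (home z) w)
     (cfg (4 * (n + 4 + csize b)) h (home (\<tau> (z s))) (u (z s)))"
    using s by (simp add: \<tau>)
  then show ?case by (simp add: \<tau>_def u_def add.commute add.left_commute fun_upd_def)
qed

end

context machine_run begin

section \<open>Reading the unary input and the space bound\<close>

lemma run_Read: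
  assumes "pc < length P" "h \<le> Suc (length inp)" "S \<ge> 1" "P ! pc = IRead t"
  shows "nxt (cfg (4 * pc) h (home z) w)
    (cfg (4 * (if input_cell inp h = Some (CHR ''1'') then Suc pc else t))
      (min (Suc h) (Suc (length inp))) (home z) w)"
proof -
  have "nxt (cfg (4 * pc) h (home z) w)
    (cfg (if input_cell inp h = Some (CHR ''1'') then 4 * Suc pc else 4 * t)
      (min (shift Go_Right h) (Suc (length inp))) (home z)
      (w @ (case None of None \<Rightarrow> [] | Some s \<Rightarrow> [s])))"
    by (rule nxt_none) (use assms in auto)
  then show ?thesis by (simp add: if_distrib)
qed

text \<open>The three instructions count a run of ones into \<open>r\<close>. The read that leaves
  the loop also steps over the delimiter; the minimum accounts for the second number, whose
  delimiter is the right end where the head stops.\<close>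

lemma run_unary:
  assumes "\<And>k. k \<le> X \<Longrightarrow> length (lsb k) + 2 \<le> S" "r < R"
    and code: "code_at pc [IRead (pc + 3), IInc r, IJmp pc]"
    and "z r + m \<le> X" "h + m \<le> Suc (length inp)"
    and "\<And>i. i < m \<Longrightarrow> input_cell inp (h + i) = Some (CHR ''1'')"
    and "input_cell inp (h + m) \<noteq> Some (CHR ''1'')"
  shows "reach (cfg (4 * pc) h (home z) w)
    (cfg (4 * (pc + 3)) (min (h + m + 1) (Suc (length inp))) (home (z(r := z r + m))) w)"
  using assms(4-)
proof (induction m arbitrary: h z)
  case 0
  have "S \<ge> 1" using assms(1)[of 0] by simp
  from run_Read[of pc h "pc + 3" z w, OF _ _ this] 0 code show ?case
    by (simp add: code_at_Cons)
next
  case (Suc m)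
  have S: "S \<ge> 1" using assms(1)[of 0] by simp
  have "input_cell inp h = Some (CHR ''1'')" using Suc.prems(3)[of 0] by simp
  then have "nxt (cfg (4 * pc) h (home z) w) (cfg (4 * Suc pc) (Suc h) (home z) w)"
    using run_Read[of pc h "pc + 3" z w, OF _ _ S] Suc.prems code by (simp add: code_at_Cons)
  moreover have "reach (cfg (4 * Suc pc) (Suc h) (home z) w)
      (cfg (4 * Suc (Suc pc)) (Suc h) (home (z(r := Suc (z r)))) w)"
    by (rule run_Inc) (use assms(1)[of "z r"] Suc.prems code assms(2) in \<open>auto simp: code_at_Cons\<close>)
  moreover have "reach (cfg (4 * Suc (Suc pc)) (Suc h) (home (z(r := Suc (z r)))) w)
      (cfg (4 * pc) (Suc h) (home (z(r := Suc (z r)))) w)"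
    by (rule run_Jmp) (use S Suc.prems code in \<open>auto simp: code_at_Cons\<close>)
  moreover have "reach (cfg (4 * pc) (Suc h) (home (z(r := Suc (z r)))) w)
      (cfg (4 * (pc + 3)) (min (Suc h + m + 1) (Suc (length inp)))
        (home ((z(r := Suc (z r)))(r := (z(r := Suc (z r))) r + m))) w)"
  proof (rule Suc.IH)
    show "input_cell inp (Suc h + i) = Some (CHR ''1'')" if "i < m" for i
      using Suc.prems(3)[of "Suc i"] that by simp
  qed (use Suc.prems in auto)
  moreover have "(z(r := Suc (z r)))(r := (z(r := Suc (z r))) r + m) = z(r := z r + Suc m)"
    by simp
  moreover have "Suc h + m + 1 = h + Suc m + 1" by simp
  ultimately show ?case by (metis nxt_reach rtranclp_trans)
qed

lemma run_start:
  assumes "S \<ge> 2"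
  shows "reach (initial M) (cfg 0 1 (home (\<lambda>_. 0)) [])"
proof -
  let ?t = "(\<lambda>_. None) (0 := mark)" and ?L = "length P"
  have init: "initial M = cfg (4 * ?L + 1) 0 (replicate R (\<lambda>_. None, 0)) []"
    by (simp add: initial_def machine_def)
  have scan: "map2 act (map (\<lambda>_. (a, m)) (scan (replicate R (t, p)))) (replicate R (t, p)) =
      replicate R (t(p := a), shift m p)" for a m t p
    by (rule nth_equalityI) auto
  have "step M inp (initial M) = cfg (4 * ?L + 2) 1 (replicate R (?t, 1)) []"
    unfolding init using scan[of mark Go_Right "\<lambda>_. None" 0] by (simp add: step_def machine_def)
  then have 1: "nxt (initial M) (cfg (4 * ?L + 2) 1 (replicate R (?t, 1)) [])"
    using assms by (auto simp: nxt_def init fits_def)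
  have "?t(1 := Some (CHR ''0'')) = tape (lsb 0)"
    by (subst lsb_rec) (auto simp: fun_eq_iff tape_def split: nat.split)
  then have "step M inp (cfg (4 * ?L + 2) 1 (replicate R (?t, 1)) []) =
      cfg 0 1 (replicate R (tape (lsb 0), 0)) []"
    using scan[of "Some (CHR ''0'')" Go_Left ?t 1]
    by (simp add: step_def machine_def del: fun_upd_apply)
  moreover have "home (\<lambda>_. 0) = replicate R (tape (lsb 0), 0)"
    by (rule nth_equalityI) (auto simp: home_def)
  ultimately have 2: "nxt (cfg (4 * ?L + 2) 1 (replicate R (?t, 1)) []) (cfg 0 1 (home (\<lambda>_. 0)) [])"
    using assms by (auto simp: nxt_def fits_def)
  from 1 2 show ?thesis by auto
qed

end

definition program :: "cmd \<Rightarrow> instr list" where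
  "program c = [IRead 3, IInc 1, IJmp 0, IRead 6, IInc 2, IJmp 3] @ compile 6 c"

lemma run_program:
  assumes "wf_cmd {1..2} c" "regs c \<subseteq> {..<R}" "2 < R"
    and S: "\<And>k. k \<le> n + d + growth (n + d) c \<Longrightarrow> length (lsb k) + 2 \<le> S"
  shows "\<exists>h z. machine_run.reach R (program c) (unary_input n d) S (initial (machine R (program c)))
    (cfg (4 * length (program c)) h (machine_run.home R z)
      (snd (exec c ((\<lambda>_. 0)(1 := n, 2 := d)))))"
proof -
  interpret machine_run R "program c" "unary_input n d" S .
  let ?i = "unary_input n d" and ?\<tau> = "(\<lambda>_. 0)(1 := n, 2 := d)"
  have len: "length ?i = n + d + 1" by (simp add: unary_input_def)
  have inp: "input_cell ?i p =
      (if p \<in> {1..n} \<union> {n + 2..n + d + 1} then Some (CHR ''1'')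
       else if p = n + 1 then Some (CHR '','') else None)" for p
    by (auto simp: input_cell_def unary_input_def nth_append nth_Cons split: nat.split)
  have code: "code_at 0 [IRead (0 + 3), IInc 1, IJmp 0]" "code_at 3 [IRead (3 + 3), IInc 2, IJmp 3]"
    "code_at 6 (compile 6 c)"
    unfolding code_at_def by (auto simp: program_def nth_append less_Suc_eq)
  have S2: "S \<ge> 2" using S[of 0] by simp
  let ?X = "n + d + growth (n + d) c"
  have 1: "reach (cfg (4 * 0) 1 (home (\<lambda>_. 0)) [])
     (cfg (4 * (0 + 3)) (min (1 + n + 1) (Suc (length ?i))) (home ((\<lambda>_. 0)(1 := 0 + n))) [])"
    using S assms(3) by (intro run_unary[of ?X] code(1)) (auto simp: inp len)
  have 2: "reach (cfg (4 * 3) (n + 2) (home ((\<lambda>_. 0)(1 := n))) [])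
     (cfg (4 * (3 + 3)) (min (n + 2 + d + 1) (Suc (length ?i)))
       (home (((\<lambda>_. 0)(1 := n))(2 := ((\<lambda>_. 0)(1 := n)) (2 :: nat) + d))) [])"
    using S assms(3) by (intro run_unary[of ?X] code(2)) (auto simp: inp len)
  have 3: "reach (cfg (4 * 6) (n + d + 2) (home ?\<tau>) [])
      (cfg (4 * (6 + csize c)) (n + d + 2) (home (fst (exec c ?\<tau>))) ([] @ snd (exec c ?\<tau>)))"
    using S assms by (intro run_comp[of ?X _ "{1..2}" c _ "n + d"] code(3)) (auto simp: len)
  have "reach (initial M) (cfg (4 * (6 + csize c)) (n + d + 2) (home (fst (exec c ?\<tau>)))
      (snd (exec c ?\<tau>)))"
    using run_start[OF S2] 1 2 3 by (simp add: len)
  moreover have "6 + csize c = length (program c)" by (simp add: program_def)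
  ultimately show ?thesis by metis
qed

theorem logspace_computable:
  assumes "gen 2 f"
  shows "\<exists>(M :: char transducer) c. transducer M \<and> (\<forall>n>0. \<forall>d>0.
    computes_in_space M (unary_input n d) (f [d, n]) (c * log 2 (real (n + d))))"
proof -
  obtain p where p: "wf_cmd {1..2} p" "\<And>z. snd (exec p z) = f (env 2 z)"
    using assms unfolding gen_def by blast
  \<comment> \<open>Register 2 receives an input and needs a tape even if the program never mentions
    it.\<close>
  define R where "R = Suc (Max (insert 2 (regs p)))"
  have "r < R" if "r \<in> insert 2 (regs p)" for r
    unfolding R_def using that finite_regs by (intro le_imp_less_Suc Max_ge) auto
  then have R: "regs p \<subseteq> {..<R}" "2 < R" by auto
  obtain K e where K: "\<And>B. B \<ge> 1 \<Longrightarrow> growth B p \<le> K * B ^ e"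
    using growth_polynomial[of p] by blast
  let ?M = "machine R (program p)"
  \<comment> \<open>With B = n + d, the numeral of \<open>X\<close> and two more cells need at most
    3 + log X, where X is at most (K + 1) * B^(e + 1). As B is at least 2, log B is at least 1 and
    absorbs the constants, which gives 3 + log (K + 1) + (e + 1).\<close>
  define c where "c = 4 + log 2 (real (K + 1)) + real e"
  have "target i \<le> length (program p)" if "i \<in> set (program p)" for i
    using that target_comp[of i 6 p] by (auto simp: program_def)
  then have "transducer ?M" by (intro transducer_machine) blast
  moreover have "computes_in_space ?M (unary_input n d) (f [d, n]) (c * log 2 (real (n + d)))"
    if "n > 0" "d > 0" for n d
  proof -
    define X where "X = n + d + growth (n + d) p"
    define S where "S = length (lsb X) + 2"
    interpret machine_run R "program p" "unary_input n d" S .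
    obtain h z where "reach (initial M) (cfg (4 * length (program p)) h (home z)
      (snd (exec p ((\<lambda>_. 0)(1 := n, 2 := d)))))"
      using run_program[OF p(1) R, of n d S] lsb_length_mono unfolding S_def X_def by force
    moreover have "env 2 ((\<lambda>_. 0)(1 := n, 2 := d)) = [d, n]" by (simp add: numeral_2_eq_2)
    ultimately have "reach (initial M) (cfg (4 * length (program p)) h (home z) (f [d, n]))"
      by (simp add: p(2) del: fun_upd_apply)
    then obtain t where t: "(step M (unary_input n d) ^^ t) (initial M) =
        cfg (4 * length (program p)) h (home z) (f [d, n])"
      "\<And>t'. t' < t \<Longrightarrow> fits ((step M (unary_input n d) ^^ t') (initial M))"
      using reach_steps by blast
    \<comment> \<open>A halted configuration is a fixed point, so bounding it and all earlier ones
      bounds the space at all times.\<close>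
    have halted: "(step M (unary_input n d) ^^ (k + t)) (initial M) =
        cfg (4 * length (program p)) h (home z) (f [d, n])" for k
    proof (induction k)
      case (Suc k)
      have "step M (unary_input n d) (cfg (4 * length (program p)) h (home z) (f [d, n])) =
          cfg (4 * length (program p)) h (home z) (f [d, n])"
        by (simp add: step_def machine_def)
      with Suc show ?case by simp
    qed (simp add: t(1))
    have fits: "fits ((step M (unary_input n d) ^^ t') (initial M))" for t'
    proof (cases "t' < t")
      case False
      then have "fits ((step M (unary_input n d) ^^ (t' - t + t)) (initial M))"
        unfolding halted by (intro fits_home) (simp add: S_def)
      with False show ?thesis by simp
    qed (rule t(2))
    have "real S \<le> c * log 2 (real (n + d))"
    proof -
      let ?B = "n + d"
      have B: "?B \<ge> 2" using that by simp
      have "?B ^ 1 \<le> ?B ^ Suc e" "?B ^ e \<le> ?B ^ Suc e" using B by (intro power_increasing; simp)+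
      moreover have "growth ?B p \<le> K * ?B ^ e" using K[of ?B] B by simp
      ultimately have "X \<le> ?B ^ Suc e + K * ?B ^ Suc e"
        unfolding X_def by (metis add_mono mult_le_mono2 order_trans power_one_right)
      then have "X \<le> (K + 1) * ?B ^ Suc e" by simp
      moreover have X: "X \<ge> 1" using B by (simp add: X_def)
      ultimately have "0 < real X" "real X \<le> real ((K + 1) * ?B ^ Suc e)"
        by (simp_all only: of_nat_le_iff of_nat_0_less_iff)
      then have "log 2 (real X) \<le> log 2 (real ((K + 1) * ?B ^ Suc e))"
        by (intro log_mono) auto
      also have "\<dots> = log 2 (real (K + 1)) + real (Suc e) * log 2 (real ?B)"
      proof -
        have "real ?B > 0" using B by simp
        then have "log 2 (real (K + 1) * real ?B ^ Suc e) = log 2 (real (K + 1)) + log 2 (real ?B ^ Suc e)"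
          by (intro log_mult_pos zero_less_power) auto
        then show ?thesis
          by (simp only: of_nat_mult of_nat_power log_nat_power[OF of_nat_0_le_iff])
      qed
      finally have "real S \<le> 3 + log 2 (real (K + 1)) + real (Suc e) * log 2 (real ?B)"
        using lsb_length[OF X] by (simp add: S_def)
      moreover have "1 \<le> log 2 (real ?B)" using B by (subst le_log_iff) auto
      then have "(3 + log 2 (real (K + 1))) * 1 \<le> (3 + log 2 (real (K + 1))) * log 2 (real ?B)"
        by (intro mult_left_mono) auto
      ultimately show ?thesis by (simp add: c_def algebra_simps)
    qed
    then have "real (Suc q) \<le> c * log 2 (real (n + d))" if "Suc q \<le> S" for q
      using that by (meson of_nat_le_iff order_trans)
    with fits have "\<forall>(_, q)\<in>set (work ((step M (unary_input n d) ^^ t') (initial M))).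
        real (Suc q) \<le> c * log 2 (real (n + d))" for t'
      unfolding fits_def by blast
    moreover have "halt_state M = 4 * length (program p)" by (simp add: machine_def)
    ultimately show ?thesis
      unfolding computes_in_space_def by (intro conjI exI[of _ t] allI) (simp_all add: t(1))
  qed
  ultimately show ?thesis by blast
qed

section \<open>Uniformity\<close>

definition genc :: "nat \<Rightarrow> (nat list \<Rightarrow> circuit) \<Rightarrow> bool" where
  "genc k F \<longleftrightarrow> gen k (\<lambda>e. concat (map describe_layer (F e)))"

lemma gen_Nil: "gen k (\<lambda>_. [])"
proof -
  have "wf_cmd {1..k} (Clear 0)" by simp
  then show ?thesis unfolding gen_def by (intro exI[of _ "Clear 0"]) simp
qed

lemma genc_Nil: "genc k (\<lambda>_. [])"
  by (simp add: genc_def gen_Nil)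

lemma genc_Cons: "gen k (\<lambda>e. describe_layer (L e)) \<Longrightarrow> genc k F \<Longrightarrow> genc k (\<lambda>e. L e # F e)"
  by (simp add: genc_def gen_append)

lemma genc_append: "genc k F \<Longrightarrow> genc k F' \<Longrightarrow> genc k (\<lambda>e. F e @ F' e)"
  by (simp add: genc_def gen_append)

text \<open>A symbolic block number, linear in one variable, as in \<open>5 * d + 1\<close> or
  \<open>5 * l + k\<close>. Words over such numbers, like the polymorphic gadget, are fixed lists
  although their values depend on the environment.\<close>

type_synonym blk_no = "nat \<times> (nat list \<Rightarrow> nat) \<times> nat"

fun blk_val :: "nat list \<Rightarrow> blk_no \<Rightarrow> nat" where
  "blk_val e (c, v, c') = c * v e + c'"

lemma pol_blk:
  assumes "var k N" "var k v" "var k I" "var k J"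
  shows "pol k (\<lambda>e. blk (N e) (c * v e + c') (I e) (J e))"
proof -
  \<comment> \<open>The address is multiplied out into monomials in which every factor is a variable
    or a constant, as \<open>pol_times\<close> and \<open>pol_scale\<close> require.\<close>
  have "(\<lambda>e. blk (N e) (c * v e + c') (I e) (J e)) =
    (\<lambda>e. N e + c * (N e * (N e * v e)) + c' * (N e * N e) + N e * I e + J e)"
    by (simp add: blk_def algebra_simps)
  moreover have "pol k (\<lambda>e. N e + c * (N e * (N e * v e)) + c' * (N e * N e) + N e * I e + J e)"
    by (intro pol_add pol_scale pol_times pol_var var_tl assms)
  ultimately show ?thesis by simp
qed

lemma gen_gate_args:
  assumes "\<And>x. x \<in> set xs \<Longrightarrow> pol k (p x)"
  shows "gen k (\<lambda>e. concat (map (\<lambda>x. binary (p x e) @ '','') xs))"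
  using assms
  by (induction xs) (simp_all add: gen_Nil, intro gen_append gen_Cons gen_binary, auto)

lemma gen_row:
  assumes "var k N"
  shows "gen k (\<lambda>e. describe_layer (row g (N e)))"
proof -
  have "(\<lambda>e. describe_layer (row g (N e))) =
      (\<lambda>e. concat (map (\<lambda>i. gate_symbol g # binary i @ '',;'') [0..<N e]) @ ''/'')"
    by (simp add: describe_layer_def row_def describe_gate_def comp_def)
  then show ?thesis
    by (simp only:) (intro gen_append gen_loop gen_Cons gen_binary gen_Nil pol_var var_hd assms)
qed

lemma map_product_concat:
  "concat (map f (List.product xs ys)) = concat (map (\<lambda>x. concat (map (\<lambda>y. f (x, y)) ys)) xs)"
  by (induction xs) (simp_all add: comp_def)

lemma gen_cells:
  assumes "var k N" "\<forall>(c, v, c')\<in>set rs. var k v"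
  shows "gen k (\<lambda>e. describe_layer (cells g (map (blk_val e) rs) (N e)))"
proof -
  have "(\<lambda>e. describe_layer (cells g (map (blk_val e) rs) (N e))) =
    (\<lambda>e. concat (map (\<lambda>i. concat (map (\<lambda>j. gate_symbol g #
      concat (map (\<lambda>x. binary (blk (N e) (blk_val e x) i j) @ '','') rs) @ '';'') [0..<N e])) [0..<N e]) @ ''/'')"
    by (simp add: describe_layer_def cells_def describe_gate_def comp_def case_prod_unfold
        map_product_concat)
  moreover have "gen (Suc (Suc k)) (\<lambda>e. concat (map (\<lambda>x. binary
      (blk (N (tl (tl e))) (blk_val (tl (tl e)) x) (hd (tl e)) (hd e)) @ '','') rs))"
  proof (rule gen_gate_args)
    fix x assume "x \<in> set rs"
    with assms(2) obtain c v c' where "x = (c, v, c')" "var k v" by (cases x) auto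
    then show "pol (Suc (Suc k)) (\<lambda>e. blk (N (tl (tl e))) (blk_val (tl (tl e)) x) (hd (tl e)) (hd e))"
      unfolding \<open>x = _\<close> blk_val.simps by (intro pol_blk var_tl var_hd assms(1))
  qed
  ultimately show ?thesis
    by (simp only:)
      (intro gen_append gen_loop gen_Cons gen_Nil var_tl var_hd assms(1))
qed

lemma genc_cell_word:
  assumes "var k N" "\<forall>(g, rs)\<in>set w. \<forall>(c, v, c')\<in>set rs. var k v"
  shows "genc k (\<lambda>e. cell_word (map (\<lambda>(g, rs). (g, map (blk_val e) rs)) w) (N e))"
  using assms(2)
proof (induction w)
  case Nil
  then show ?case by (simp add: cell_word_def genc_Nil)
next
  case (Cons x w)
  obtain g rs where x: "x = (g, rs)" by force
  have "genc k (\<lambda>e. cells g (map (blk_val e) rs) (N e) #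
      cell_word (map (\<lambda>(g, rs). (g, map (blk_val e) rs)) w) (N e))"
    using Cons x assms(1) by (intro genc_Cons gen_cells) auto
  then show ?case by (simp add: cell_word_def x)
qed

lemma genc_row_word: "var k N \<Longrightarrow> genc k (\<lambda>e. row_word w (N e))"
  unfolding row_word_def by (induction w) (simp_all add: genc_Nil genc_Cons gen_row)

lemma gen_fan_rows:
  assumes "var k N" "var k v"
  shows "gen k (\<lambda>e. describe_layer (fan_rows (c * v e + c') (N e)))"
proof -
  have "(\<lambda>e. describe_layer (fan_rows (c * v e + c') (N e))) =
    (\<lambda>e. concat (map (\<lambda>i. CHR ''F'' # binary i @ '','' @ concat (map (\<lambda>j.
      binary (blk (N e) (c * v e + c') i j) @ '','') [0..<N e]) @ '';'') [0..<N e]) @ ''/'')"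
    by (simp add: describe_layer_def fan_rows_def describe_gate_def comp_def)
  then show ?thesis
    by (simp only:) (intro gen_append gen_loop gen_Cons gen_Nil gen_binary pol_blk pol_var var_tl var_hd assms)
qed

lemma gen_fan_cols:
  assumes "var k N" "var k v"
  shows "gen k (\<lambda>e. describe_layer (fan_cols (c * v e + c') (N e)))"
proof -
  have "(\<lambda>e. describe_layer (fan_cols (c * v e + c') (N e))) =
    (\<lambda>e. concat (map (\<lambda>j. CHR ''F'' # binary j @ '','' @ concat (map (\<lambda>i.
      binary (blk (N e) (c * v e + c') i j) @ '','') [0..<N e]) @ '';'') [0..<N e]) @ ''/'')"
    by (simp add: describe_layer_def fan_cols_def describe_gate_def comp_def)
  then show ?thesis
    by (simp only:) (intro gen_append gen_loop gen_Cons gen_Nil gen_binary pol_blk pol_var var_tl var_hd assms)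
qed

lemma gen_tof_cols:
  assumes "var k N" "var k v"
  shows "gen k (\<lambda>e. describe_layer (tof_cols (c * v e + c') (N e)))"
proof -
  have "(\<lambda>e. describe_layer (tof_cols (c * v e + c') (N e))) =
    (\<lambda>e. concat (map (\<lambda>j. CHR ''A'' # concat (map (\<lambda>i.
      binary (blk (N e) (c * v e + c') i j) @ '','') [0..<N e]) @ binary j @ '',;'') [0..<N e]) @ ''/'')"
    by (simp add: describe_layer_def tof_cols_def describe_gate_def comp_def)
  then show ?thesis
    by (simp only:) (intro gen_append gen_loop gen_Cons gen_Nil gen_binary pol_blk pol_var var_tl var_hd assms)
qed

text \<open>Naturality in the names of the qubits, which passes from symbolic to actual block
  numbers.\<close>

lemma gadget_map:
  "map (\<lambda>(g, rs). (g, map h rs)) (gadget a m b) = gadget (h a) (h m) (h b)"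
  by (simp add: gadget_def)

context
  fixes k :: nat and N D V :: "nat list \<Rightarrow> nat"
  assumes vars: "var k N" "var k D" "var k V"
begin

lemma genc_multiply: "genc k (\<lambda>e. multiply (5 * D e) (5 * D e + 1) (5 * V e + c) (N e))"
proof -
  have "genc k (\<lambda>e. cell_word (map (\<lambda>(g, rs). (g, map (blk_val e) rs))
      (gadget (5, D, 0) (5, V, c) (5, D, 1))) (N e))"
    by (rule genc_cell_word) (use vars in \<open>auto simp: gadget_def\<close>)
  then have "genc k (\<lambda>e. cell_word (gadget (5 * D e) (5 * V e + c) (5 * D e + 1)) (N e))"
    by (simp add: gadget_map)
  then show ?thesis
    unfolding multiply_def
    using gen_fan_rows[OF vars(1,2), of 5 0]
    by (intro genc_Cons genc_append genc_Nil) simp_all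
qed

lemma genc_phase_stage: "genc k (\<lambda>e. phase_stage r (5 * D e) (5 * D e + 1) (5 * V e + c) (N e))"
proof -
  have "genc k (\<lambda>e. cell_word (map (\<lambda>(g, rs). (g, map (blk_val e) rs))
      (replicate r (PiEighth, [(5, D, 1)]))) (N e))"
    by (rule genc_cell_word) (use vars in auto)
  then show ?thesis
    unfolding phase_stage_def by (intro genc_append genc_multiply) simp
qed

lemma genc_copy:
  "genc k (\<lambda>e. cell_word [(Fanout 1, [5 * V e + c, 5 * D e + 1])] (N e))"
  using genc_cell_word[OF vars(1), of "[(Fanout 1, [(5, V, c), (5, D, 1)])]"] vars by simp

lemma genc_parity: "genc k (\<lambda>e. parity (5 * D e + 1) (N e))"
proof -
  have "gen k (\<lambda>e. describe_layer (cells Hadamard [5 * D e + 1] (N e)))"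
    using gen_cells[OF vars(1), of "[(5, D, 1)]" Hadamard] vars by simp
  then show ?thesis
    unfolding parity_def by (intro genc_Cons genc_Nil gen_row gen_fan_cols vars)
qed

lemma genc_block: "genc k (\<lambda>e. block t (D e) (V e) (N e))"
proof -
  have "genc k (\<lambda>e. toffoli_stage (5 * D e) (5 * D e + 1) (5 * V e + 3) (5 * V e + 4) (N e))"
    unfolding toffoli_stage_def
    by (intro genc_append genc_Cons genc_Nil genc_multiply genc_copy gen_tof_cols vars)
  then show ?thesis
    \<comment> \<open>The stage for T gates refers to block \<open>5 * l\<close> without a summand,
      so its instance is supplied with the summand 0 to be simplified away.\<close>
    using genc_phase_stage[of 1 0]
    unfolding block_def hadamard_stage_def fanout_stage_def
    by (cases t) (simp_all only: if_True if_False add_0_right append_Nil2,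
      (intro genc_append genc_phase_stage genc_row_word genc_multiply genc_parity vars; assumption)+)
qed

end

lemma gen_describe:
  "gen 2 (\<lambda>e. describe (hd (tl e)) (univ t (hd (tl e)) (hd e)))"
proof -
  \<comment> \<open>The environment at the top level is \<open>[d, n]\<close>: register 2, the one
    read last, comes first.\<close>
  have D: "var (Suc (Suc k)) hd" and N: "var (Suc (Suc k)) (\<lambda>e. hd (tl e))" for k
    by (intro var_hd var_tl)+
  have flatten: "concat (map describe_layer (concat Cs)) =
      concat (map (\<lambda>C. concat (map describe_layer C)) Cs)" for Cs
    by (induction Cs) auto
  have loop: "gen (Suc (Suc 0)) (\<lambda>e. concat (map (\<lambda>l. concat (map describe_layer
      (block t (hd e) l (hd (tl e))))) [0..<hd e]))"
  proof (rule gen_loop[OF D])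
    show "gen (Suc (Suc (Suc 0))) (\<lambda>e. concat (map describe_layer
        (block t (hd (tl e)) (hd e) (hd (tl (tl e))))))"
      using genc_block[OF var_tl[OF var_tl[OF var_hd]] var_tl[OF var_hd] var_hd, of 0 t]
      unfolding genc_def .
  qed
  have "(\<lambda>e. describe (hd (tl e)) (univ t (hd (tl e)) (hd e))) =
    (\<lambda>e. binary (hd (tl e)) @ '','' @ binary (5 * (hd e * (hd (tl e) * hd (tl e)))) @ '','' @
      binary (2 * (hd (tl e) * hd (tl e))) @ '':'' @
      concat (map (\<lambda>l. concat (map describe_layer (block t (hd e) l (hd (tl e))))) [0..<hd e]))"
    by (simp add: describe_def univ_def circ_def flatten comp_def)
  moreover have "gen (Suc (Suc 0)) \<dots>"
    by (intro gen_append gen_Cons gen_Nil gen_binary pol_scale pol_times pol_var var_tl D N loop)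
  ultimately show ?thesis by (simp add: numeral_2_eq_2)
qed

theorem logspace_uniform_univ: "logspace_uniform (univ t)"
  using logspace_computable[OF gen_describe[of t]] unfolding logspace_uniform_def by simp

lemma depth_universal_univ:
  assumes "\<And>n. n > 0 \<Longrightarrow> {Hadamard, PiEighth, Fanout 1, Fanout n} \<subseteq> G"
    and "\<And>n. t \<Longrightarrow> n > 0 \<Longrightarrow> Toffoli n \<in> G" "t \<or> (\<forall>k. Toffoli k \<notin> G)"
  shows "depth_universal G (univ t)"
  unfolding depth_universal_def
proof (intro conjI allI impI)
  show "universal_for n (circuits_of_depth G n d) (univ t n d)" if "n > 0" for n d
    using assms that by (intro universal_univ) auto
  show "circuit_over G (num_qubits n (univ t n d)) (layers (univ t n d))" if "n > 0" for n d
    using assms that by (intro circuit_over_univ) auto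
  show "\<exists>c. \<forall>n>0. \<forall>d>0. depth (layers (univ t n d)) \<le> c * d"
    using depth_univ by blast
  have "enc_qubits (univ t n d) \<le> 5 * (n + d) ^ 3" for n d
  proof -
    have "d * (n * n) \<le> (n + d) * ((n + d) * (n + d))" by (intro mult_le_mono) simp_all
    then show ?thesis by (simp add: univ_def power3_eq_cube mult.assoc)
  qed
  then show "\<exists>c k. \<forall>n>0. \<forall>d>0. enc_qubits (univ t n d) \<le> c * (n + d) ^ k" by blast
qed

text \<open>8 = 1 + 5 + 2: the data, the encoding and the ancillas are at most 1, 5 and 2 times n^2
  d, respectively.\<close>

lemma num_qubits_univ:
  assumes "n > 0" "d > 0"
  shows "num_qubits n (univ t n d) \<le> 8 * n\<^sup>2 * d"
proof -
  have "n * 1 \<le> (n * n) * d" "n * n * 1 \<le> n * n * d" using assms by (intro mult_le_mono; simp)+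
  then have "n + 5 * (d * (n * n)) + 2 * (n * n) \<le> 8 * (n * n * d)"
    by (simp only: mult_1_right mult.commute[of d])
  then show ?thesis by (simp add: num_qubits_def univ_def power2_eq_square mult.assoc)
qed

theorem theorem1:
  fixes G :: "gate set"
  assumes "G \<in> {fanout_family, fanout_toffoli_family}"
  shows "\<exists>U. depth_universal G U \<and>
             (\<exists>c. \<forall>n>0. \<forall>d>0. num_qubits n (U n d) \<le> c * n\<^sup>2 * d) \<and>
             logspace_uniform U"
proof -
  define t where "t \<longleftrightarrow> G = fanout_toffoli_family"
  have "t \<or> G = fanout_family" using assms by (auto simp: t_def)
  then have "depth_universal G (univ t)"
    by (intro depth_universal_univ)
      (auto simp: t_def fanout_family_def fanout_toffoli_family_def)
  then show ?thesis using num_qubits_univ logspace_uniform_univ by blast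
qed

end
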